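(* Let $P$ be a semigroup which embeds into a group $G$; regard $P\subseteq G$. There is a canonical isomorphism $C^*_\lambda(P)\cong C(\Omega_P)\rtimes_r G$, where the reduced crossed product is formed with respect to the canonical partial action $G\curvearrowright\Omega_P$, and this isomorphism is determined by $V_p\mapsto W_p$ for all $p\in P$, where $W_g$ denote the canonical partial isometries in the crossed product.
   Context: All semigroups and groups are discrete and countable. For a left cancellative semigroup $P$ and $p\in P$ let $V_p$ be the isometry of $\ell^2P$ with $V_p\delta_x=\delta_{px}$; $C^*_\lambda(P)\subseteq\mathcal L(\ell^2P)$ is the C*-algebra generated by $\{V_p:p\in P\}$. The left inverse hull $I_l(P)$ is the smallest semigroup of partial bijections of $P$ (product = composition on the largest possible domain) that is closed under inverses and contains all maps $P\to pP$, $x\mapsto px$ ($p\in P$). If the nowhere defined map lies in $I_l(P)$ it is denoted $0$; $I_l(P)^\times$ is the set of all elements other than the nowhere defined map. $\mathcal J_P=\{\mathrm{dom}(s):s\in I_l(P)\}$ is the semilattice (under intersection) of constructible right ideals. $\widehat{\mathcal J_P}$ is the set of non-zero maps $\chi:\mathcal J_P\to\{0,1\}$ with $\chi(X\cap Y)=\chi(X)\chi(Y)$, and $\chi(\emptyset)=0$ if $\emptyset\in\mathcal J_P$, with the topology of pointwise convergence. $\Omega_P$ is the spectrum of $D_\lambda(P)=C^*(\{1_X:X\in\mathcal J_P\})\subseteq C^*_\lambda(P)$, identified with the closed subspace of all $\chi\in\widehat{\mathcal J_P}$ such that whenever $X=\bigcup_{i=1}^nX_i$ with $X,X_1,\dots,X_n\in\mathcal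 J_P$ and $\chi(X)=1$, then $\chi(X_i)=1$ for some $i$. For $s\in I_l(P)^\times$ there is a unique $\sigma(s)\in G$ with $s(x)=\sigma(s)x$ for all $x\in\mathrm{dom}(s)$. The partial action of $G$ on $\Omega_P$: $U_{g^{-1}}=\{\chi\in\Omega_P:\chi(\mathrm{dom}(s))=1\text{ for some }s\in I_l(P)^\times\text{ with }\sigma(s)=g\}$ and, for such $\chi,s$, $(g.\chi)(X)=\chi(s^{-1}(X\cap\mathrm{im}(s)))$; this gives homeomorphisms $U_{g^{-1}}\to U_g$. Reduced crossed product of a partial dynamical system $G\curvearrowright X$ (open sets $U_g\subseteq X$, homeomorphisms $U_{g^{-1}}\to U_g$, $x\mapsto g.x$): let $\alpha^*_g:C_0(U_{g^{-1}})\to C_0(U_g)$, $f\mapsto f(g^{-1}.\,\cdot\,)$. $C_0(X)\rtimes^{\ell^1}G$ is the *-algebra of $\ell^1$-sums $\sum_gf_g\delta_g$, $f_g\in C_0(U_g)$, with $(f\delta_g)(\tilde f\delta_h)=\alpha^*_g(\alpha^*_{g^{-1}}(f)\tilde f)\delta_{gh}$ and $(f\delta_g)^*=\alpha^*_{g^{-1}}(f^* )\delta_{g^{-1}}$. On $H=\ell^2G\otimes\ell^2X$ ($X$ viewed as a discrete set) let $\mu(f)(\delta_g\otimes\delta_x)=f(g.x)\,\delta_g\otimes\delta_x$ if $x\in U_{g^{-1}}$ and $0$ otherwise; let $E_g$ be the projection onto $\overline{\mu(C_0(U_{g^{-1}}))H}$ and $V_g=(\lambda_g\otimes I)E_g$,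 with $\lambda$ the left regular representation of $G$. $C_0(X)\rtimes_rG$ is the completion of $C_0(X)\rtimes^{\ell^1}G$ in the norm of the representation $\sum_gf_g\delta_g\mapsto\sum_g\mu(f_g)V_g$. For $X=\Omega_P$ and $p\in P$, the set $U_p=\{\chi\in\Omega_P:\chi(pP)=1\}$ is clopen and $W_p$ is the image of $1_{U_p}\delta_p$. *)

theory Defs
  imports "HOL-Analysis.Analysis"
begin

section \<open>The Hilbert space of square summable families\<close>

typedef 'i ell2 = "{f :: 'i \<Rightarrow> complex. (\<lambda>i. (cmod (f i))\<^sup>2) summable_on UNIV}"
  morphisms coord Abs_ell2
  by (rule exI[of _ "\<lambda>_. 0"]) simp

setup_lifting type_definition_ell2

lemma coord_summable: "(\<lambda>i. (cmod (coord x i))\<^sup>2) summable_on UNIV"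
  using coord[of x] by simp

lemma square_summable_add:
  fixes f g :: "'i \<Rightarrow> complex"
  assumes "(\<lambda>i. (cmod (f i))\<^sup>2) summable_on UNIV" "(\<lambda>i. (cmod (g i))\<^sup>2) summable_on UNIV"
  shows "(\<lambda>i. (cmod (f i + g i))\<^sup>2) summable_on UNIV"
proof (rule summable_on_comparison_test)
  show "(\<lambda>i. 2 * (cmod (f i))\<^sup>2 + 2 * (cmod (g i))\<^sup>2) summable_on UNIV"
    by (intro summable_on_add summable_on_cmult_right assms)
  fix i
  have "(cmod (f i + g i))\<^sup>2 \<le> (cmod (f i) + cmod (g i))\<^sup>2"
    by (intro power_mono norm_triangle_ineq) simp
  also have "\<dots> \<le> 2 * (cmod (f i))\<^sup>2 + 2 * (cmod (g i))\<^sup>2"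
    using sum_squares_bound[of "cmod (f i)" "cmod (g i)"]
    by (simp add: power2_sum)
  finally show "(cmod (f i + g i))\<^sup>2 \<le> 2 * (cmod (f i))\<^sup>2 + 2 * (cmod (g i))\<^sup>2" .
qed simp

lemma square_summable_mult:
  fixes f :: "'i \<Rightarrow> complex"
  assumes "(\<lambda>i. (cmod (f i))\<^sup>2) summable_on UNIV"
  shows "(\<lambda>i. (cmod (c * f i))\<^sup>2) summable_on UNIV"
  using summable_on_cmult_right[OF assms, of "(cmod c)\<^sup>2"]
  by (simp add: norm_mult power_mult_distrib)

lift_definition cscale :: "complex \<Rightarrow> 'i ell2 \<Rightarrow> 'i ell2" is "\<lambda>c f i. c * f i"
  by (simp add: square_summable_mult)

definition cinner :: "'i ell2 \<Rightarrow> 'i ell2 \<Rightarrow> complex" where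
  "cinner x y = (\<Sum>\<^sub>\<infinity>i. cnj (coord x i) * coord y i)"

lemma cinner_summable: "(\<lambda>i. cnj (coord x i) * coord y i) summable_on UNIV"
proof (rule abs_summable_summable, rule summable_on_comparison_test)
  show "(\<lambda>i. (cmod (coord x i))\<^sup>2 + (cmod (coord y i))\<^sup>2) summable_on UNIV"
    by (intro summable_on_add coord_summable)
  fix i
  have "cmod (coord x i) * cmod (coord y i) \<le> 2 * cmod (coord x i) * cmod (coord y i)"
    by simp
  also have "\<dots> \<le> (cmod (coord x i))\<^sup>2 + (cmod (coord y i))\<^sup>2"
    by (rule sum_squares_bound)
  finally show "norm (cnj (coord x i) * coord y i) \<le> (cmod (coord x i))\<^sup>2 + (cmod (coord y i))\<^sup>2"
    by (simp add: norm_mult)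
qed simp

instantiation ell2 :: (type) real_vector
begin

lift_definition zero_ell2 :: "'a ell2" is "\<lambda>_. 0" by simp

lift_definition plus_ell2 :: "'a ell2 \<Rightarrow> 'a ell2 \<Rightarrow> 'a ell2" is "\<lambda>f g i. f i + g i"
  by (simp add: square_summable_add)

lift_definition uminus_ell2 :: "'a ell2 \<Rightarrow> 'a ell2" is "\<lambda>f i. - f i" by simp

definition minus_ell2 :: "'a ell2 \<Rightarrow> 'a ell2 \<Rightarrow> 'a ell2" where "minus_ell2 x y = x + (- y)"

definition scaleR_ell2 :: "real \<Rightarrow> 'a ell2 \<Rightarrow> 'a ell2" where
  "scaleR_ell2 r = cscale (complex_of_real r)"

instance
proof
  fix x y z :: "'a ell2" and r s :: real
  show "x + y + z = x + (y + z)" by transfer (simp add: add.assoc)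
  show "x + y = y + x" by transfer (simp add: add.commute)
  show "0 + x = x" by transfer simp
  show "- x + x = 0" by transfer simp
  show "x - y = x + - y" by (simp add: minus_ell2_def)
  show "r *\<^sub>R (x + y) = r *\<^sub>R x + r *\<^sub>R y"
    unfolding scaleR_ell2_def by transfer (simp add: distrib_left)
  show "(r + s) *\<^sub>R x = r *\<^sub>R x + s *\<^sub>R x"
    unfolding scaleR_ell2_def by transfer (simp add: distrib_right)
  show "r *\<^sub>R s *\<^sub>R x = (r * s) *\<^sub>R x"
    unfolding scaleR_ell2_def by transfer (simp add: mult.assoc)
  show "1 *\<^sub>R x = x" unfolding scaleR_ell2_def by transfer simp
qed

end

instantiation ell2 :: (type) real_inner
begin

definition inner_ell2 :: "'a ell2 \<Rightarrow> 'a ell2 \<Rightarrow> real" where "inner_ell2 x y = Re (cinner x y)"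

definition norm_ell2 :: "'a ell2 \<Rightarrow> real" where
  "norm_ell2 x = sqrt (\<Sum>\<^sub>\<infinity>i. (cmod (coord x i))\<^sup>2)"

definition dist_ell2 :: "'a ell2 \<Rightarrow> 'a ell2 \<Rightarrow> real" where "dist_ell2 x y = norm (x - y)"

definition sgn_ell2 :: "'a ell2 \<Rightarrow> 'a ell2" where "sgn_ell2 x = x /\<^sub>R norm x"

definition uniformity_ell2 :: "('a ell2 \<times> 'a ell2) filter" where
  "uniformity_ell2 = (INF e\<in>{0<..}. principal {(x, y). dist x y < e})"

definition open_ell2 :: "'a ell2 set \<Rightarrow> bool" where
  "open_ell2 U = (\<forall>x\<in>U. \<forall>\<^sub>F (x', y) in uniformity. x' = x \<longrightarrow> y \<in> U)"

instance
proof
  fix x y z :: "'a ell2" and r :: real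
  show "dist x y = norm (x - y)" by (rule dist_ell2_def)
  show "sgn x = x /\<^sub>R norm x" by (rule sgn_ell2_def)
  show "uniformity = (INF e\<in>{0<..}. principal {(x :: 'a ell2, y). dist x y < e})"
    by (rule uniformity_ell2_def)
  show "open U = (\<forall>x\<in>U. \<forall>\<^sub>F (x', y) in uniformity. x' = x \<longrightarrow> y \<in> U)" for U :: "'a ell2 set"
    by (rule open_ell2_def)
  have Re_cinner: "inner u v = (\<Sum>\<^sub>\<infinity>i. Re (cnj (coord u i) * coord v i))" for u v :: "'a ell2"
    unfolding inner_ell2_def cinner_def by (rule infsum_Re[OF cinner_summable, symmetric])
  have Re_summable: "(\<lambda>i. Re (cnj (coord u i) * coord v i)) summable_on UNIV" for u v :: "'a ell2"
    by (rule summable_on_Re[OF cinner_summable])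
  show "inner x y = inner y x"
    unfolding Re_cinner by (simp add: mult.commute)
  have "coord (x + y) = (\<lambda>i. coord x i + coord y i)" by transfer simp
  then show "inner (x + y) z = inner x z + inner y z"
    unfolding Re_cinner infsum_add[OF Re_summable Re_summable, symmetric]
    by (simp add: algebra_simps)
  have "coord (r *\<^sub>R x) = (\<lambda>i. complex_of_real r * coord x i)"
    unfolding scaleR_ell2_def by transfer simp
  then show "inner (r *\<^sub>R x) y = r * inner x y"
    unfolding Re_cinner infsum_cmult_right'[symmetric]
    by (simp add: algebra_simps)
  have inner_self: "inner x x = (\<Sum>\<^sub>\<infinity>i. (cmod (coord x i))\<^sup>2)"
    unfolding Re_cinner by (simp add: cmod_power2, simp add: power2_eq_square)
  show "0 \<le> inner x x"
    unfolding inner_self by (rule infsum_nonneg) simp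
  show "inner x x = 0 \<longleftrightarrow> x = 0"
  proof
    assume "inner x x = 0"
    then have "(cmod (coord x i))\<^sup>2 = 0" for i
      using nonneg_infsum_le_0D[of "\<lambda>i. (cmod (coord x i))\<^sup>2" UNIV i] coord_summable[of x]
      unfolding inner_self by simp
    then have "coord x = coord 0"
      by (auto simp: fun_eq_iff zero_ell2.rep_eq)
    then show "x = 0" by (simp add: coord_inject)
  next
    assume "x = 0"
    then show "inner x x = 0" unfolding inner_self by (simp add: zero_ell2.rep_eq)
  qed
  show "norm x = sqrt (inner x x)"
    unfolding inner_self norm_ell2_def ..
qed

end

lift_definition ket :: "'i \<Rightarrow> 'i ell2" is "\<lambda>j i. if i = j then 1 else 0"
proof -
  fix j :: 'i
  have "(\<lambda>i. (cmod (if i = j then 1 else 0))\<^sup>2) summable_on {j}" by simp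
  then show "(\<lambda>i. (cmod (if i = j then 1 else 0))\<^sup>2) summable_on UNIV"
    by (rule summable_on_cong_neutral[THEN iffD1, rotated -1]) auto
qed


section \<open>Bounded operators and C*-algebras of operators\<close>

text \<open>
  The type \<open>'i ell2 \<Rightarrow>\<^sub>L 'i ell2\<close> consists of the real-linear bounded operators;
  the algebra of bounded operators on \<open>'i ell2\<close> is the subset \<open>bounded_ops\<close>, with
  the operator norm inherited from that type.
\<close>

type_synonym 'i operator = "'i ell2 \<Rightarrow>\<^sub>L 'i ell2"

definition bounded_ops :: "'i operator set" where
  "bounded_ops = {A. \<forall>c x. blinfun_apply A (cscale c x) = cscale c (blinfun_apply A x)}"

lemma norm_cscale: "norm (cscale c x) = cmod c * norm x"
proof -
  have "(\<Sum>\<^sub>\<infinity>i. (cmod (coord (cscale c x) i))\<^sup>2) = (cmod c)\<^sup>2 * (\<Sum>\<^sub>\<infinity>i. (cmod (coord x i))\<^sup>2)"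
    by (simp add: cscale.rep_eq norm_mult power_mult_distrib infsum_cmult_right')
  then show ?thesis by (simp add: norm_ell2_def real_sqrt_mult)
qed

lemma bounded_linear_cscale: "bounded_linear (cscale c)"
proof (rule bounded_linear_intro[where K = "cmod c"])
  show "cscale c (x + y) = cscale c x + cscale c y" for x y
    by transfer (simp add: distrib_left)
  show "cscale c (r *\<^sub>R x) = r *\<^sub>R cscale c x" for r x
    unfolding scaleR_ell2_def by transfer (simp add: mult.left_commute)
  show "norm (cscale c x) \<le> norm x * cmod c" for x
    by (simp add: norm_cscale)
qed

definition op_scale :: "complex \<Rightarrow> 'i operator \<Rightarrow> 'i operator" where
  "op_scale c A = Blinfun (\<lambda>x. cscale c (blinfun_apply A x))"

lemma op_scale_apply: "blinfun_apply (op_scale c A) x = cscale c (blinfun_apply A x)"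
  unfolding op_scale_def
  by (simp add: bounded_linear_Blinfun_apply
      bounded_linear_compose[OF bounded_linear_cscale blinfun.bounded_linear_right])

definition adj :: "'i operator \<Rightarrow> 'i operator" where
  "adj A = (THE B. B \<in> bounded_ops \<and>
     (\<forall>x y. cinner (blinfun_apply B x) y = cinner x (blinfun_apply A y)))"

text \<open>The bounded operator with prescribed values on the standard orthonormal basis.\<close>

definition op_on_basis :: "('i \<Rightarrow> 'i ell2) \<Rightarrow> 'i operator" where
  "op_on_basis v = (THE A. A \<in> bounded_ops \<and> (\<forall>i. blinfun_apply A (ket i) = v i))"

definition proj_onto :: "'i ell2 set \<Rightarrow> 'i operator" where
  "proj_onto M = (THE E. E \<in> bounded_ops \<and>
     (\<forall>x. blinfun_apply E x \<in> M \<and> (\<forall>y\<in>M. cinner y (x - blinfun_apply E x) = 0)))"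

definition cstar_subalgebra :: "'i operator set \<Rightarrow> bool" where
  "cstar_subalgebra B \<longleftrightarrow> B \<subseteq> bounded_ops \<and> closed B \<and> 0 \<in> B \<and>
     (\<forall>S\<in>B. \<forall>T\<in>B. S + T \<in> B \<and> S o\<^sub>L T \<in> B) \<and>
     (\<forall>c. \<forall>S\<in>B. op_scale c S \<in> B) \<and> (\<forall>S\<in>B. adj S \<in> B)"

definition cstar_generated :: "'i operator set \<Rightarrow> 'i operator set" where
  "cstar_generated S = \<Inter>{B. cstar_subalgebra B \<and> S \<subseteq> B}"

definition star_isomorphism ::
    "('i operator \<Rightarrow> 'j operator) \<Rightarrow> 'i operator set \<Rightarrow> 'j operator set \<Rightarrow> bool" where
  "star_isomorphism \<Phi> A B \<longleftrightarrow> bij_betw \<Phi> A B \<and>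
     (\<forall>S\<in>A. \<forall>T\<in>A. \<Phi> (S + T) = \<Phi> S + \<Phi> T \<and> \<Phi> (S o\<^sub>L T) = \<Phi> S o\<^sub>L \<Phi> T) \<and>
     (\<forall>c. \<forall>S\<in>A. \<Phi> (op_scale c S) = op_scale c (\<Phi> S)) \<and>
     (\<forall>S\<in>A. \<Phi> (adj S) = adj (\<Phi> S))"


section \<open>Reduced crossed products of partial dynamical systems\<close>

text \<open>
  Groups and semigroups are written additively, since the library's type class of (not
  necessarily commutative) groups is \<^class>\<open>group_add\<close>. A partial dynamical system is given
  by a family \<open>U\<close> of open sets and maps \<open>\<theta> g\<close> from \<open>U (- g)\<close> onto \<open>U g\<close>; values of \<open>\<theta> g\<close>
  outside \<open>U (- g)\<close> are irrelevant. Elements of \<open>C0 W\<close> are extended by zero off \<open>W\<close>.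
\<close>

definition C0 :: "'x::topological_space set \<Rightarrow> ('x \<Rightarrow> complex) set" where
  "C0 W = {f. continuous_on W f \<and> (\<forall>x. x \<notin> W \<longrightarrow> f x = 0) \<and>
     (\<forall>e>0. compact {x \<in> W. e \<le> cmod (f x)})}"

text \<open>The tensor product of the \<open>\<ell>\<^sup>2\<close>-spaces of \<open>'g\<close> and \<open>'x\<close> is realised as
  \<open>('g \<times> 'x) ell2\<close>.\<close>

definition cp_mu :: "('g::group_add \<Rightarrow> 'x set) \<Rightarrow> ('g \<Rightarrow> 'x \<Rightarrow> 'x) \<Rightarrow> ('x \<Rightarrow> complex)
    \<Rightarrow> ('g \<times> 'x) operator" where
  "cp_mu U \<theta> f = op_on_basis (\<lambda>(g, x). if x \<in> U (- g) then cscale (f (\<theta> g x)) (ket (g, x)) else 0)"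

definition cp_lambda :: "'g::group_add \<Rightarrow> ('g \<times> 'x) operator" where
  "cp_lambda g = op_on_basis (\<lambda>(h, x). ket (g + h, x))"

text \<open>The set of vectors spanned in \<open>cp_E\<close> is closed under complex scaling, so its real span
  is its complex span.\<close>

definition cp_E :: "('g::group_add \<Rightarrow> 'x::topological_space set) \<Rightarrow> ('g \<Rightarrow> 'x \<Rightarrow> 'x) \<Rightarrow> 'g
    \<Rightarrow> ('g \<times> 'x) operator" where
  "cp_E U \<theta> g = proj_onto (closure (span (\<Union>f\<in>C0 (U (- g)). range (blinfun_apply (cp_mu U \<theta> f)))))"

definition cp_V :: "('g::group_add \<Rightarrow> 'x::topological_space set) \<Rightarrow> ('g \<Rightarrow> 'x \<Rightarrow> 'x) \<Rightarrow> 'g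
    \<Rightarrow> ('g \<times> 'x) operator" where
  "cp_V U \<theta> g = cp_lambda g o\<^sub>L cp_E U \<theta> g"

text \<open>A formal sum \<open>\<Sum>\<^sub>g f\<^sub>g \<delta>\<^sub>g\<close> is encoded by its family of coefficients.\<close>

definition cp_ell1 :: "('g::group_add \<Rightarrow> 'x::topological_space set) \<Rightarrow> ('g \<Rightarrow> 'x \<Rightarrow> complex) set" where
  "cp_ell1 U = {a. (\<forall>g. a g \<in> C0 (U g)) \<and> (\<lambda>g. SUP x. cmod (a g x)) summable_on UNIV}"

definition cp_delta :: "('x \<Rightarrow> complex) \<Rightarrow> 'g \<Rightarrow> 'g \<Rightarrow> 'x \<Rightarrow> complex" where
  "cp_delta f g = (\<lambda>h. if h = g then f else (\<lambda>_. 0))"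

definition cp_rep :: "('g::group_add \<Rightarrow> 'x::topological_space set) \<Rightarrow> ('g \<Rightarrow> 'x \<Rightarrow> 'x)
    \<Rightarrow> ('g \<Rightarrow> 'x \<Rightarrow> complex) \<Rightarrow> ('g \<times> 'x) operator" where
  "cp_rep U \<theta> a = (\<Sum>\<^sub>\<infinity>g. cp_mu U \<theta> (a g) o\<^sub>L cp_V U \<theta> g)"

text \<open>The completion of the \<open>\<ell>\<^sup>1\<close>-algebra in the norm \<open>a \<mapsto> \<parallel>cp_rep U \<theta> a\<parallel>\<close> is the norm closure
  of the image of \<open>cp_rep U \<theta>\<close>.\<close>

definition reduced_crossed_product :: "('g::group_add \<Rightarrow> 'x::topological_space set)
    \<Rightarrow> ('g \<Rightarrow> 'x \<Rightarrow> 'x) \<Rightarrow> ('g \<times> 'x) operator set" where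
  "reduced_crossed_product U \<theta> = closure (cp_rep U \<theta> ` cp_ell1 U)"


section \<open>Semigroups and their left inverse hulls\<close>

definition semigroup_isometry :: "'p::semigroup_add \<Rightarrow> 'p operator" where
  "semigroup_isometry p = op_on_basis (\<lambda>x. ket (p + x))"

definition reduced_semigroup_algebra :: "'p::semigroup_add operator set" where
  "reduced_semigroup_algebra = cstar_generated (range semigroup_isometry)"

text \<open>
  Partial bijections are encoded by their graphs: \<open>s O t\<close> is \<open>t\<close> after \<open>s\<close>, the inverse of \<open>s\<close>
  is \<open>s\<inverse>\<close>, and the nowhere defined map is \<open>{}\<close>.
\<close>

inductive_set left_inverse_hull :: "('p::semigroup_add \<times> 'p) set set" where
  translation: "range (\<lambda>x. (x, p + x)) \<in> left_inverse_hull"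
| inverse: "s \<in> left_inverse_hull \<Longrightarrow> s\<inverse> \<in> left_inverse_hull"
| product: "s \<in> left_inverse_hull \<Longrightarrow> t \<in> left_inverse_hull \<Longrightarrow> s O t \<in> left_inverse_hull"

definition constructible_ideals :: "'p::semigroup_add set set" where
  "constructible_ideals = Domain ` left_inverse_hull"

text \<open>Maps on the semilattice of constructible ideals with values in \<open>{0, 1}\<close> are encoded as
  predicates which are false outside the semilattice.\<close>

definition semilattice_characters :: "('p::semigroup_add set \<Rightarrow> bool) set" where
  "semilattice_characters = {\<omega>.
     (\<forall>X. X \<notin> constructible_ideals \<longrightarrow> \<not> \<omega> X) \<and>
     (\<exists>X\<in>constructible_ideals. \<omega> X) \<and>
     (\<forall>X\<in>constructible_ideals. \<forall>Y\<in>constructible_ideals. \<omega> (X \<inter> Y) \<longleftrightarrow> \<omega> X \<and> \<omega> Y) \<and>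
     (({} :: 'p set) \<in> constructible_ideals \<longrightarrow> \<not> \<omega> {})}"

lemma left_inverse_hull_single_valued:
  fixes s :: "('p::cancel_semigroup_add \<times> 'p) set"
  assumes "s \<in> left_inverse_hull"
  shows "single_valued s \<and> single_valued (s\<inverse>)"
  using assms
proof induction
  case (translation p)
  show ?case by (auto simp: single_valued_def)
qed (auto simp: converse_relcomp single_valued_relcomp)

lemma constructible_ideals_Int:
  fixes X Y :: "'p::cancel_semigroup_add set"
  assumes "X \<in> constructible_ideals" "Y \<in> constructible_ideals"
  shows "X \<inter> Y \<in> constructible_ideals"
proof -
  from assms obtain s t where st: "s \<in> left_inverse_hull" "t \<in> left_inverse_hull"
    and XY: "X = Domain s" "Y = Domain t"
    by (auto simp: constructible_ideals_def)
  have idem: "u O u\<inverse> = Id_on (Domain u)" if "u \<in> left_inverse_hull" for u :: "('p \<times> 'p) set"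
    using left_inverse_hull_single_valued[OF that]
    by (auto simp: single_valued_def Id_on_def)
  have "(s O s\<inverse>) O (t O t\<inverse>) \<in> left_inverse_hull"
    by (intro left_inverse_hull.intros st)
  moreover have "Domain ((s O s\<inverse>) O (t O t\<inverse>)) = X \<inter> Y"
    unfolding idem[OF st(1)] idem[OF st(2)] XY by (auto simp: Id_on_def)
  ultimately show ?thesis unfolding constructible_ideals_def by blast
qed

lemma UNIV_constructible: "UNIV \<in> constructible_ideals"
proof -
  have "Domain (range (\<lambda>x. (x, p + x))) = UNIV" for p :: 'a by auto
  then show ?thesis
    unfolding constructible_ideals_def
    by (metis image_eqI left_inverse_hull.translation)
qed

text \<open>Cancellativity makes the semilattice closed under intersection, so that the defining
  conditions are satisfiable; it holds in every semigroup that embeds into a group.\<close>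

typedef (overloaded) ('p::cancel_semigroup_add) Omega =
  "{\<omega> :: 'p set \<Rightarrow> bool. \<omega> \<in> semilattice_characters \<and> (\<forall>X\<in>constructible_ideals. \<forall>\<F>. finite \<F> \<longrightarrow>
      \<F> \<subseteq> constructible_ideals \<longrightarrow> X = \<Union>\<F> \<longrightarrow> \<omega> X \<longrightarrow> (\<exists>Y\<in>\<F>. \<omega> Y))}"
  morphisms character Abs_Omega
proof -
  fix x :: 'p
  have "(\<lambda>X. X \<in> constructible_ideals \<and> x \<in> X) \<in> semilattice_characters"
    using UNIV_constructible by (auto simp: semilattice_characters_def constructible_ideals_Int)
  then show ?thesis
    by (intro exI[of _ "\<lambda>X. X \<in> constructible_ideals \<and> x \<in> X"]) auto
qed

text \<open>The library topology on functions is that of pointwise convergence.\<close>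

instantiation Omega :: (cancel_semigroup_add) topological_space
begin

definition open_Omega :: "'a Omega set \<Rightarrow> bool" where
  "open_Omega W \<longleftrightarrow> (\<exists>V. open V \<and> W = character -` V)"

instance
proof
  show "open (UNIV :: 'a Omega set)"
    unfolding open_Omega_def by (rule exI[of _ UNIV]) simp
  show "open (S \<inter> T)" if "open S" "open T" for S T :: "'a Omega set"
    using that unfolding open_Omega_def by (metis open_Int vimage_Int)
  show "open (\<Union>K)" if "\<forall>S\<in>K. open S" for K :: "'a Omega set set"
  proof -
    from that obtain V where V: "\<And>S. S \<in> K \<Longrightarrow> open (V S) \<and> S = character -` V S"
      unfolding open_Omega_def by metis
    then have "open (\<Union>S\<in>K. V S)" "\<Union>K = character -` (\<Union>S\<in>K. V S)" by auto
    then show ?thesis unfolding open_Omega_def by blast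
  qed
qed

end


section \<open>The canonical partial action\<close>

text \<open>The parameter \<open>\<iota>\<close> is the embedding of the semigroup into the group.\<close>

definition group_value :: "('p::cancel_semigroup_add \<Rightarrow> 'g::group_add) \<Rightarrow> ('p \<times> 'p) set \<Rightarrow> 'g" where
  "group_value \<iota> s = (THE g. \<forall>(x, y)\<in>s. \<iota> y = g + \<iota> x)"

definition Omega_dom :: "('p::cancel_semigroup_add \<Rightarrow> 'g::group_add) \<Rightarrow> 'g \<Rightarrow> 'p Omega set" where
  "Omega_dom \<iota> g = {\<omega>. \<exists>s\<in>left_inverse_hull. s \<noteq> {} \<and> group_value \<iota> s = - g \<and>
     character \<omega> (Domain s)}"

definition Omega_act :: "('p::cancel_semigroup_add \<Rightarrow> 'g::group_add) \<Rightarrow> 'g \<Rightarrow> 'p Omega \<Rightarrow> 'p Omega" where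
  "Omega_act \<iota> g \<omega> = (THE \<psi>. \<forall>s\<in>left_inverse_hull.
     s \<noteq> {} \<and> group_value \<iota> s = g \<and> character \<omega> (Domain s) \<longrightarrow>
     (\<forall>X\<in>constructible_ideals. character \<psi> X \<longleftrightarrow> character \<omega> (s\<inverse> `` (X \<inter> Range s))))"

definition canonical_isometry ::
    "('p::cancel_semigroup_add \<Rightarrow> 'g::group_add) \<Rightarrow> 'p \<Rightarrow> ('g \<times> 'p Omega) operator" where
  "canonical_isometry \<iota> p = cp_rep (Omega_dom \<iota>) (Omega_act \<iota>)
     (cp_delta (\<lambda>\<omega>. of_bool (character \<omega> (range (\<lambda>x. p + x)))) (\<iota> p))"

end

theory Submission
  imports Defs
begin

text \<open>
  The left inverse hull acts on \<open>\<ell>\<^sup>2 P\<close> by partial isometries, and on \<open>\<ell>\<^sup>2 (G \<times> \<Omega>)\<close> by the partial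
  isometries of the partial bijections \<open>lift s\<close>: think of the basis vector \<open>(k, \<omega>)\<close> as the
  point \<open>k.\<omega>\<close> of the spectrum and let \<open>s\<close> translate it if \<open>k.\<omega>\<close> lies in the domain of \<open>s\<close>.
  Both assignments respect products and inverses. The reduced semigroup algebra is the closed
  linear span of the first family (\<open>reduced_semigroup_algebra_eq\<close>) and the reduced crossed
  product is the closed linear span of the second (\<open>reduced_crossed_product_eq\<close>). The latter
  uses that the indicator functions of constructible ideals generate the continuous functions on
  the compact spectrum, and that \<open>lift s\<close> is translation by the group element of \<open>s\<close>, cut
  down to the clopen set of characters with value one on the range of \<open>s\<close>.

  It remains to see that a linear combination of the operators of the \<open>s\<close> has the same norm as the
  corresponding combination of the operators of the \<open>lift s\<close>. The first representation is the
  orthogonal sum of its restrictions to the orbits of the left inverse hull in \<open>P\<close>, the second one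
  of its restrictions to the fibres \<open>G \<times> {\<omega>}\<close>, so norms can be computed on blocks
  (\<open>norm_le_of_block_bounds\<close>). The fibre over the character of a point \<open>q\<close> contains a copy of
  the orbit of \<open>q\<close>, which gives one inequality. For the other one, let a combination act on a
  finitely supported vector in the fibre over an arbitrary \<open>\<omega>\<close>. The result depends only on the
  values of \<open>\<omega>\<close> on finitely many ideals (\<open>orbit_map_intertwines\<close>). The covering condition that
  cuts out the spectrum provides a point \<open>q\<close> whose character has the same values
  (\<open>point_matching_character\<close>), and on the orbit of \<open>q\<close> the combination has norm at most its norm
  on \<open>\<ell>\<^sup>2 P\<close>.

  An isometric linear relation that respects products and adjoints extends to an isomorphism of
  the closures (\<open>star_isomorphism_of_isometric_relation\<close>). Two isomorphisms that agree on the
  generators agree on the closed algebra that these generate, since star homomorphisms are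
  contractive (\<open>star_isomorphism_agree\<close>).
\<close>

section \<open>Square summable families and their standard basis\<close>

lemmas coord_simps [simp] =
  plus_ell2.rep_eq zero_ell2.rep_eq uminus_ell2.rep_eq cscale.rep_eq ket.rep_eq

lemma coord_diff [simp]: "coord (x - y) i = coord x i - coord y i"
  by (simp only: minus_ell2_def coord_simps) simp

lemma coord_scaleR [simp]: "coord (r *\<^sub>R x) i = complex_of_real r * coord x i"
  by (simp add: scaleR_ell2_def)

lemma coord_sum [simp]: "coord (sum f F) i = (\<Sum>a\<in>F. coord (f a) i)"
  by (induction F rule: infinite_finite_induct) auto

lemma ell2_eqI: "(\<And>i. coord x i = coord y i) \<Longrightarrow> x = y"
  by (metis coord_inject ext)

lemma scaleR_eq_cscale: "r *\<^sub>R x = cscale (complex_of_real r) x"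
  by (simp add: scaleR_ell2_def)

lemma cscale_add_right: "cscale c (x + y) = cscale c x + cscale c y"
  by (intro ell2_eqI) (simp add: algebra_simps)

lemma cscale_diff_right: "cscale c (x - y) = cscale c x - cscale c y"
  by (intro ell2_eqI) (simp add: algebra_simps)

lemma cscale_cscale [simp]: "cscale c (cscale d x) = cscale (c * d) x"
  by (intro ell2_eqI) (simp add: algebra_simps)

lemma cscale_1 [simp]: "cscale 1 x = x" and cscale_0_left [simp]: "cscale 0 x = 0"
  and cscale_0_right [simp]: "cscale c 0 = 0"
  by (intro ell2_eqI; simp)+

lemma norm_ell2_square: "(norm x)\<^sup>2 = (\<Sum>\<^sub>\<infinity>i. (cmod (coord x i))\<^sup>2)"
  unfolding norm_ell2_def by (intro real_sqrt_pow2 infsum_nonneg) simp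

lemma sum_coord_le_norm:
  assumes "finite F"
  shows "(\<Sum>i\<in>F. (cmod (coord x i))\<^sup>2) \<le> (norm x)\<^sup>2"
  unfolding norm_ell2_square by (rule finite_sum_le_infsum[OF coord_summable assms]) auto

lemma coord_le_norm: "cmod (coord x i) \<le> norm x"
  using sum_coord_le_norm[of "{i}" x] by (simp add: power2_le_iff_abs_le)

lemma ell2_of_bounded_finite_sums:
  assumes "\<And>F. finite F \<Longrightarrow> (\<Sum>i\<in>F. (cmod (f i))\<^sup>2) \<le> C\<^sup>2" and "0 \<le> C"
  obtains x where "coord x = f" "norm x \<le> C"
proof -
  have s: "(\<lambda>i. (cmod (f i))\<^sup>2) summable_on UNIV"
    by (rule nonneg_bdd_above_summable_on) (auto intro!: bdd_aboveI[of _ "C\<^sup>2"] assms)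
  then have c: "coord (Abs_ell2 f) = f" by (simp add: Abs_ell2_inverse)
  have "(norm (Abs_ell2 f))\<^sup>2 \<le> C\<^sup>2"
    unfolding norm_ell2_square c by (rule infsum_le_finite_sums[OF s]) (rule assms)
  then show thesis using that[OF c] assms(2) by (simp add: power2_le_iff_abs_le)
qed

lemma coord_ket_sum:
  "finite F \<Longrightarrow> coord (\<Sum>i\<in>F. cscale (c i) (ket i)) j = (if j \<in> F then c j else 0)"
  by (simp add: if_distrib cong: if_cong)

lemma norm_ket_sum:
  assumes "finite F"
  shows "(norm (\<Sum>i\<in>F. cscale (c i) (ket i)))\<^sup>2 = (\<Sum>i\<in>F. (cmod (c i))\<^sup>2)"
proof -
  have "(norm (\<Sum>i\<in>F. cscale (c i) (ket i)))\<^sup>2 = (\<Sum>\<^sub>\<infinity>i\<in>F. (cmod (c i))\<^sup>2)"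
    unfolding norm_ell2_square by (rule infsum_cong_neutral) (auto simp: coord_ket_sum[OF assms] simp del: coord_sum)
  then show ?thesis using assms by simp
qed

lemma ket_expansion_approx:
  assumes "0 < e"
  shows "\<exists>F. finite F \<and> norm (x - (\<Sum>i\<in>F. cscale (coord x i) (ket i))) < e"
proof -
  let ?f = "\<lambda>i. (cmod (coord x i))\<^sup>2"
  from assms have "0 < e\<^sup>2 / 2" by simp
  from infsum_finite_approximation[OF coord_summable[of x] this]
  obtain F where F: "finite F" "dist (sum ?f F) (infsum ?f UNIV) \<le> e\<^sup>2 / 2" by auto
  let ?y = "x - (\<Sum>i\<in>F. cscale (coord x i) (ket i))"
  have "coord ?y j = (if j \<in> F then 0 else coord x j)" for j
    using coord_ket_sum[OF F(1), of "coord x"] by simp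
  then have "(norm ?y)\<^sup>2 = infsum ?f (UNIV - F)"
    unfolding norm_ell2_square by (intro infsum_cong_neutral) auto
  also have "\<dots> = infsum ?f UNIV - sum ?f F"
    using infsum_Diff[OF coord_summable[of x], of F] F(1) by simp
  also have "\<dots> < e\<^sup>2" using F(2) \<open>0 < e\<^sup>2 / 2\<close> unfolding dist_real_def by linarith
  finally show ?thesis using F(1) assms by (metis power_less_imp_less_base less_eq_real_def)
qed

text \<open>Only the coordinates in the support of the vector are tested. So this serves to show both that
  the finitely supported vectors are dense and that a closed span is everything supported on a
  given set of indices.\<close>

lemma closed_subspace_contains_expansion:
  assumes M: "subspace M" "closed M"
    and ket: "\<And>i. coord x i \<noteq> 0 \<Longrightarrow> cscale (coord x i) (ket i) \<in> M"
  shows "x \<in> M"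
proof -
  have "cscale (coord x i) (ket i) \<in> M" for i
    using ket[of i] subspace_0[OF M(1)] by (cases "coord x i = 0") auto
  then have "(\<Sum>i\<in>F. cscale (coord x i) (ket i)) \<in> M" for F
    by (intro subspace_sum[OF M(1)])
  then have "x \<in> closure M"
    unfolding closure_approachable
    using ket_expansion_approx[of _ x] by (metis dist_norm norm_minus_commute)
  then show ?thesis using M(2) by simp
qed

lemma bounded_linear_eq_on_kets:
  assumes f: "bounded_linear f" and g: "bounded_linear g"
    and eq: "\<And>c i. f (cscale c (ket i)) = g (cscale c (ket i))"
  shows "f x = g x"
proof -
  have "x \<in> {x. f x - g x = 0}"
  proof (rule closed_subspace_contains_expansion)
    have "linear (\<lambda>x. f x - g x)"
      using bounded_linear_sub[OF f g] bounded_linear.linear by blast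
    then show "subspace {x. f x - g x = 0}"
      by (rule linear_subspace_kernel)
    show "closed {x. f x - g x = 0}"
      by (intro closed_Collect_eq continuous_intros linear_continuous_on f g)
  qed (simp add: eq)
  then show ?thesis by simp
qed

instance ell2 :: (type) banach
proof
  fix X :: "nat \<Rightarrow> 'a ell2"
  assume X: "Cauchy X"
  have "Cauchy (\<lambda>n. coord (X n) i)" for i
  proof (rule metric_CauchyI)
    fix e :: real assume "0 < e"
    with X obtain N where "\<forall>m\<ge>N. \<forall>n\<ge>N. dist (X m) (X n) < e"
      using metric_CauchyD by blast
    moreover have "dist (coord (X m) i) (coord (X n) i) \<le> dist (X m) (X n)" for m n
      using coord_le_norm[of "X m - X n" i] by (simp add: dist_norm)
    ultimately have "\<forall>m\<ge>N. \<forall>n\<ge>N. dist (coord (X m) i) (coord (X n) i) < e"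
      by (smt (verit))
    then show "\<exists>N. \<forall>m\<ge>N. \<forall>n\<ge>N. dist (coord (X m) i) (coord (X n) i) < e" ..
  qed
  then obtain f where f: "\<And>i. (\<lambda>n. coord (X n) i) \<longlonglongrightarrow> f i"
    unfolding Cauchy_convergent_iff convergent_def by metis
  \<comment> \<open>a bound on the tails of the sequence passes to the coordinatewise limit, finite sum by
     finite sum\<close>
  have tail: "\<exists>y. coord y = (\<lambda>i. f i - coord (X n) i) \<and> norm y \<le> e"
    if e: "0 < e" and n: "\<forall>m\<ge>N. \<forall>n\<ge>N. dist (X m) (X n) < e" "N \<le> n" for e N n
  proof -
    have "(\<Sum>i\<in>F. (cmod (f i - coord (X n) i))\<^sup>2) \<le> e\<^sup>2" if "finite F" for F
    proof (rule LIMSEQ_le_const2)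
      show "(\<lambda>m. \<Sum>i\<in>F. (cmod (coord (X m) i - coord (X n) i))\<^sup>2)
          \<longlonglongrightarrow> (\<Sum>i\<in>F. (cmod (f i - coord (X n) i))\<^sup>2)"
        by (intro tendsto_intros f)
      have "(\<Sum>i\<in>F. (cmod (coord (X m) i - coord (X n) i))\<^sup>2) \<le> e\<^sup>2" if "N \<le> m" for m
      proof -
        have "(\<Sum>i\<in>F. (cmod (coord (X m - X n) i))\<^sup>2) \<le> (norm (X m - X n))\<^sup>2"
          by (rule sum_coord_le_norm) fact
        also have "\<dots> \<le> e\<^sup>2"
          using n that by (intro power_mono) (auto simp: dist_norm less_imp_le)
        finally show ?thesis by simp
      qed
      then show "\<exists>N. \<forall>m\<ge>N. (\<Sum>i\<in>F. (cmod (coord (X m) i - coord (X n) i))\<^sup>2) \<le> e\<^sup>2" by blast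
    qed
    from ell2_of_bounded_finite_sums[OF this less_imp_le[OF e]] show ?thesis by metis
  qed
  obtain N1 where N1: "\<forall>m\<ge>N1. \<forall>n\<ge>N1. dist (X m) (X n) < 1"
    using metric_CauchyD[OF X, of 1] by auto
  from tail[OF _ N1 order_refl] obtain y where y: "coord y = (\<lambda>i. f i - coord (X N1) i)" by auto
  define x where "x = y + X N1"
  have x: "coord x = f" by (simp add: x_def y fun_eq_iff)
  have "X \<longlonglongrightarrow> x"
  proof (rule metric_LIMSEQ_I)
    fix e :: real assume "0 < e"
    then have e2: "0 < e/2" by simp
    obtain N where N: "\<forall>m\<ge>N. \<forall>n\<ge>N. dist (X m) (X n) < e/2" using metric_CauchyD[OF X e2] by auto
    have "dist (X n) x < e" if "n \<ge> N" for n
    proof -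
      from tail[OF e2 N that] obtain z where "coord z = (\<lambda>i. f i - coord (X n) i)" "norm z \<le> e/2"
        by auto
      moreover from this have "z = x - X n" by (intro ell2_eqI) (simp add: x)
      ultimately show ?thesis using \<open>0 < e\<close> by (simp add: dist_norm norm_minus_commute)
    qed
    then show "\<exists>N. \<forall>n\<ge>N. dist (X n) x < e" by blast
  qed
  then show "convergent X" by (auto simp: convergent_def)
qed


section \<open>Adjoints\<close>

lemma cinner_cscale_right: "cinner x (cscale c y) = c * cinner x y"
  unfolding cinner_def by (subst infsum_cmult_right'[symmetric]) (simp add: algebra_simps)

lemma cinner_eq_inner: "cinner x y = Complex (inner x y) (- inner x (cscale \<i> y))"
  by (simp add: inner_ell2_def cinner_cscale_right complex_eq_iff)

lemma cinner_ket_right: "cinner x (ket i) = cnj (coord x i)"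
proof -
  have "cinner x (ket i) = (\<Sum>\<^sub>\<infinity>j\<in>{i}. cnj (coord x j) * coord (ket i) j)"
    unfolding cinner_def by (rule infsum_cong_neutral) auto
  then show ?thesis by simp
qed

lemma inner_cscale_ket: "inner x (cscale c (ket i)) = Re (c * cnj (coord x i))"
  by (simp add: inner_ell2_def cinner_cscale_right cinner_ket_right)

lemma inner_cscale_left: "inner (cscale c x) y = inner x (cscale (cnj c) y)"
  unfolding inner_ell2_def cinner_def by (simp add: algebra_simps)

lemma ell2_eq_by_inner: "(\<And>y. inner u y = inner v y) \<Longrightarrow> u = (v :: 'a ell2)"
  using vector_eq_rdot[of u v] by blast

lemma bounded_opsD: "A \<in> bounded_ops \<Longrightarrow> blinfun_apply A (cscale c x) = cscale c (blinfun_apply A x)"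
  by (simp add: bounded_ops_def)

text \<open>A complex linear operator is already determined by the real inner product, so that
  adjoints can be computed with the real inner product alone.\<close>

lemma adjoint_iff_inner:
  assumes "A \<in> bounded_ops"
  shows "(\<forall>x y. cinner (blinfun_apply B x) y = cinner x (blinfun_apply A y)) \<longleftrightarrow>
    (\<forall>x y. inner (blinfun_apply B x) y = inner x (blinfun_apply A y))"
  unfolding cinner_eq_inner complex_eq_iff
  using bounded_opsD[OF assms] by auto

text \<open>The coordinates of the adjoint at a vector are forced. Applying \<open>A\<close> to a finite truncation
  of the resulting family and pairing with the vector returns the squared norm of the truncation,
  which bounds it by \<open>norm A\<close>.\<close>

lemma adjoint_exists:
  assumes A: "A \<in> bounded_ops"
  shows "\<exists>B\<in>bounded_ops. norm B \<le> norm A \<and>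
    (\<forall>x y. inner (blinfun_apply B x) y = inner x (blinfun_apply A y))"
proof -
  have "\<exists>z. norm z \<le> norm A * norm x \<and> (\<forall>y. inner z y = inner x (blinfun_apply A y))" for x
  proof -
    let ?z = "\<lambda>i. cnj (cinner x (blinfun_apply A (ket i)))"
    have "(\<Sum>i\<in>F. (cmod (?z i))\<^sup>2) \<le> (norm A * norm x)\<^sup>2" if F: "finite F" for F
    proof -
      define zF where "zF = (\<Sum>i\<in>F. cscale (?z i) (ket i))"
      have n: "(norm zF)\<^sup>2 = (\<Sum>i\<in>F. (cmod (?z i))\<^sup>2)"
        unfolding zF_def by (rule norm_ket_sum) fact
      have "inner x (blinfun_apply A zF) = (\<Sum>i\<in>F. inner x (cscale (?z i) (blinfun_apply A (ket i))))"
        by (simp add: zF_def blinfun.sum_right inner_sum_right bounded_opsD[OF A])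
      also have "\<dots> = (\<Sum>i\<in>F. (cmod (?z i))\<^sup>2)"
        by (intro sum.cong refl)
          (simp add: inner_ell2_def cinner_cscale_right cmod_power2, simp add: power2_eq_square)
      finally have "(norm zF)\<^sup>2 = inner x (blinfun_apply A zF)" using n by simp
      also have "\<dots> \<le> norm x * (norm A * norm zF)"
        by (meson norm_blinfun norm_cauchy_schwarz mult_left_mono norm_ge_zero order_trans)
      finally have "norm zF * norm zF \<le> (norm A * norm x) * norm zF"
        by (simp add: power2_eq_square algebra_simps)
      then have "norm zF \<le> norm A * norm x"
        by (cases "norm zF = 0") (auto simp: mult_le_cancel_right)
      then show ?thesis unfolding n[symmetric] by (intro power_mono) auto
    qed
    then obtain z where z: "coord z = ?z" "norm z \<le> norm A * norm x"
      by (rule ell2_of_bounded_finite_sums) auto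
    have "inner z y = inner x (blinfun_apply A y)" for y
    proof (rule bounded_linear_eq_on_kets[of "inner z"])
      show "bounded_linear (inner z)" by (rule bounded_linear_inner_right)
      show "bounded_linear (\<lambda>y. inner x (blinfun_apply A y))"
        by (intro bounded_linear_compose[OF bounded_linear_inner_right] blinfun.bounded_linear_right)
      show "inner z (cscale c (ket i)) = inner x (blinfun_apply A (cscale c (ket i)))" for c i
        unfolding inner_cscale_ket z
        by (simp add: bounded_opsD[OF A] inner_ell2_def cinner_cscale_right)
    qed
    with z show ?thesis by blast
  qed
  then obtain b where b: "\<And>x. norm (b x) \<le> norm A * norm x"
    "\<And>x y. inner (b x) y = inner x (blinfun_apply A y)" by metis
  have bl: "bounded_linear b"
  proof (rule bounded_linear_intro[where K = "norm A"])
    show "b (x + y) = b x + b y" for x y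
      by (rule ell2_eq_by_inner) (simp add: b inner_add_left)
    show "b (r *\<^sub>R x) = r *\<^sub>R b x" for r x
      by (rule ell2_eq_by_inner) (simp add: b)
    show "norm (b x) \<le> norm x * norm A" for x using b(1)[of x] by (simp add: mult.commute)
  qed
  show ?thesis
  proof (intro bexI conjI allI)
    show "norm (Blinfun b) \<le> norm A"
      by (rule norm_blinfun_bound) (auto simp: bounded_linear_Blinfun_apply[OF bl] b)
    show "inner (blinfun_apply (Blinfun b) x) y = inner x (blinfun_apply A y)" for x y
      by (simp add: bounded_linear_Blinfun_apply[OF bl] b)
    have "b (cscale c x) = cscale c (b x)" for c x
      by (rule ell2_eq_by_inner) (simp add: b inner_cscale_left bounded_opsD[OF A])
    then show "Blinfun b \<in> bounded_ops"
      by (simp add: bounded_ops_def bounded_linear_Blinfun_apply[OF bl])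
  qed
qed

lemma adj_unique:
  assumes A: "A \<in> bounded_ops" and B: "B \<in> bounded_ops"
    and *: "\<And>x y. inner (blinfun_apply B x) y = inner x (blinfun_apply A y)"
  shows "adj A = B"
  unfolding adj_def
proof (rule the_equality)
  show "B \<in> bounded_ops \<and> (\<forall>x y. cinner (blinfun_apply B x) y = cinner x (blinfun_apply A y))"
    using B * adjoint_iff_inner[OF A] by blast
  fix C assume "C \<in> bounded_ops \<and> (\<forall>x y. cinner (blinfun_apply C x) y = cinner x (blinfun_apply A y))"
  then have "inner (blinfun_apply C x) y = inner (blinfun_apply B x) y" for x y
    using adjoint_iff_inner[OF A] * by metis
  then show "C = B" by (intro blinfun_eqI ell2_eq_by_inner)
qed

lemma
  assumes A: "A \<in> bounded_ops"
  shows adj_bounded_ops: "adj A \<in> bounded_ops"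
    and inner_adj: "inner (blinfun_apply (adj A) x) y = inner x (blinfun_apply A y)"
    and norm_adj_le: "norm (adj A) \<le> norm A"
proof -
  obtain B where B: "B \<in> bounded_ops" "norm B \<le> norm A"
    "\<And>x y. inner (blinfun_apply B x) y = inner x (blinfun_apply A y)"
    using adjoint_exists[OF A] by blast
  then have "adj A = B" by (intro adj_unique[OF A])
  with B show "adj A \<in> bounded_ops" "norm (adj A) \<le> norm A"
    "inner (blinfun_apply (adj A) x) y = inner x (blinfun_apply A y)" by auto
qed

lemma adj_adj: "A \<in> bounded_ops \<Longrightarrow> adj (adj A) = A"
  by (intro adj_unique adj_bounded_ops)
    (simp_all add: inner_adj inner_commute[of _ "blinfun_apply (adj A) _"] inner_commute[of "blinfun_apply A _"])

lemma norm_adj: "A \<in> bounded_ops \<Longrightarrow> norm (adj A) = norm A"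
  by (metis adj_adj adj_bounded_ops norm_adj_le order_antisym)

lemma bounded_ops_add: "A \<in> bounded_ops \<Longrightarrow> B \<in> bounded_ops \<Longrightarrow> A + B \<in> bounded_ops"
  by (simp add: bounded_ops_def blinfun.add_left cscale_add_right)

lemma bounded_ops_diff: "A \<in> bounded_ops \<Longrightarrow> B \<in> bounded_ops \<Longrightarrow> A - B \<in> bounded_ops"
  by (simp add: bounded_ops_def blinfun.diff_left cscale_diff_right)

lemma bounded_ops_compose: "A \<in> bounded_ops \<Longrightarrow> B \<in> bounded_ops \<Longrightarrow> A o\<^sub>L B \<in> bounded_ops"
  by (simp add: bounded_ops_def)

lemma bounded_ops_op_scale: "A \<in> bounded_ops \<Longrightarrow> op_scale c A \<in> bounded_ops"
  by (simp add: bounded_ops_def op_scale_apply mult.commute)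

lemma bounded_ops_0: "0 \<in> bounded_ops"
  by (simp add: bounded_ops_def)

lemma closed_bounded_ops: "closed bounded_ops"
proof -
  have "bounded_ops = (\<Inter>c x. {A :: 'a operator. blinfun_apply A (cscale c x) = cscale c (blinfun_apply A x)})"
    by (auto simp: bounded_ops_def)
  also have "closed \<dots>"
    by (intro closed_INT ballI closed_Collect_eq bounded_linear.continuous_on[OF bounded_linear_cscale]
        bounded_linear.continuous_on[OF blinfun.bounded_linear_left] continuous_on_id)
  finally show ?thesis .
qed

lemma op_scale_of_real: "op_scale (complex_of_real r) A = r *\<^sub>R A"
  by (rule blinfun_eqI) (simp add: op_scale_apply blinfun.scaleR_left scaleR_eq_cscale)

lemma op_scale_minus_1: "op_scale (- 1) A = - A"
  using op_scale_of_real[of "- 1" A] by simp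

lemma bounded_linear_op_scale: "bounded_linear (op_scale c)"
proof (rule bounded_linear_intro[where K = "cmod c"])
  show "op_scale c (A + B) = op_scale c A + op_scale c B" for A B :: "'a operator"
    by (rule blinfun_eqI) (simp add: op_scale_apply blinfun.add_left cscale_add_right)
  show "op_scale c (r *\<^sub>R A) = r *\<^sub>R op_scale c A" for r and A :: "'a operator"
    by (rule blinfun_eqI) (simp add: op_scale_apply blinfun.scaleR_left scaleR_eq_cscale mult.commute)
  show "norm (op_scale c A) \<le> norm A * cmod c" for A :: "'a operator"
  proof (rule norm_blinfun_bound)
    show "norm (blinfun_apply (op_scale c A) x) \<le> norm A * cmod c * norm x" for x
      using mult_left_mono[OF norm_blinfun[of A x] norm_ge_zero[of c]]
      by (simp add: op_scale_apply norm_cscale mult_ac)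
  qed simp
qed

lemma op_scale_op_scale: "op_scale c (op_scale d A) = op_scale (c * d) A"
  by (rule blinfun_eqI) (simp add: op_scale_apply)

lemma op_scale_compose:
  assumes "A \<in> bounded_ops"
  shows "op_scale c A o\<^sub>L op_scale d B = op_scale (c * d) (A o\<^sub>L B)"
  by (rule blinfun_eqI) (simp add: op_scale_apply bounded_opsD[OF assms])

lemma adj_add: "A \<in> bounded_ops \<Longrightarrow> B \<in> bounded_ops \<Longrightarrow> adj (A + B) = adj A + adj B"
  by (intro adj_unique bounded_ops_add adj_bounded_ops)
    (simp_all add: blinfun.add_left inner_add_left inner_add_right inner_adj)

lemma adj_diff: "A \<in> bounded_ops \<Longrightarrow> B \<in> bounded_ops \<Longrightarrow> adj (A - B) = adj A - adj B"
  by (intro adj_unique bounded_ops_diff adj_bounded_ops)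
    (simp_all add: blinfun.diff_left inner_diff_left inner_diff_right inner_adj)

lemma adj_compose: "A \<in> bounded_ops \<Longrightarrow> B \<in> bounded_ops \<Longrightarrow> adj (A o\<^sub>L B) = adj B o\<^sub>L adj A"
  by (intro adj_unique bounded_ops_compose adj_bounded_ops) (simp_all add: inner_adj)

lemma adj_op_scale: "A \<in> bounded_ops \<Longrightarrow> adj (op_scale c A) = op_scale (cnj c) (adj A)"
  by (intro adj_unique bounded_ops_op_scale adj_bounded_ops)
    (simp_all add: op_scale_apply inner_adj inner_cscale_left bounded_opsD)

lemma adj_scaleR: "A \<in> bounded_ops \<Longrightarrow> adj (r *\<^sub>R A) = r *\<^sub>R adj A"
  using adj_op_scale[of A "complex_of_real r"] by (simp add: op_scale_of_real)

lemma tendsto_adj: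
  assumes "X \<longlonglongrightarrow> A" "\<And>n. X n \<in> bounded_ops"
  shows "(\<lambda>n. adj (X n)) \<longlonglongrightarrow> adj A"
proof -
  have A: "A \<in> bounded_ops"
    using closed_sequentially[OF closed_bounded_ops] assms by blast
  have eq: "(\<lambda>n. norm (adj (X n) - adj A)) = (\<lambda>n. norm (X n - A))"
    by (simp only: adj_diff[OF assms(2) A, symmetric] norm_adj[OF bounded_ops_diff[OF assms(2) A]])
  from assms(1) have "(\<lambda>n. norm (X n - A)) \<longlonglongrightarrow> 0"
    by (intro tendsto_norm_zero) (simp only: LIM_zero_iff)
  then have "(\<lambda>n. adj (X n) - adj A) \<longlonglongrightarrow> 0"
    unfolding eq[symmetric] by (rule tendsto_norm_zero_cancel)
  then show ?thesis by (simp only: LIM_zero_iff)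
qed


section \<open>Operators that permute the standard basis up to weights\<close>

lemma op_eqI:
  assumes "A \<in> bounded_ops" "B \<in> bounded_ops" "\<And>i. blinfun_apply A (ket i) = blinfun_apply B (ket i)"
  shows "A = B"
  by (rule blinfun_eqI, rule bounded_linear_eq_on_kets)
    (simp_all add: bounded_opsD assms blinfun.bounded_linear_right)

lemma op_on_basis_eqI:
  assumes "A \<in> bounded_ops" "\<And>i. blinfun_apply A (ket i) = v i"
  shows "op_on_basis v = A"
  unfolding op_on_basis_def
  by (rule the_equality) (use assms in \<open>auto intro!: op_eqI\<close>)

definition partial_bij :: "('i \<times> 'j) set \<Rightarrow> bool" where
  "partial_bij r \<longleftrightarrow> single_valued r \<and> single_valued (r\<inverse>)"

lemma partial_bijI:
  "(\<And>i j j'. (i, j) \<in> r \<Longrightarrow> (i, j') \<in> r \<Longrightarrow> j = j') \<Longrightarrow>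
    (\<And>i i' j. (i, j) \<in> r \<Longrightarrow> (i', j) \<in> r \<Longrightarrow> i = i') \<Longrightarrow> partial_bij r"
  by (auto simp: partial_bij_def single_valued_def)

lemma partial_bijD:
  assumes "partial_bij r" "(i, j) \<in> r"
  shows "(i, j') \<in> r \<longleftrightarrow> j' = j" "(i', j) \<in> r \<longleftrightarrow> i' = i"
  using assms by (auto simp: partial_bij_def single_valued_def)

lemma partial_bij_converse: "partial_bij (r\<inverse>) \<longleftrightarrow> partial_bij r"
  by (auto simp: partial_bij_def)

lemma partial_bij_relcomp: "partial_bij r \<Longrightarrow> partial_bij s \<Longrightarrow> partial_bij (r O s)"
  by (simp add: partial_bij_def single_valued_relcomp converse_relcomp)

lemma partial_bij_Id_on: "partial_bij (Id_on D)"
  by (auto intro: partial_bijI)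

text \<open>The basis vector at \<open>i\<close> goes to \<open>c i\<close> times the basis vector at the partner of \<open>i\<close>. Source and
  target have different index types so that orbits in the semigroup can be embedded into the
  Hilbert space of the crossed product.\<close>

definition shift :: "('i \<Rightarrow> complex) \<Rightarrow> ('i \<times> 'j) set \<Rightarrow> 'i ell2 \<Rightarrow>\<^sub>L 'j ell2" where
  "shift c r = Blinfun (\<lambda>x. Abs_ell2 (\<lambda>j.
     if j \<in> Range r then c (THE i. (i, j) \<in> r) * coord x (THE i. (i, j) \<in> r) else 0))"

definition bounded_weight :: "('i \<Rightarrow> complex) \<Rightarrow> ('i \<times> 'j) set \<Rightarrow> bool" where
  "bounded_weight c r \<longleftrightarrow> (\<exists>C. \<forall>i\<in>Domain r. cmod (c i) \<le> C)"

lemma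
  fixes r :: "('i \<times> 'j) set"
  assumes r: "partial_bij r" and c: "\<And>i. i \<in> Domain r \<Longrightarrow> cmod (c i) \<le> C" and C: "0 \<le> C"
  shows coord_shift_aux: "coord (blinfun_apply (shift c r) x) j =
      (if j \<in> Range r then c (THE i. (i, j) \<in> r) * coord x (THE i. (i, j) \<in> r) else 0)"
    and norm_shift_le: "norm (shift c r) \<le> C"
proof -
  define i where "i j = (THE i. (i, j) \<in> r)" for j
  have i: "(i j, j) \<in> r" if j: "j \<in> Range r" for j
  proof -
    from j obtain k where k: "(k, j) \<in> r" by auto
    then have "i j = k" unfolding i_def by (simp add: partial_bijD[OF r k])
    with k show ?thesis by simp
  qed
  have inj: "inj_on i (Range r)"
    by (rule inj_onI) (use i partial_bijD(1)[OF r] in metis)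
  define f where "f x j = (if j \<in> Range r then c (i j) * coord x (i j) else 0)" for x j
  have ex: "\<exists>y. coord y = f x \<and> norm y \<le> C * norm x" for x
  proof -
    have "(\<Sum>j\<in>F. (cmod (f x j))\<^sup>2) \<le> (C * norm x)\<^sup>2" if "finite F" for F
    proof -
      have "(\<Sum>j\<in>F. (cmod (f x j))\<^sup>2) = (\<Sum>j\<in>F \<inter> Range r. (cmod (f x j))\<^sup>2)"
        using that by (intro sum.mono_neutral_right) (auto simp: f_def)
      also have "\<dots> \<le> (\<Sum>j\<in>F \<inter> Range r. C\<^sup>2 * (cmod (coord x (i j)))\<^sup>2)"
      proof (rule sum_mono)
        fix j assume j: "j \<in> F \<inter> Range r"
        then have "i j \<in> Domain r" using i[of j] by auto
        from c[OF this] j show "(cmod (f x j))\<^sup>2 \<le> C\<^sup>2 * (cmod (coord x (i j)))\<^sup>2"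
          unfolding f_def by (auto simp: norm_mult power_mult_distrib intro!: mult_right_mono power_mono)
      qed
      also have "\<dots> = C\<^sup>2 * (\<Sum>j\<in>i ` (F \<inter> Range r). (cmod (coord x j))\<^sup>2)"
        using inj_on_subset[OF inj, of "F \<inter> Range r"]
        by (simp add: sum_distrib_left sum.reindex)
      also have "\<dots> \<le> C\<^sup>2 * (norm x)\<^sup>2"
        using that by (intro mult_left_mono sum_coord_le_norm) auto
      finally show ?thesis by (simp add: power_mult_distrib)
    qed
    from ell2_of_bounded_finite_sums[OF this] C show ?thesis by (metis norm_ge_zero zero_le_mult_iff)
  qed
  define g where "g x = Abs_ell2 (f x)" for x
  have g: "coord (g x) = f x" "norm (g x) \<le> C * norm x" for x
    using ex[of x] unfolding g_def by (metis coord_inverse)+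
  have bl: "bounded_linear g"
  proof (rule bounded_linear_intro[where K = C])
    show "g (x + y) = g x + g y" for x y
      by (rule ell2_eqI) (simp add: g f_def algebra_simps)
    show "g (a *\<^sub>R x) = a *\<^sub>R g x" for a x
      by (rule ell2_eqI) (simp add: g f_def algebra_simps)
    show "norm (g x) \<le> norm x * C" for x using g(2)[of x] by (simp add: mult.commute)
  qed
  have sh: "shift c r = Blinfun g"
    unfolding shift_def g_def f_def i_def by simp
  show "coord (blinfun_apply (shift c r) x) j =
      (if j \<in> Range r then c (THE i. (i, j) \<in> r) * coord x (THE i. (i, j) \<in> r) else 0)"
    unfolding sh by (simp add: bounded_linear_Blinfun_apply[OF bl] g) (simp add: f_def i_def)
  show "norm (shift c r) \<le> C"
    unfolding sh by (rule norm_blinfun_bound[OF C]) (simp add: bounded_linear_Blinfun_apply[OF bl] g)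
qed

lemma bounded_weightE:
  assumes "bounded_weight c r"
  obtains C where "\<And>i. i \<in> Domain r \<Longrightarrow> cmod (c i) \<le> C" "0 \<le> C"
proof -
  from assms obtain C where "\<forall>i\<in>Domain r. cmod (c i) \<le> C" by (auto simp: bounded_weight_def)
  then show thesis by (intro that[of "max C 0"]) (auto simp: max.coboundedI1)
qed

lemma coord_shift:
  assumes r: "partial_bij r" and c: "bounded_weight c r" and ij: "(i, j) \<in> r"
  shows "coord (blinfun_apply (shift c r) x) j = c i * coord x i"
proof -
  obtain C where "\<And>i. i \<in> Domain r \<Longrightarrow> cmod (c i) \<le> C" "0 \<le> C" using c by (rule bounded_weightE) auto
  moreover have "(THE i. (i, j) \<in> r) = i" by (simp add: partial_bijD[OF r ij])
  ultimately show ?thesis using ij by (auto simp: coord_shift_aux[OF r, of c C])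
qed

lemma coord_shift_0:
  assumes r: "partial_bij r" and c: "bounded_weight c r" and j: "j \<notin> Range r"
  shows "coord (blinfun_apply (shift c r) x) j = 0"
proof -
  obtain C where "\<And>i. i \<in> Domain r \<Longrightarrow> cmod (c i) \<le> C" "0 \<le> C" using c by (rule bounded_weightE) auto
  then show ?thesis using j by (simp add: coord_shift_aux[OF r, of c C])
qed

lemma shift_ket:
  assumes r: "partial_bij r" and c: "bounded_weight c r" and ij: "(i, j) \<in> r"
  shows "blinfun_apply (shift c r) (cscale d (ket i)) = cscale (d * c i) (ket j)"
proof (rule ell2_eqI)
  fix k
  show "coord (blinfun_apply (shift c r) (cscale d (ket i))) k = coord (cscale (d * c i) (ket j)) k"
  proof (cases "k \<in> Range r")
    case True
    then obtain l where l: "(l, k) \<in> r" by auto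
    then have "l = i \<longleftrightarrow> k = j" using partial_bijD[OF r] ij by metis
    then show ?thesis by (auto simp: coord_shift[OF r c l])
  next
    case False
    with ij have "k \<noteq> j" by auto
    with False show ?thesis by (simp add: coord_shift_0[OF r c])
  qed
qed

lemma shift_ket_0:
  assumes r: "partial_bij r" and c: "bounded_weight c r" and i: "i \<notin> Domain r"
  shows "blinfun_apply (shift c r) (cscale d (ket i)) = 0"
proof (rule ell2_eqI)
  fix k
  show "coord (blinfun_apply (shift c r) (cscale d (ket i))) k = coord 0 k"
  proof (cases "k \<in> Range r")
    case True
    then obtain l where l: "(l, k) \<in> r" by auto
    with i have "l \<noteq> i" by auto
    then show ?thesis by (simp add: coord_shift[OF r c l])
  qed (simp add: coord_shift_0[OF r c])
qed

lemma shift_bounded_ops: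
  assumes r: "partial_bij r" and c: "bounded_weight c r"
  shows "shift c r \<in> bounded_ops"
  unfolding bounded_ops_def
proof (intro CollectI allI ell2_eqI)
  fix d x k
  show "coord (blinfun_apply (shift c r) (cscale d x)) k = coord (cscale d (blinfun_apply (shift c r) x)) k"
    by (cases "k \<in> Range r") (auto simp: coord_shift[OF r c] coord_shift_0[OF r c])
qed

abbreviation pshift :: "('i \<times> 'j) set \<Rightarrow> 'i ell2 \<Rightarrow>\<^sub>L 'j ell2" where
  "pshift \<equiv> shift (\<lambda>_. 1)"

lemma bounded_weight_1: "bounded_weight (\<lambda>_. 1) r"
  by (auto simp: bounded_weight_def)

lemmas pshift_bounded_ops = shift_bounded_ops[OF _ bounded_weight_1]
lemmas coord_pshift = coord_shift[OF _ bounded_weight_1, simplified]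
lemmas coord_pshift_0 = coord_shift_0[OF _ bounded_weight_1]

lemma pshift_ket: "partial_bij r \<Longrightarrow> (i, j) \<in> r \<Longrightarrow>
    blinfun_apply (pshift r) (cscale d (ket i)) = cscale d (ket j)"
  using shift_ket[OF _ bounded_weight_1, of r i j d] by simp

lemmas pshift_ket_0 = shift_ket_0[OF _ bounded_weight_1]

lemma shift_compose:
  assumes r: "partial_bij r" "bounded_weight c r" and s: "partial_bij s" "bounded_weight d s"
    and rs: "bounded_weight e (r O s)"
    and e: "\<And>i j k. (i, j) \<in> r \<Longrightarrow> (j, k) \<in> s \<Longrightarrow> e i = c i * d j"
  shows "shift d s o\<^sub>L shift c r = shift e (r O s)"
proof (intro blinfun_eqI ell2_eqI)
  fix x k
  note prs = partial_bij_relcomp[OF r(1) s(1)]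
  show "coord (blinfun_apply (shift d s o\<^sub>L shift c r) x) k = coord (blinfun_apply (shift e (r O s)) x) k"
  proof (cases "k \<in> Range s")
    case True
    then obtain j where j: "(j, k) \<in> s" by auto
    show ?thesis
    proof (cases "j \<in> Range r")
      case True
      then obtain i where i: "(i, j) \<in> r" by auto
      with j have "(i, k) \<in> r O s" by auto
      from coord_shift[OF prs rs this] show ?thesis
        by (simp add: coord_shift[OF s j] coord_shift[OF r i] e[OF i j])
    next
      case False
      then have "k \<notin> Range (r O s)" using partial_bijD(2)[OF s(1) j] by auto
      with False show ?thesis
        by (simp add: coord_shift[OF s j] coord_shift_0[OF r] coord_shift_0[OF prs rs])
    qed
  next
    case False
    then have "k \<notin> Range (r O s)" by auto
    with False show ?thesis by (simp add: coord_shift_0[OF s] coord_shift_0[OF prs rs])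
  qed
qed

lemma pshift_compose: "partial_bij r \<Longrightarrow> partial_bij s \<Longrightarrow> pshift s o\<^sub>L pshift r = pshift (r O s)"
  by (intro shift_compose bounded_weight_1) auto

lemma adj_pshift:
  fixes r :: "('i \<times> 'i) set"
  assumes r: "partial_bij r"
  shows "adj (pshift r) = pshift (r\<inverse>)"
proof (rule adj_unique)
  have rc: "partial_bij (r\<inverse>)" using r by (simp add: partial_bij_converse)
  show "pshift r \<in> bounded_ops" "pshift (r\<inverse>) \<in> bounded_ops"
    using r rc by (auto intro: pshift_bounded_ops)
  show "inner (blinfun_apply (pshift (r\<inverse>)) x) y = inner x (blinfun_apply (pshift r) y)" for x y
  proof (rule bounded_linear_eq_on_kets[of "inner (blinfun_apply (pshift (r\<inverse>)) x)"])
    show "bounded_linear (inner (blinfun_apply (pshift (r\<inverse>)) x))"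
      by (rule bounded_linear_inner_right)
    show "bounded_linear (\<lambda>y. inner x (blinfun_apply (pshift r) y))"
      by (intro bounded_linear_compose[OF bounded_linear_inner_right] blinfun.bounded_linear_right)
    show "inner (blinfun_apply (pshift (r\<inverse>)) x) (cscale c (ket i)) =
        inner x (blinfun_apply (pshift r) (cscale c (ket i)))" for c i
    proof (cases "i \<in> Domain r")
      case True
      then obtain j where j: "(i, j) \<in> r" by auto
      then have "(j, i) \<in> r\<inverse>" by simp
      from coord_pshift[OF rc this] show ?thesis
        by (simp add: pshift_ket[OF r j] inner_cscale_ket)
    next
      case False
      then have "i \<notin> Range (r\<inverse>)" by auto
      with False show ?thesis
        by (simp add: inner_cscale_ket coord_pshift_0[OF rc] pshift_ket_0[OF r])
    qed
  qed
qed

lemma pshift_Id: "pshift Id = id_blinfun"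
proof (intro blinfun_eqI ell2_eqI)
  have "partial_bij (Id :: ('a \<times> 'a) set)" by (auto intro: partial_bijI)
  then show "coord (blinfun_apply (pshift Id) x) k = coord (blinfun_apply id_blinfun x) k" for x :: "'a ell2" and k
    using coord_pshift[of Id k k x] by simp
qed

lemma pshift_empty: "pshift {} = 0"
proof (intro blinfun_eqI ell2_eqI)
  have "partial_bij {}" by (auto intro: partial_bijI)
  from coord_pshift_0[OF this]
  show "coord (blinfun_apply (pshift {}) x) k = coord (blinfun_apply 0 x) k" for x :: "'a ell2" and k :: 'b
    by simp
qed

lemma norm_pshift_total:
  assumes f: "inj f"
  shows "norm (blinfun_apply (pshift (range (\<lambda>i. (i, f i)))) x) = norm x"
proof -
  have r: "partial_bij (range (\<lambda>i. (i, f i)))"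
    using f by (auto intro!: partial_bijI dest: injD)
  have c1: "coord (blinfun_apply (pshift (range (\<lambda>i. (i, f i)))) x) (f i) = coord x i" for i
    by (rule coord_pshift[OF r]) auto
  have "(norm (blinfun_apply (pshift (range (\<lambda>i. (i, f i)))) x))\<^sup>2 =
      (\<Sum>\<^sub>\<infinity>j\<in>range f. (cmod (coord (blinfun_apply (pshift (range (\<lambda>i. (i, f i)))) x) j))\<^sup>2)"
    unfolding norm_ell2_square by (rule infsum_cong_neutral) (auto intro!: coord_pshift_0[OF r])
  also have "\<dots> = (\<Sum>\<^sub>\<infinity>i. (cmod (coord x i))\<^sup>2)"
    by (subst infsum_reindex[OF f]) (simp add: o_def c1)
  finally have "(norm (blinfun_apply (pshift (range (\<lambda>i. (i, f i)))) x))\<^sup>2 = (norm x)\<^sup>2"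
    by (simp add: norm_ell2_square)
  then show ?thesis by (rule power2_eq_imp_eq) auto
qed


section \<open>Norms of block diagonal operators\<close>

lemma orthogonal_of_disjoint_supports:
  assumes "\<And>i. coord x i = 0 \<or> coord y i = 0"
  shows "orthogonal x y"
proof -
  have "(\<lambda>i. cnj (coord x i) * coord y i) = (\<lambda>_. 0)" using assms by auto
  then show ?thesis by (simp add: orthogonal_def inner_ell2_def cinner_def)
qed

text \<open>Vectors from different blocks are orthogonal, and so are their images, so by Pythagoras a bound
  on each block is a bound on all finitely supported vectors.\<close>

lemma norm_le_of_block_bounds:
  fixes b :: "'i \<Rightarrow> 'b" and T :: "'i operator"
  assumes T: "T \<in> bounded_ops" and C: "0 \<le> C"
    and block: "\<And>i j. coord (blinfun_apply T (ket i)) j \<noteq> 0 \<Longrightarrow> b j = b i"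
    and ker: "\<And>i. i \<notin> D \<Longrightarrow> blinfun_apply T (ket i) = 0"
    and bound: "\<And>F c. finite F \<Longrightarrow> F \<subseteq> D \<Longrightarrow> (\<And>i j. i \<in> F \<Longrightarrow> j \<in> F \<Longrightarrow> b i = b j) \<Longrightarrow>
      norm (blinfun_apply T (\<Sum>i\<in>F. cscale (c i) (ket i))) \<le> C * norm (\<Sum>i\<in>F. cscale (c i) (ket i))"
  shows "norm T \<le> C"
proof -
  define \<xi> where "\<xi> F c = (\<Sum>i\<in>F. cscale (c i) (ket i) :: 'i ell2)" for F c
  have fin: "norm (blinfun_apply T (\<xi> F c)) \<le> C * norm (\<xi> F c)" if F: "finite F" for F c
  proof -
    define F' where "F' = F \<inter> D"
    define G where "G \<beta> = {i \<in> F'. b i = \<beta>}" for \<beta>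
    have F': "finite F'" using F by (simp add: F'_def)
    have T_ket: "blinfun_apply T (\<xi> H c) = (\<Sum>i\<in>H. cscale (c i) (blinfun_apply T (ket i)))" for H
      by (simp add: \<xi>_def blinfun.sum_right bounded_opsD[OF T])
    have "blinfun_apply T (\<xi> F c) = blinfun_apply T (\<xi> F' c)"
      unfolding T_ket using F by (intro sum.mono_neutral_right) (auto simp: F'_def ker)
    also have "\<xi> F' c = (\<Sum>\<beta>\<in>b ` F'. \<xi> (G \<beta>) c)"
      unfolding \<xi>_def G_def by (rule sum.image_gen[OF F'])
    finally have split: "blinfun_apply T (\<xi> F c) = (\<Sum>\<beta>\<in>b ` F'. blinfun_apply T (\<xi> (G \<beta>) c))"
      by (simp add: blinfun.sum_right)
    have supp: "b j = \<beta>" if "coord (blinfun_apply T (\<xi> (G \<beta>) c)) j \<noteq> 0" for \<beta> j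
    proof -
      from that obtain i where "i \<in> G \<beta>" "coord (blinfun_apply T (ket i)) j \<noteq> 0"
        unfolding T_ket by (auto elim!: sum.not_neutral_contains_not_neutral)
      then show ?thesis using block by (auto simp: G_def)
    qed
    have "(norm (blinfun_apply T (\<xi> F c)))\<^sup>2 = (\<Sum>\<beta>\<in>b ` F'. (norm (blinfun_apply T (\<xi> (G \<beta>) c)))\<^sup>2)"
      unfolding split
    proof (rule norm_sum_Pythagorean)
      show "pairwise (\<lambda>\<beta> \<beta>'. orthogonal (blinfun_apply T (\<xi> (G \<beta>) c)) (blinfun_apply T (\<xi> (G \<beta>') c))) (b ` F')"
        by (intro pairwiseI orthogonal_of_disjoint_supports) (metis supp)
    qed (use F' in simp)
    also have "\<dots> \<le> (\<Sum>\<beta>\<in>b ` F'. C\<^sup>2 * (\<Sum>i\<in>G \<beta>. (cmod (c i))\<^sup>2))"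
    proof (rule sum_mono)
      fix \<beta>
      have G: "finite (G \<beta>)" by (rule finite_subset[OF _ F']) (auto simp: G_def)
      have "norm (blinfun_apply T (\<xi> (G \<beta>) c)) \<le> C * norm (\<xi> (G \<beta>) c)"
        unfolding \<xi>_def by (rule bound) (use G in \<open>auto simp: G_def F'_def\<close>)
      then have "(norm (blinfun_apply T (\<xi> (G \<beta>) c)))\<^sup>2 \<le> (C * norm (\<xi> (G \<beta>) c))\<^sup>2"
        by (intro power_mono) auto
      then show "(norm (blinfun_apply T (\<xi> (G \<beta>) c)))\<^sup>2 \<le> C\<^sup>2 * (\<Sum>i\<in>G \<beta>. (cmod (c i))\<^sup>2)"
        by (simp add: power_mult_distrib \<xi>_def norm_ket_sum[OF G])
    qed
    also have "\<dots> = C\<^sup>2 * (\<Sum>i\<in>F'. (cmod (c i))\<^sup>2)"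
      unfolding sum_distrib_left[symmetric] G_def using sum.image_gen[OF F', of "\<lambda>i. (cmod (c i))\<^sup>2" b] by simp
    also have "\<dots> \<le> C\<^sup>2 * (\<Sum>i\<in>F. (cmod (c i))\<^sup>2)"
      using F by (intro mult_left_mono sum_mono2) (auto simp: F'_def)
    also have "\<dots> = (C * norm (\<xi> F c))\<^sup>2"
      by (simp add: power_mult_distrib \<xi>_def norm_ket_sum[OF F])
    finally show ?thesis using C by (simp add: power2_le_iff_abs_le)
  qed
  have "x \<in> {x. norm (blinfun_apply T x) \<le> C * norm x}" for x
  proof -
    have "x \<in> closure {x. norm (blinfun_apply T x) \<le> C * norm x}"
      unfolding closure_approachable
    proof (intro allI impI)
      fix e :: real assume "0 < e"
      from ket_expansion_approx[OF this, of x]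
      obtain F where F: "finite F" "norm (x - \<xi> F (coord x)) < e" by (auto simp: \<xi>_def)
      with fin[OF F(1), of "coord x"] show "\<exists>y\<in>{x. norm (blinfun_apply T x) \<le> C * norm x}. dist y x < e"
        by (intro bexI[of _ "\<xi> F (coord x)"]) (auto simp: dist_norm norm_minus_commute)
    qed
    moreover have "closed {x. norm (blinfun_apply T x) \<le> C * norm x}"
      by (intro closed_Collect_le continuous_intros)
    ultimately show ?thesis by simp
  qed
  then show ?thesis using C by (intro norm_blinfun_bound) auto
qed


section \<open>Closures and isomorphisms of operator algebras\<close>

lemma tendsto_blinfun_compose:
  fixes A B :: "nat \<Rightarrow> 'i operator"
  assumes "A \<longlonglongrightarrow> a" "B \<longlonglongrightarrow> b"
  shows "(\<lambda>n. A n o\<^sub>L B n) \<longlonglongrightarrow> (a o\<^sub>L b)"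
  by (rule bounded_bilinear.tendsto[OF bounded_bilinear_blinfun_compose assms])

lemma tendsto_op_scale: "A \<longlonglongrightarrow> a \<Longrightarrow> (\<lambda>n. op_scale c (A n)) \<longlonglongrightarrow> op_scale c a"
  by (rule bounded_linear.tendsto[OF bounded_linear_op_scale])

lemma closureI_seq: "S \<in> closure B" if "s \<longlonglongrightarrow> S" "\<And>n. s n \<in> B" for S :: "'a :: metric_space"
  unfolding closure_sequential using that by blast

lemma infsum_in_closed_subspace:
  fixes f :: "'i \<Rightarrow> 'a::real_normed_vector"
  assumes "subspace B" "closed B" "\<And>i. f i \<in> B"
  shows "infsum f UNIV \<in> B"
proof (cases "f summable_on UNIV")
  case True
  then have "(sum f \<longlongrightarrow> infsum f UNIV) (finite_subsets_at_top UNIV)"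
    using has_sum_infsum by (simp add: has_sum_def)
  then show ?thesis
    by (rule Lim_in_closed_set[OF assms(2) _ finite_subsets_at_top_neq_bot, rotated])
      (intro always_eventually allI subspace_sum[OF assms(1)] assms(3))
next
  case False
  then show ?thesis using subspace_0[OF assms(1)] by (simp add: infsum_not_exists)
qed

lemma in_closed_if_approx:
  fixes x :: "'a::real_normed_vector"
  assumes "closed B" "\<And>e. 0 < e \<Longrightarrow> \<exists>y\<in>B. norm (x - y) \<le> e"
  shows "x \<in> B"
proof -
  have "x \<in> closure B"
    unfolding closure_approachable
  proof (intro allI impI)
    fix e :: real assume "0 < e"
    then obtain y where "y \<in> B" "norm (x - y) \<le> e / 2" using assms(2)[of "e / 2"] by auto
    with \<open>0 < e\<close> show "\<exists>y\<in>B. dist y x < e"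
      by (intro bexI[of _ y]) (auto simp: dist_norm norm_minus_commute)
  qed
  with assms(1) show ?thesis by simp
qed

lemma cstar_subalgebra_closure:
  assumes B: "B \<subseteq> bounded_ops" and z: "0 \<in> B"
    and add: "\<And>S T. S \<in> B \<Longrightarrow> T \<in> B \<Longrightarrow> S + T \<in> B"
    and mult: "\<And>S T. S \<in> B \<Longrightarrow> T \<in> B \<Longrightarrow> S o\<^sub>L T \<in> B"
    and scale: "\<And>c S. S \<in> B \<Longrightarrow> op_scale c S \<in> B"
    and adj: "\<And>S. S \<in> B \<Longrightarrow> adj S \<in> B"
  shows "cstar_subalgebra (closure B)"
  unfolding cstar_subalgebra_def
proof (intro conjI ballI allI)
  show "closure B \<subseteq> bounded_ops"
    by (rule closure_minimal[OF B closed_bounded_ops])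
  show "0 \<in> closure B" using z closure_subset by blast
  show "S + T \<in> closure B" "S o\<^sub>L T \<in> closure B" if "S \<in> closure B" "T \<in> closure B" for S T
  proof -
    from that obtain s t where st: "\<And>n. s n \<in> B" "\<And>n. t n \<in> B" and lim: "s \<longlonglongrightarrow> S" "t \<longlonglongrightarrow> T"
      unfolding closure_sequential by blast
    have "(\<lambda>n. s n + t n) \<longlonglongrightarrow> S + T" by (intro tendsto_add lim)
    then show "S + T \<in> closure B" by (rule closureI_seq) (rule add[OF st])
    have "(\<lambda>n. s n o\<^sub>L t n) \<longlonglongrightarrow> (S o\<^sub>L T)" by (intro tendsto_blinfun_compose lim)
    then show "S o\<^sub>L T \<in> closure B" by (rule closureI_seq) (rule mult[OF st])
  qed
  show "op_scale c S \<in> closure B" "adj S \<in> closure B" if S: "S \<in> closure B" for c S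
  proof -
    from S obtain s where s: "\<And>n. s n \<in> B" and lim: "s \<longlonglongrightarrow> S"
      unfolding closure_sequential by blast
    have "(\<lambda>n. op_scale c (s n)) \<longlonglongrightarrow> op_scale c S" by (intro tendsto_op_scale lim)
    then show "op_scale c S \<in> closure B" by (rule closureI_seq) (rule scale[OF s])
    have "(\<lambda>n. adj (s n)) \<longlonglongrightarrow> adj S" using tendsto_adj[OF lim] s B by blast
    then show "adj S \<in> closure B" by (rule closureI_seq) (rule adj[OF s])
  qed
qed simp

text \<open>A relation instead of a map on the dense subalgebra avoids a well-definedness proof: that the
  relation is single-valued and injective follows from the equality of norms.\<close>

lemma star_isomorphism_of_isometric_relation:
  fixes R :: "('i operator \<times> 'j operator) set"
  assumes bdd: "R \<subseteq> bounded_ops \<times> bounded_ops"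
    and sub: "subspace R"
    and mult: "\<And>S T S' T'. (S, T) \<in> R \<Longrightarrow> (S', T') \<in> R \<Longrightarrow> (S o\<^sub>L S', T o\<^sub>L T') \<in> R"
    and scale: "\<And>c S T. (S, T) \<in> R \<Longrightarrow> (op_scale c S, op_scale c T) \<in> R"
    and adj: "\<And>S T. (S, T) \<in> R \<Longrightarrow> (adj S, adj T) \<in> R"
    and isometric: "\<And>S T. (S, T) \<in> R \<Longrightarrow> norm S = norm T"
  shows "\<exists>\<Phi>. star_isomorphism \<Phi> (closure (fst ` R)) (closure (snd ` R)) \<and> (\<forall>(S, T)\<in>R. \<Phi> S = T)"
proof -
  define C where "C = closure R"
  have CI: "(S, T) \<in> C" if "\<And>n. (s n, t n) \<in> R" "s \<longlonglongrightarrow> S" "t \<longlonglongrightarrow> T" for s t S T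
    unfolding C_def closure_sequential using that
    by (intro exI[of _ "\<lambda>n. (s n, t n)"]) (auto intro: tendsto_Pair)
  have CE: "\<exists>s t. (\<forall>n. (s n, t n) \<in> R) \<and> s \<longlonglongrightarrow> S \<and> t \<longlonglongrightarrow> T" if "(S, T) \<in> C" for S T
  proof -
    from that obtain x where x: "\<forall>n. x n \<in> R" "x \<longlonglongrightarrow> (S, T)"
      unfolding C_def closure_sequential by blast
    then show ?thesis using tendsto_fst[OF x(2)] tendsto_snd[OF x(2)]
      by (intro exI[of _ "\<lambda>n. fst (x n)"] exI[of _ "\<lambda>n. snd (x n)"]) auto
  qed
  have C_add: "(S + S', T + T') \<in> C" and C_diff: "(S - S', T - T') \<in> C"
    and C_mult: "(S o\<^sub>L S', T o\<^sub>L T') \<in> C"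
    if ST: "(S, T) \<in> C" "(S', T') \<in> C" for S T S' T'
  proof -
    obtain s t s' t' where st: "\<And>n. (s n, t n) \<in> R" "\<And>n. (s' n, t' n) \<in> R"
      and lim: "s \<longlonglongrightarrow> S" "t \<longlonglongrightarrow> T" "s' \<longlonglongrightarrow> S'" "t' \<longlonglongrightarrow> T'"
      using CE[OF ST(1)] CE[OF ST(2)] by blast
    show "(S + S', T + T') \<in> C"
      by (rule CI[of "\<lambda>n. s n + s' n" "\<lambda>n. t n + t' n"])
        (use subspace_add[OF sub st] in \<open>auto intro: tendsto_add lim\<close>)
    show "(S - S', T - T') \<in> C"
      by (rule CI[of "\<lambda>n. s n - s' n" "\<lambda>n. t n - t' n"])
        (use subspace_diff[OF sub st] in \<open>auto intro: tendsto_diff lim\<close>)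
    show "(S o\<^sub>L S', T o\<^sub>L T') \<in> C"
      by (rule CI[of "\<lambda>n. s n o\<^sub>L s' n" "\<lambda>n. t n o\<^sub>L t' n"])
        (use mult[OF st] in \<open>auto intro: tendsto_blinfun_compose lim\<close>)
  qed
  have C_scale: "(op_scale c S, op_scale c T) \<in> C" and C_adj: "(adj S, adj T) \<in> C"
    and C_norm: "norm S = norm T" if ST: "(S, T) \<in> C" for c S T
  proof -
    obtain s t where st: "\<And>n. (s n, t n) \<in> R" and lim: "s \<longlonglongrightarrow> S" "t \<longlonglongrightarrow> T"
      using CE[OF ST] by blast
    have bst: "s n \<in> bounded_ops" "t n \<in> bounded_ops" for n using st[of n] bdd by auto
    show "(op_scale c S, op_scale c T) \<in> C"
      by (rule CI[of "\<lambda>n. op_scale c (s n)" "\<lambda>n. op_scale c (t n)"])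
        (use scale[OF st] in \<open>auto intro: tendsto_op_scale lim\<close>)
    show "(adj S, adj T) \<in> C"
      by (rule CI[of "\<lambda>n. adj (s n)" "\<lambda>n. adj (t n)"])
        (use adj[OF st] bst in \<open>auto intro: tendsto_adj lim\<close>)
    have "(\<lambda>n. norm (s n)) \<longlonglongrightarrow> norm S" "(\<lambda>n. norm (s n)) \<longlonglongrightarrow> norm T"
      using tendsto_norm[OF lim(1)] tendsto_norm[OF lim(2)] isometric[OF st] by simp_all
    then show "norm S = norm T" by (rule LIMSEQ_unique)
  qed
  have CR: "R \<subseteq> C" unfolding C_def by (rule closure_subset)
  have right_unique: "T = T'" if "(S, T) \<in> C" "(S, T') \<in> C" for S T T'
    using C_norm[OF C_diff[OF that]] by simp
  have left_unique: "S = S'" if "(S, T) \<in> C" "(S', T) \<in> C" for S S' T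
    using C_norm[OF C_diff[OF that]] by simp
  \<comment> \<open>an isometric relation transports Cauchy sequences, so its closure is total on the closure
     of its domain\<close>
  have tot: "\<exists>T. (S, T) \<in> C" if S: "S \<in> closure (fst ` R)" for S
  proof -
    obtain s where s: "\<And>n. s n \<in> fst ` R" and lim: "s \<longlonglongrightarrow> S"
      using S unfolding closure_sequential by blast
    from s have "\<exists>T. (s n, T) \<in> R" for n by (metis imageE prod.collapse)
    then obtain t where t: "\<And>n. (s n, t n) \<in> R" by metis
    have "dist (t m) (t n) = dist (s m) (s n)" for m n
      using isometric[OF subspace_diff[OF sub t[of m] t[of n], simplified]] by (simp add: dist_norm)
    then have "Cauchy t"
      using LIMSEQ_imp_Cauchy[OF lim] by (simp add: Cauchy_def)
    then obtain T where "t \<longlonglongrightarrow> T" using Cauchy_convergent_iff convergent_def by blast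
    then show ?thesis using CI[OF t lim] by blast
  qed
  have sur: "\<exists>S. (S, T) \<in> C" if T: "T \<in> closure (snd ` R)" for T
  proof -
    obtain t where t: "\<And>n. t n \<in> snd ` R" and lim: "t \<longlonglongrightarrow> T"
      using T unfolding closure_sequential by blast
    from t have "\<exists>S. (S, t n) \<in> R" for n by (metis imageE prod.collapse)
    then obtain s where s: "\<And>n. (s n, t n) \<in> R" by metis
    have "dist (s m) (s n) = dist (t m) (t n)" for m n
      using isometric[OF subspace_diff[OF sub s[of m] s[of n], simplified]] by (simp add: dist_norm)
    then have "Cauchy s"
      using LIMSEQ_imp_Cauchy[OF lim] by (simp add: Cauchy_def)
    then obtain S where "s \<longlonglongrightarrow> S" using Cauchy_convergent_iff convergent_def by blast
    then show ?thesis using CI[OF s _ lim] by blast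
  qed
  have rng: "S \<in> closure (fst ` R)" "T \<in> closure (snd ` R)" if ST: "(S, T) \<in> C" for S T
  proof -
    obtain s t where st: "\<And>n. (s n, t n) \<in> R" and lim: "s \<longlonglongrightarrow> S" "t \<longlonglongrightarrow> T"
      using CE[OF ST] by blast
    have "s n \<in> fst ` R" "t n \<in> snd ` R" for n using st[of n] by force+
    with lim show "S \<in> closure (fst ` R)" "T \<in> closure (snd ` R)"
      unfolding closure_sequential by blast+
  qed
  define \<Phi> where "\<Phi> S = (THE T. (S, T) \<in> C)" for S
  have \<Phi>: "\<Phi> S = T" if "(S, T) \<in> C" for S T
    unfolding \<Phi>_def using that right_unique by (intro the_equality)
  have \<Phi>C: "(S, \<Phi> S) \<in> C" if "S \<in> closure (fst ` R)" for S
    using tot[OF that] \<Phi> by metis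
  have "star_isomorphism \<Phi> (closure (fst ` R)) (closure (snd ` R))"
    unfolding star_isomorphism_def
  proof (intro conjI ballI allI)
    show "bij_betw \<Phi> (closure (fst ` R)) (closure (snd ` R))"
    proof (rule bij_betwI')
      show "\<Phi> S = \<Phi> S' \<longleftrightarrow> S = S'" if "S \<in> closure (fst ` R)" "S' \<in> closure (fst ` R)" for S S'
        using left_unique \<Phi>C[OF that(1)] \<Phi>C[OF that(2)] by metis
      show "\<Phi> S \<in> closure (snd ` R)" if "S \<in> closure (fst ` R)" for S
        using rng(2)[OF \<Phi>C[OF that]] .
      show "\<exists>S\<in>closure (fst ` R). T = \<Phi> S" if "T \<in> closure (snd ` R)" for T
        using sur[OF that] \<Phi> rng(1) by metis
    qed
  next
    fix S T assume "S \<in> closure (fst ` R)" "T \<in> closure (fst ` R)"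
    note ST = this[THEN \<Phi>C]
    show "\<Phi> (S + T) = \<Phi> S + \<Phi> T" by (rule \<Phi>[OF C_add[OF ST]])
    show "\<Phi> (S o\<^sub>L T) = \<Phi> S o\<^sub>L \<Phi> T" by (rule \<Phi>[OF C_mult[OF ST]])
  next
    fix c S assume "S \<in> closure (fst ` R)"
    note S = \<Phi>C[OF this]
    show "\<Phi> (op_scale c S) = op_scale c (\<Phi> S)" by (rule \<Phi>[OF C_scale[OF S]])
    show "\<Phi> (adj S) = adj (\<Phi> S)" by (rule \<Phi>[OF C_adj[OF S]])
  qed
  moreover have "\<forall>(S, T)\<in>R. \<Phi> S = T" using CR \<Phi> by auto
  ultimately show ?thesis by blast
qed


section \<open>Star homomorphisms are contractive\<close>

lemma cstar_subalgebraD: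
  assumes "cstar_subalgebra A"
  shows "A \<subseteq> bounded_ops" "closed A" "0 \<in> A" "S \<in> A \<Longrightarrow> T \<in> A \<Longrightarrow> S + T \<in> A"
    "S \<in> A \<Longrightarrow> T \<in> A \<Longrightarrow> S o\<^sub>L T \<in> A" "S \<in> A \<Longrightarrow> op_scale c S \<in> A" "S \<in> A \<Longrightarrow> r *\<^sub>R S \<in> A"
    "S \<in> A \<Longrightarrow> adj S \<in> A" "S \<in> A \<Longrightarrow> T \<in> A \<Longrightarrow> S - T \<in> A"
proof -
  show "S \<in> A \<Longrightarrow> r *\<^sub>R S \<in> A"
    using assms unfolding cstar_subalgebra_def by (metis op_scale_of_real)
  have "S + op_scale (- 1) T \<in> A" if "S \<in> A" "T \<in> A"
    using assms that unfolding cstar_subalgebra_def by blast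
  then show "S \<in> A \<Longrightarrow> T \<in> A \<Longrightarrow> S - T \<in> A" by (simp add: op_scale_minus_1)
qed (use assms in \<open>auto simp: cstar_subalgebra_def\<close>)

lemma cstar_subalgebra_subspace: "cstar_subalgebra A \<Longrightarrow> subspace A"
  by (rule subspaceI) (simp_all add: cstar_subalgebraD)

text \<open>The element \<open>z\<close> is \<open>1 - sqrt (1 - x)\<close>: the equation says that \<open>1 - z\<close> has square \<open>1 - x\<close>. It
  is a fixed point of \<open>z \<mapsto> (x + z\<^sup>2) / 2\<close>, which maps the ball of radius \<open>norm x\<close> into itself and
  is a contraction there with constant \<open>norm x\<close>. Being self-adjoint follows from the uniqueness of
  the fixed point.\<close>

lemma one_minus_selfadjoint_is_square:
  assumes A: "cstar_subalgebra A" and x: "x \<in> A" "adj x = x" "norm x < 1"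
  obtains z where "z \<in> A" "adj z = z" "2 *\<^sub>R z = x + (z o\<^sub>L z)"
proof -
  define f where "f z = (1/2) *\<^sub>R (x + (z o\<^sub>L z))" for z
  define B where "B = A \<inter> cball 0 (norm x)"
  note [intro] = cstar_subalgebraD[OF A]
  have ab: "S \<in> bounded_ops" if "S \<in> A" for S using that cstar_subalgebraD(1)[OF A] by blast
  have "\<exists>!z\<in>B. f z = z"
  proof (rule Banach_fix)
    show "complete B" unfolding B_def
      by (simp add: complete_eq_closed closed_Int cstar_subalgebraD(2)[OF A])
    show "B \<noteq> {}" using cstar_subalgebraD(3)[OF A] by (auto simp: B_def)
    show "0 \<le> norm x" "norm x < 1" using x by auto
    have "f z \<in> B" if z: "z \<in> B" for z
    proof -
      have "norm (z o\<^sub>L z) \<le> norm x * norm x"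
        using z by (intro order_trans[OF norm_blinfun_compose] mult_mono) (auto simp: B_def)
      also have "\<dots> \<le> norm x * 1" using x by (intro mult_left_mono) auto
      finally have "norm (x + (z o\<^sub>L z)) \<le> norm x + norm x"
        by (intro order_trans[OF norm_triangle_ineq]) simp
      moreover have "f z \<in> A" unfolding f_def using z x(1) by (auto simp: B_def)
      ultimately show ?thesis by (simp add: B_def f_def)
    qed
    then show "f ` B \<subseteq> B" by auto
    show "dist (f z) (f w) \<le> norm x * dist z w" if z: "z \<in> B" and w: "w \<in> B" for z w
    proof -
      have "f z - f w = (1/2) *\<^sub>R ((z o\<^sub>L (z - w)) + ((z - w) o\<^sub>L w))"
        by (rule blinfun_eqI)
          (simp add: f_def blinfun.add_left blinfun.diff_left blinfun.diff_right blinfun.scaleR_left algebra_simps)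
      also have "norm \<dots> \<le> (1/2) * (norm z * norm (z - w) + norm (z - w) * norm w)"
        by (simp add: order_trans[OF norm_triangle_ineq add_mono[OF norm_blinfun_compose norm_blinfun_compose]])
      also have "\<dots> \<le> (1/2) * (norm x * norm (z - w) + norm (z - w) * norm x)"
        using z w by (intro mult_left_mono add_mono mult_right_mono) (auto simp: B_def)
      finally show ?thesis by (simp add: dist_norm)
    qed
  qed
  then obtain z where z: "z \<in> B" "f z = z" and uniq: "\<And>w. w \<in> B \<Longrightarrow> f w = w \<Longrightarrow> w = z" by blast
  have zA: "z \<in> A" using z by (simp add: B_def)
  have "adj z = z"
  proof (rule uniq)
    show "adj z \<in> B" using z norm_adj[OF ab[OF zA]] by (auto simp: B_def)
    have zz: "z o\<^sub>L z \<in> bounded_ops" by (intro bounded_ops_compose ab zA)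
    have "adj (f z) = f (adj z)"
      unfolding f_def adj_scaleR[OF bounded_ops_add[OF ab[OF x(1)] zz]] adj_add[OF ab[OF x(1)] zz]
        adj_compose[OF ab[OF zA] ab[OF zA]] x(2) ..
    then show "f (adj z) = adj z" using z by simp
  qed
  moreover have "2 *\<^sub>R z = x + (z o\<^sub>L z)"
    using arg_cong[OF z(2), of "\<lambda>u. 2 *\<^sub>R u"] by (simp add: f_def)
  ultimately show thesis using that zA by blast
qed

text \<open>For \<open>a\<close> of norm less than one, \<open>1 - a\<^sup>* a\<close> is the square of a self-adjoint element of the
  algebra. A star homomorphism therefore sends it to a positive operator, so that the image of
  \<open>a\<^sup>* a\<close> is at most the image of \<open>1\<close>, which is a projection.\<close>

lemma star_homomorphism_contractive:
  fixes \<pi> :: "'i operator \<Rightarrow> 'j operator"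
  assumes A: "cstar_subalgebra A" and one: "id_blinfun \<in> A"
    and into: "\<And>S. S \<in> A \<Longrightarrow> \<pi> S \<in> bounded_ops"
    and add: "\<And>S T. S \<in> A \<Longrightarrow> T \<in> A \<Longrightarrow> \<pi> (S + T) = \<pi> S + \<pi> T"
    and mult: "\<And>S T. S \<in> A \<Longrightarrow> T \<in> A \<Longrightarrow> \<pi> (S o\<^sub>L T) = \<pi> S o\<^sub>L \<pi> T"
    and scale: "\<And>c S. S \<in> A \<Longrightarrow> \<pi> (op_scale c S) = op_scale c (\<pi> S)"
    and adj: "\<And>S. S \<in> A \<Longrightarrow> \<pi> (adj S) = adj (\<pi> S)"
    and S: "S \<in> A"
  shows "norm (\<pi> S) \<le> norm S"
proof -
  note [intro] = cstar_subalgebraD[OF A]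
  have ab: "S \<in> bounded_ops" if "S \<in> A" for S using that cstar_subalgebraD(1)[OF A] by blast
  have scaleR: "\<pi> (r *\<^sub>R S) = r *\<^sub>R \<pi> S" if "S \<in> A" for r S
    using scale[OF that, of "complex_of_real r"] by (simp add: op_scale_of_real)
  have diff: "\<pi> (S - T) = \<pi> S - \<pi> T" if "S \<in> A" "T \<in> A" for S T
    using add[of S "(- 1) *\<^sub>R T"] scaleR[of T "-1"] cstar_subalgebraD(7)[OF A, of T "-1"] that by simp
  have self_inner: "inner (blinfun_apply (\<pi> (adj a o\<^sub>L a)) \<xi>) \<xi> = (norm (blinfun_apply (\<pi> a) \<xi>))\<^sup>2"
    if "a \<in> A" for a \<xi>
    using that inner_adj[OF into[OF that], of "blinfun_apply (\<pi> a) \<xi>" \<xi>]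
    by (simp add: mult adj cstar_subalgebraD[OF A] power2_norm_eq_inner)
  have adj_one: "adj id_blinfun = (id_blinfun :: 'i operator)"
    by (rule adj_unique) (auto intro: ab[OF one])
  have one_one: "id_blinfun o\<^sub>L id_blinfun = (id_blinfun :: 'i operator)"
    by (rule blinfun_eqI) simp
  have p_one: "norm (blinfun_apply (\<pi> id_blinfun) \<xi>) \<le> norm \<xi>" for \<xi>
  proof -
    have "(norm (blinfun_apply (\<pi> id_blinfun) \<xi>))\<^sup>2 = inner (blinfun_apply (\<pi> id_blinfun) \<xi>) \<xi>"
      using self_inner[OF one, of \<xi>] by (simp add: adj_one one_one)
    also have "\<dots> \<le> norm (blinfun_apply (\<pi> id_blinfun) \<xi>) * norm \<xi>" by (rule norm_cauchy_schwarz)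
    finally show ?thesis
      by (cases "norm (blinfun_apply (\<pi> id_blinfun) \<xi>) = 0") (auto simp: power2_eq_square)
  qed
  have small: "norm (\<pi> a) \<le> 1" if a: "a \<in> A" "norm a < 1" for a
  proof -
    define x where "x = adj a o\<^sub>L a"
    have xA: "x \<in> A" using a by (auto simp: x_def)
    have "norm x \<le> norm a * norm a"
      unfolding x_def by (rule order_trans[OF norm_blinfun_compose]) (simp add: norm_adj[OF ab[OF a(1)]])
    also have "\<dots> \<le> norm a * 1" using a(2) by (intro mult_left_mono) auto
    also have "\<dots> < 1" using a(2) by simp
    finally have xn: "norm x < 1" .
    have xs: "adj x = x"
      using a(1) by (simp add: x_def adj_compose ab cstar_subalgebraD[OF A] adj_adj)
    obtain z where z: "z \<in> A" "adj z = z" "2 *\<^sub>R z = x + (z o\<^sub>L z)"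
      using one_minus_selfadjoint_is_square[OF A xA xs xn] by blast
    define y where "y = id_blinfun - z"
    have yA: "y \<in> A" using one z by (auto simp: y_def)
    have ys: "adj y = y" using z ab[OF one] ab[OF z(1)] by (simp add: y_def adj_diff adj_one)
    \<comment> \<open>completing the square in the equation for z\<close>
    have yy: "adj y o\<^sub>L y = id_blinfun - x"
    proof (rule blinfun_eqI)
      fix \<eta>
      have "2 *\<^sub>R blinfun_apply z \<eta> = blinfun_apply x \<eta> + blinfun_apply z (blinfun_apply z \<eta>)"
        using arg_cong[OF z(3), of "\<lambda>u. blinfun_apply u \<eta>"]
        by (simp add: blinfun.scaleR_left blinfun.add_left)
      then show "blinfun_apply (adj y o\<^sub>L y) \<eta> = blinfun_apply (id_blinfun - x) \<eta>"
        unfolding ys by (simp add: y_def blinfun.diff_left blinfun.diff_right scaleR_2 algebra_simps)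
    qed
    have "norm (blinfun_apply (\<pi> a) \<xi>) \<le> 1 * norm \<xi>" for \<xi>
    proof -
      have "0 \<le> inner (blinfun_apply (\<pi> (adj y o\<^sub>L y)) \<xi>) \<xi>"
        unfolding self_inner[OF yA] by simp
      also have "\<dots> = inner (blinfun_apply (\<pi> id_blinfun) \<xi>) \<xi> - (norm (blinfun_apply (\<pi> a) \<xi>))\<^sup>2"
        unfolding yy diff[OF one xA]
        by (simp add: blinfun.diff_left inner_diff_left) (simp add: x_def self_inner[OF a(1)])
      also have "inner (blinfun_apply (\<pi> id_blinfun) \<xi>) \<xi> \<le> norm \<xi> * norm \<xi>"
        by (rule order_trans[OF norm_cauchy_schwarz]) (intro mult_right_mono p_one, simp)
      finally have "(norm (blinfun_apply (\<pi> a) \<xi>))\<^sup>2 \<le> (norm \<xi>)\<^sup>2" by (simp add: power2_eq_square)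
      then show ?thesis by simp
    qed
    then show ?thesis by (intro norm_blinfun_bound) auto
  qed
  show ?thesis
  proof (rule dense_ge)
    fix r assume r: "norm S < r"
    then have r0: "0 < r" by (meson norm_ge_zero order_le_less_trans)
    have "norm ((1/r) *\<^sub>R S) < 1" using r r0 by simp
    then have "norm (\<pi> ((1/r) *\<^sub>R S)) \<le> 1" using S by (intro small) auto
    then show "norm (\<pi> S) \<le> r" using S r0 by (simp add: scaleR field_simps)
  qed
qed


text \<open>The set where two isomorphisms agree is a closed star subalgebra, because star
  homomorphisms are contractive, and it contains the generators.\<close>

lemma star_isomorphism_agree:
  fixes \<Phi> \<Psi> :: "'i operator \<Rightarrow> 'j operator"
  assumes \<Phi>: "star_isomorphism \<Phi> (cstar_generated G) B" and \<Psi>: "star_isomorphism \<Psi> (cstar_generated G) B"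
    and A: "cstar_subalgebra (cstar_generated G)" and one: "id_blinfun \<in> cstar_generated G"
    and B: "B \<subseteq> bounded_ops" and G: "\<And>S. S \<in> G \<Longrightarrow> \<Phi> S = \<Psi> S"
    and S: "S \<in> cstar_generated G"
  shows "\<Psi> S = \<Phi> S"
proof -
  let ?A = "cstar_generated G"
  define E where "E = {S \<in> ?A. \<Phi> S = \<Psi> S}"
  note AD = cstar_subalgebraD[OF A]
  have hom: "\<pi> (S + T) = \<pi> S + \<pi> T" "\<pi> (S o\<^sub>L T) = \<pi> S o\<^sub>L \<pi> T" "\<pi> (op_scale c S) = op_scale c (\<pi> S)"
    "\<pi> (adj S) = adj (\<pi> S)" "\<pi> S \<in> bounded_ops"
    if "star_isomorphism \<pi> ?A B" "S \<in> ?A" "T \<in> ?A" for \<pi> c S T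
    using that B unfolding star_isomorphism_def bij_betw_def by auto
  have dist: "norm (\<pi> S - \<pi> T) \<le> norm (S - T)" if \<pi>: "star_isomorphism \<pi> ?A B" and ST: "S \<in> ?A" "T \<in> ?A" for \<pi> S T
  proof -
    have "\<pi> (S - T) = \<pi> (S + op_scale (- 1) T)" by (simp add: op_scale_minus_1)
    also have "\<dots> = \<pi> S + op_scale (- 1) (\<pi> T)"
      using hom(1)[OF \<pi> ST(1) AD(6)[OF ST(2)]] hom(3)[OF \<pi> ST(2) ST(2)] by simp
    finally have "\<pi> (S - T) = \<pi> S - \<pi> T" by (simp add: op_scale_minus_1)
    then show ?thesis
      using star_homomorphism_contractive[OF A one, of \<pi> "S - T"] hom[OF \<pi>] AD(9)[OF ST] by simp
  qed
  have "cstar_subalgebra E"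
    unfolding cstar_subalgebra_def
  proof (intro conjI ballI allI)
    show "E \<subseteq> bounded_ops" using AD(1) by (auto simp: E_def)
    show "closed E"
      unfolding closed_sequential_limits
    proof (intro allI impI)
      fix X l assume X: "(\<forall>n. X n \<in> E) \<and> X \<longlonglongrightarrow> l"
      then have XA: "X n \<in> ?A" and eq: "\<Phi> (X n) = \<Psi> (X n)" for n by (auto simp: E_def)
      have l: "l \<in> ?A" using closed_sequentially[OF AD(2)] XA X by blast
      have "(\<lambda>n. X n - l) \<longlonglongrightarrow> 0" using X LIM_zero by blast
      then have n0: "(\<lambda>n. norm (X n - l)) \<longlonglongrightarrow> 0" by (rule tendsto_norm_zero)
      have conv: "(\<lambda>n. \<pi> (X n)) \<longlonglongrightarrow> \<pi> l" if \<pi>: "star_isomorphism \<pi> ?A B" for \<pi>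
      proof (rule LIM_zero_cancel, rule tendsto_0_le[OF n0, where K = 1])
        show "\<forall>\<^sub>F n in sequentially. norm (\<pi> (X n) - \<pi> l) \<le> norm (norm (X n - l)) * 1"
          using dist[OF \<pi> XA l] by (intro always_eventually allI) simp
      qed
      have "\<Phi> l = \<Psi> l"
        using conv[OF \<Phi>] conv[OF \<Psi>] unfolding eq by (rule LIMSEQ_unique)
      with l show "l \<in> E" by (simp add: E_def)
    qed
    have "\<pi> 0 = 0" if "star_isomorphism \<pi> ?A B" for \<pi>
      using hom(1)[OF that AD(3) AD(3)] by simp
    from this[OF \<Phi>] this[OF \<Psi>] show "0 \<in> E" using AD(3) by (simp add: E_def)
  qed (use hom[OF \<Phi>] hom[OF \<Psi>] AD in \<open>auto simp: E_def\<close>)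
  moreover have "G \<subseteq> E" using G by (auto simp: E_def cstar_generated_def)
  ultimately have "?A \<subseteq> E" unfolding cstar_generated_def by blast
  with S show ?thesis by (auto simp: E_def)
qed


section \<open>Left inverse hulls and characters\<close>

lemma hull_partial_bij: "s \<in> left_inverse_hull \<Longrightarrow> partial_bij (s :: ('p::cancel_semigroup_add \<times> 'p) set)"
  using left_inverse_hull_single_valued by (simp add: partial_bij_def)

lemma hull_Id: "Id \<in> (left_inverse_hull :: ('p::cancel_semigroup_add \<times> 'p) set set)"
proof -
  have "range (\<lambda>x. (x, p + x)) O (range (\<lambda>x. (x, p + x)))\<inverse> \<in> left_inverse_hull" for p :: 'p
    by (intro left_inverse_hull.intros)
  moreover have "range (\<lambda>x. (x, p + x)) O (range (\<lambda>x. (x, p + x)))\<inverse> = Id" for p :: 'p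
    by auto
  ultimately show ?thesis by simp
qed

lemma hull_relcomp_converse:
  "s \<in> left_inverse_hull \<Longrightarrow> s O s\<inverse> = Id_on (Domain (s :: ('p::cancel_semigroup_add \<times> 'p) set))"
  using left_inverse_hull_single_valued[of s] by (auto simp: single_valued_def Id_on_def)

lemma Domain_constructible: "s \<in> left_inverse_hull \<Longrightarrow> Domain s \<in> constructible_ideals"
  by (simp add: constructible_ideals_def)

lemma hull_Id_on:
  "X \<in> constructible_ideals \<Longrightarrow> Id_on (X :: 'p::cancel_semigroup_add set) \<in> left_inverse_hull"
  unfolding constructible_ideals_def
  by (metis hull_relcomp_converse image_iff left_inverse_hull.inverse left_inverse_hull.product)

lemma
  fixes \<omega> :: "'p::cancel_semigroup_add Omega"
  shows character_constructible: "character \<omega> X \<Longrightarrow> X \<in> constructible_ideals"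
    and character_Int: "X \<in> constructible_ideals \<Longrightarrow> Y \<in> constructible_ideals \<Longrightarrow>
      character \<omega> (X \<inter> Y) \<longleftrightarrow> character \<omega> X \<and> character \<omega> Y"
    and character_empty: "\<not> character \<omega> {}"
    and character_cover: "finite \<F> \<Longrightarrow> \<F> \<subseteq> constructible_ideals \<Longrightarrow> character \<omega> (\<Union>\<F>) \<Longrightarrow>
      \<exists>Y\<in>\<F>. character \<omega> Y"
    and character_UNIV: "character \<omega> UNIV"
proof -
  have c: "character \<omega> \<in> semilattice_characters"
    and f: "\<And>X \<F>. X \<in> constructible_ideals \<Longrightarrow> finite \<F> \<Longrightarrow> \<F> \<subseteq> constructible_ideals \<Longrightarrow>
      X = \<Union>\<F> \<Longrightarrow> character \<omega> X \<Longrightarrow> \<exists>Y\<in>\<F>. character \<omega> Y"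
    using character[of \<omega>] by auto
  show 1: "character \<omega> X \<Longrightarrow> X \<in> constructible_ideals" for X
    using c by (auto simp: semilattice_characters_def)
  show 2: "X \<in> constructible_ideals \<Longrightarrow> Y \<in> constructible_ideals \<Longrightarrow>
      character \<omega> (X \<inter> Y) \<longleftrightarrow> character \<omega> X \<and> character \<omega> Y" for X Y
    using c by (auto simp: semilattice_characters_def)
  have "({} :: 'p set) \<in> constructible_ideals \<longrightarrow> \<not> character \<omega> {}"
    using c by (simp add: semilattice_characters_def)
  with 1[of "{}"] show "\<not> character \<omega> {}" by blast
  show "finite \<F> \<Longrightarrow> \<F> \<subseteq> constructible_ideals \<Longrightarrow> character \<omega> (\<Union>\<F>) \<Longrightarrow> \<exists>Y\<in>\<F>. character \<omega> Y"
    using f[OF 1 _ _ refl] by simp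
  obtain X where "X \<in> constructible_ideals" "character \<omega> X"
    using c by (auto simp: semilattice_characters_def)
  then show "character \<omega> UNIV" using 2[of X UNIV] UNIV_constructible by simp
qed

lemma character_mono:
  "character \<omega> X \<Longrightarrow> X \<subseteq> Y \<Longrightarrow> Y \<in> constructible_ideals \<Longrightarrow> character \<omega> Y"
  using character_Int[of X Y \<omega>] character_constructible[of \<omega> X] by (simp add: Int_absorb2)

lemma character_nonempty: "character \<omega> (Domain s) \<Longrightarrow> s \<noteq> {}"
  using character_empty[of \<omega>] by auto

lemma Omega_eqI:
  assumes "\<And>X. X \<in> constructible_ideals \<Longrightarrow> character \<omega> X \<longleftrightarrow> character \<psi> X"
  shows "\<omega> = \<psi>"
proof -
  have "character \<omega> = character \<psi>"
    using assms character_constructible by (intro ext) blast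
  then show ?thesis by (simp add: character_inject)
qed

definition point_character :: "'p::cancel_semigroup_add \<Rightarrow> 'p Omega" where
  "point_character q = Abs_Omega (\<lambda>X. X \<in> constructible_ideals \<and> q \<in> X)"

lemma character_point: "character (point_character q) X \<longleftrightarrow> X \<in> constructible_ideals \<and> q \<in> X"
proof -
  have "(\<lambda>X. X \<in> constructible_ideals \<and> q \<in> X) \<in> semilattice_characters"
    using UNIV_constructible by (auto simp: semilattice_characters_def constructible_ideals_Int)
  then show ?thesis
    unfolding point_character_def by (subst Abs_Omega_inverse) auto
qed

text \<open>The point characters are dense. If no point matched the character on the given ideals, the
  intersection of the ideals of value one would be the union of its intersections with the ideals
  of value zero, which the covering condition defining the spectrum excludes.\<close>

lemma point_matching_character:
  assumes \<X>: "finite \<X>" "\<X> \<subseteq> constructible_ideals"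
  shows "\<exists>q. \<forall>X\<in>\<X>. q \<in> X \<longleftrightarrow> character \<omega> X"
proof (rule ccontr)
  assume no: "\<not> ?thesis"
  define A where "A = {X \<in> \<X>. character \<omega> X}"
  have "character \<omega> (\<Inter>A')" if "finite A'" "A' \<subseteq> A" for A'
    using that
  proof (induction A')
    case empty show ?case by (simp add: character_UNIV)
  next
    case (insert X A')
    then have "character \<omega> X" "character \<omega> (\<Inter>A')" by (auto simp: A_def)
    then show ?case
      using character_Int[OF character_constructible[of \<omega> X] character_constructible[of \<omega> "\<Inter>A'"], of \<omega>] by simp
  qed
  moreover have "finite A" using \<X> by (simp add: A_def)
  ultimately have A: "character \<omega> (\<Inter>A)" by blast
  let ?F = "(\<lambda>Y. \<Inter>A \<inter> Y) ` (\<X> - A)"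
  have "\<Inter>A = \<Union>?F"
  proof
    show "\<Inter>A \<subseteq> \<Union>?F"
    proof
      fix q assume q: "q \<in> \<Inter>A"
      from no obtain X where X: "X \<in> \<X>" "\<not> (q \<in> X \<longleftrightarrow> character \<omega> X)" by blast
      with q have "q \<in> X" "X \<notin> A" by (auto simp: A_def)
      with q X show "q \<in> \<Union>?F" by auto
    qed
  qed auto
  moreover have "?F \<subseteq> constructible_ideals"
    using \<X> character_constructible[OF A] by (auto intro: constructible_ideals_Int)
  ultimately obtain Y where "Y \<in> \<X> - A" "character \<omega> (\<Inter>A \<inter> Y)"
    using character_cover[of ?F \<omega>] A \<X>(1) by auto
  moreover from this have "character \<omega> Y"
    using character_Int[OF character_constructible[OF A], of Y] \<X> by auto
  ultimately show False by (auto simp: A_def)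
qed


section \<open>Translation by group elements\<close>

locale semigroup_embedding =
  fixes \<iota> :: "'p::cancel_semigroup_add \<Rightarrow> 'g::group_add"
  assumes hom: "\<iota> (p + q) = \<iota> p + \<iota> q"
    and inj: "inj \<iota>"
begin

lemma iota_eq: "\<iota> x = \<iota> y \<longleftrightarrow> x = y"
  using inj by (auto dest: injD)

lemma group_value:
  assumes "s \<in> left_inverse_hull" "(x, y) \<in> s"
  shows "group_value \<iota> s = \<iota> y - \<iota> x"
proof -
  have "\<exists>g. \<forall>(x, y)\<in>s. \<iota> y = g + \<iota> x"
    using assms(1)
  proof induction
    case (translation p)
    show ?case by (rule exI[of _ "\<iota> p"]) (auto simp: hom)
  next
    case (inverse s)
    then obtain g where "\<forall>(x, y)\<in>s. \<iota> y = g + \<iota> x" by blast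
    then show ?case by (intro exI[of _ "- g"]) (auto simp: add.assoc[symmetric])
  next
    case (product s t)
    then obtain g h where "\<forall>(x, y)\<in>s. \<iota> y = g + \<iota> x" "\<forall>(x, y)\<in>t. \<iota> y = h + \<iota> x" by blast
    then show ?case by (intro exI[of _ "h + g"]) (fastforce simp: add.assoc)
  qed
  then obtain g where g: "\<forall>(x, y)\<in>s. \<iota> y = g + \<iota> x" by blast
  have "group_value \<iota> s = g"
    unfolding group_value_def
  proof (rule the_equality[where P = "\<lambda>g. \<forall>(x, y)\<in>s. \<iota> y = g + \<iota> x", OF g])
    fix h assume "\<forall>(x, y)\<in>s. \<iota> y = h + \<iota> x"
    with g assms(2) have "h + \<iota> x = g + \<iota> x" by fastforce
    then show "h = g" by simp
  qed
  with g assms(2) show ?thesis by fastforce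
qed

lemma group_value_apply: "s \<in> left_inverse_hull \<Longrightarrow> (x, y) \<in> s \<Longrightarrow> \<iota> y = group_value \<iota> s + \<iota> x"
  by (simp add: group_value)

lemma group_value_relcomp:
  assumes "s \<in> left_inverse_hull" "t \<in> left_inverse_hull" "s O t \<noteq> {}"
  shows "group_value \<iota> (s O t) = group_value \<iota> t + group_value \<iota> s"
proof -
  from assms(3) obtain x y z where xyz: "(x, y) \<in> s" "(y, z) \<in> t" by auto
  then have "(x, z) \<in> s O t" by auto
  from group_value[OF left_inverse_hull.product[OF assms(1,2)] this]
  show ?thesis
    by (simp add: group_value[OF assms(1) xyz(1)] group_value[OF assms(2) xyz(2)]
        diff_conv_add_uminus add.assoc del: add_uminus_conv_diff)
qed

lemma group_value_converse:
  assumes "s \<in> left_inverse_hull" "s \<noteq> {}"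
  shows "group_value \<iota> (s\<inverse>) = - group_value \<iota> s"
proof -
  from assms(2) obtain x y where xy: "(x, y) \<in> s" by auto
  then show ?thesis
    using group_value[OF left_inverse_hull.inverse[OF assms(1)], of y x] group_value[OF assms(1) xy] by simp
qed

text \<open>Whether a character can be moved by a product depends on the first factor only through its
  group element: by injectivity of the embedding, partial bijections with the same group element
  agree wherever both are defined.\<close>

lemma character_relcomp_cong:
  assumes t: "t \<in> left_inverse_hull" "t' \<in> left_inverse_hull" and s: "s \<in> left_inverse_hull"
    and v: "group_value \<iota> t = group_value \<iota> t'"
    and ct: "character \<omega> (Domain t)" and ct': "character \<omega> (Domain (t' O s))"
  shows "character \<omega> (Domain (t O s))"
proof (rule character_mono)
  show "character \<omega> (Domain t \<inter> Domain (t' O s))"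
    using ct ct' character_Int[OF character_constructible character_constructible] by blast
  show "Domain t \<inter> Domain (t' O s) \<subseteq> Domain (t O s)"
  proof clarify
    fix x y y' z assume h: "(x, y) \<in> t" "(x, y') \<in> t'" "(y', z) \<in> s"
    then have "\<iota> y = \<iota> y'" using t v by (simp add: group_value_apply)
    then have "y = y'" by (simp add: iota_eq)
    with h show "x \<in> Domain (t O s)" by auto
  qed
  show "Domain (t O s) \<in> constructible_ideals"
    by (intro Domain_constructible left_inverse_hull.product t s)
qed

text \<open>The pair \<open>(k, \<omega>)\<close> represents the translate \<open>k.\<omega>\<close>, and the condition says that \<open>k.\<omega>\<close> exists
  and takes the value one on the domain of \<open>s\<close>. It is expressed through some \<open>t\<close> with group
  element \<open>k\<close> rather than through the partial action, so that products and inverses reduce to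
  calculations in the left inverse hull.\<close>

definition lift :: "('p \<times> 'p) set \<Rightarrow> (('g \<times> 'p Omega) \<times> ('g \<times> 'p Omega)) set" where
  "lift s = {((k, \<omega>), (group_value \<iota> s + k, \<omega>)) | k \<omega>.
     \<exists>t\<in>left_inverse_hull. group_value \<iota> t = k \<and> character \<omega> (Domain (t O s))}"

lemma partial_bij_lift: "partial_bij (lift s)"
  by (rule partial_bijI) (auto simp: lift_def)

text \<open>The choice of \<open>t\<close> in the definition does not matter.\<close>

lemma lift_iff:
  assumes "s \<in> left_inverse_hull" "t \<in> left_inverse_hull" "character \<omega> (Domain t)"
  shows "((group_value \<iota> t, \<omega>), y) \<in> lift s \<longleftrightarrow>
    character \<omega> (Domain (t O s)) \<and> y = (group_value \<iota> s + group_value \<iota> t, \<omega>)"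
  using assms character_relcomp_cong[OF assms(2) _ assms(1) _ assms(3)]
  by (auto simp: lift_def)

lemma lift_relcomp:
  assumes s: "s \<in> left_inverse_hull" and u: "u \<in> left_inverse_hull"
  shows "lift (s O u) = lift s O lift u"
proof (intro set_eqI iffI)
  note su = left_inverse_hull.product[OF s u]
  fix z assume "z \<in> lift (s O u)"
  then obtain t \<omega> where t: "t \<in> left_inverse_hull" and c: "character \<omega> (Domain (t O s O u))"
    and z: "z = ((group_value \<iota> t, \<omega>), (group_value \<iota> (s O u) + group_value \<iota> t, \<omega>))"
    by (auto simp: lift_def)
  note ts = left_inverse_hull.product[OF t s]
  have ct: "character \<omega> (Domain t)"
    by (rule character_mono[OF c _ Domain_constructible[OF t]]) auto
  have cts: "character \<omega> (Domain (t O s))"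
    by (rule character_mono[OF c _ Domain_constructible[OF ts]]) auto
  have ne: "t O s \<noteq> {}" "s O u \<noteq> {}" using character_nonempty[OF c] by auto
  have "((group_value \<iota> t, \<omega>), (group_value \<iota> s + group_value \<iota> t, \<omega>)) \<in> lift s"
    using lift_iff[OF s t ct] cts by simp
  moreover have "((group_value \<iota> (t O s), \<omega>), (group_value \<iota> u + group_value \<iota> (t O s), \<omega>)) \<in> lift u"
    using lift_iff[OF u ts cts] c by (simp add: O_assoc)
  ultimately show "z \<in> lift s O lift u"
    unfolding z group_value_relcomp[OF t s ne(1)] group_value_relcomp[OF s u ne(2)]
    by (auto simp: add.assoc)
next
  note su = left_inverse_hull.product[OF s u]
  fix z assume "z \<in> lift s O lift u"
  then obtain t t' \<omega> where t: "t \<in> left_inverse_hull" "t' \<in> left_inverse_hull"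
    and c: "character \<omega> (Domain (t O s))" "character \<omega> (Domain (t' O u))"
    and t': "group_value \<iota> t' = group_value \<iota> s + group_value \<iota> t"
    and z: "z = ((group_value \<iota> t, \<omega>), (group_value \<iota> u + group_value \<iota> t', \<omega>))"
    by (auto simp: lift_def)
  note ts = left_inverse_hull.product[OF t(1) s]
  have ct: "character \<omega> (Domain t)"
    by (rule character_mono[OF c(1) _ Domain_constructible[OF t(1)]]) auto
  have "group_value \<iota> (t O s) = group_value \<iota> t'"
    using group_value_relcomp[OF t(1) s character_nonempty[OF c(1)]] t' by simp
  from character_relcomp_cong[OF ts t(2) u this c] have c3: "character \<omega> (Domain (t O s O u))"
    by (simp add: O_assoc)
  then have "s O u \<noteq> {}" using character_nonempty[OF c3] by auto
  then show "z \<in> lift (s O u)"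
    unfolding z t' using lift_iff[OF su t(1) ct] c3 group_value_relcomp[OF s u]
    by (simp add: add.assoc)
qed

lemma lift_converse_subset:
  assumes s: "s \<in> left_inverse_hull"
  shows "(lift s)\<inverse> \<subseteq> lift (s\<inverse>)"
proof
  fix z assume "z \<in> (lift s)\<inverse>"
  then obtain t \<omega> where t: "t \<in> left_inverse_hull" and c: "character \<omega> (Domain (t O s))"
    and z: "z = ((group_value \<iota> s + group_value \<iota> t, \<omega>), (group_value \<iota> t, \<omega>))"
    by (auto simp: lift_def)
  note ts = left_inverse_hull.product[OF t s]
  have "Domain ((t O s) O s\<inverse>) = Domain (t O s)" by auto
  then have "((group_value \<iota> (t O s), \<omega>), (group_value \<iota> (s\<inverse>) + group_value \<iota> (t O s), \<omega>)) \<in> lift (s\<inverse>)"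
    using lift_iff[OF left_inverse_hull.inverse[OF s] ts c] c by simp
  moreover have "s \<noteq> {}" "t O s \<noteq> {}" using character_nonempty[OF c] by auto
  ultimately show "z \<in> lift (s\<inverse>)"
    unfolding z by (simp add: group_value_relcomp t s group_value_converse add.assoc[symmetric])
qed

lemma lift_converse: "s \<in> left_inverse_hull \<Longrightarrow> lift (s\<inverse>) = (lift s)\<inverse>"
  using lift_converse_subset[of s] lift_converse_subset[of "s\<inverse>"] left_inverse_hull.inverse[of s] by auto


section \<open>The two representations have the same norms\<close>

text \<open>The graph of the isomorphism on the dense subalgebras. The generators are closed under complex
  scaling, so their real span is their complex span.\<close>

definition paired :: "('p operator \<times> ('g \<times> 'p Omega) operator) set" where
  "paired = span {(op_scale c (pshift s), op_scale c (pshift (lift s))) | c s. s \<in> left_inverse_hull}"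

lemma subspace_paired: "subspace paired"
  by (simp add: paired_def)

lemma paired_generator:
  "s \<in> left_inverse_hull \<Longrightarrow> (op_scale c (pshift s), op_scale c (pshift (lift s))) \<in> paired"
  unfolding paired_def by (rule span_base) blast

lemma paired_induct [consumes 1, case_names zero add scaleR generator]:
  assumes "(S, T) \<in> paired" and "P 0 0"
    and "\<And>S T S' T'. P S T \<Longrightarrow> P S' T' \<Longrightarrow> P (S + S') (T + T')"
    and "\<And>r S T. P S T \<Longrightarrow> P (r *\<^sub>R S) (r *\<^sub>R T)"
    and "\<And>c s. s \<in> left_inverse_hull \<Longrightarrow> P (op_scale c (pshift s)) (op_scale c (pshift (lift s)))"
  shows "P S T"
proof -
  have "case (S, T) of (S, T) \<Rightarrow> P S T"
    using assms(1) unfolding paired_def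
  proof (rule span_induct)
    show "subspace {x. case x of (S, T) \<Rightarrow> P S T}"
      by (rule subspaceI) (use assms(2,3,4) in \<open>auto simp: zero_prod_def\<close>)
  qed (use assms(5) in auto)
  then show ?thesis by simp
qed

lemma paired_bounded: "(S, T) \<in> paired \<Longrightarrow> S \<in> bounded_ops \<and> T \<in> bounded_ops"
proof (induction rule: paired_induct)
  case (scaleR r S T)
  then show ?case
    using bounded_ops_op_scale[of S "complex_of_real r"] bounded_ops_op_scale[of T "complex_of_real r"]
    by (simp add: op_scale_of_real)
qed (auto intro: bounded_ops_0 bounded_ops_add bounded_ops_op_scale pshift_bounded_ops
    hull_partial_bij partial_bij_lift)

lemma paired_op_scale:
  assumes "(S, T) \<in> paired"
  shows "(op_scale c S, op_scale c T) \<in> paired"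
proof -
  interpret l1: bounded_linear "op_scale c :: 'p operator \<Rightarrow> _" by (rule bounded_linear_op_scale)
  interpret l2: bounded_linear "op_scale c :: ('g \<times> 'p Omega) operator \<Rightarrow> _" by (rule bounded_linear_op_scale)
  show ?thesis
    using assms
  proof (induction rule: paired_induct)
    case zero
    show ?case using subspace_0[OF subspace_paired] by (simp add: l1.zero l2.zero zero_prod_def)
  next
    case (add S T S' T')
    then show ?case using subspace_add[OF subspace_paired] by (force simp: l1.add l2.add)
  next
    case (scaleR r S T)
    then show ?case using subspace_scale[OF subspace_paired] by (force simp: l1.scaleR l2.scaleR)
  next
    case (generator d s)
    then show ?case by (simp add: op_scale_op_scale paired_generator)
  qed
qed

lemma paired_compose:
  assumes "(S, T) \<in> paired" "(S', T') \<in> paired"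
  shows "(S o\<^sub>L S', T o\<^sub>L T') \<in> paired"
proof -
  note bil = bounded_bilinear_blinfun_compose
  note [simp] = bounded_bilinear.zero_left[OF bil] bounded_bilinear.zero_right[OF bil]
    bounded_bilinear.add_left[OF bil] bounded_bilinear.add_right[OF bil]
    bounded_bilinear.scaleR_left[OF bil] bounded_bilinear.scaleR_right[OF bil]
  have z: "(0, 0) \<in> paired" using subspace_0[OF subspace_paired] by (simp add: zero_prod_def)
  have a: "(S + S', T + T') \<in> paired" if "(S, T) \<in> paired" "(S', T') \<in> paired" for S T S' T'
    using subspace_add[OF subspace_paired that] by simp
  have r: "(x *\<^sub>R S, x *\<^sub>R T) \<in> paired" if "(S, T) \<in> paired" for x S T
    using subspace_scale[OF subspace_paired that] by simp
  have gen: "(S o\<^sub>L op_scale c (pshift u), T o\<^sub>L op_scale c (pshift (lift u))) \<in> paired"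
    if "(S, T) \<in> paired" "u \<in> left_inverse_hull" for S T u c
    using that(1)
  proof (induction rule: paired_induct)
    case (generator d s)
    have "(op_scale (d * c) (pshift (u O s)), op_scale (d * c) (pshift (lift (u O s)))) \<in> paired"
      by (intro paired_generator left_inverse_hull.product that generator)
    then show ?case
      using generator that(2)
      by (simp add: op_scale_compose pshift_bounded_ops hull_partial_bij partial_bij_lift
          pshift_compose lift_relcomp)
  qed (simp_all add: z a r)
  show ?thesis
    using assms(2) by (induction rule: paired_induct) (simp_all add: z a r gen[OF assms(1)])
qed

lemma paired_adj:
  assumes "(S, T) \<in> paired"
  shows "(adj S, adj T) \<in> paired"
proof -
  have "(S, T) \<in> paired \<and> (adj S, adj T) \<in> paired"
    using assms
  proof (induction rule: paired_induct)
    case zero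
    have "adj (0 :: 'p operator) = 0" "adj (0 :: ('g \<times> 'p Omega) operator) = 0"
      using adj_scaleR[OF bounded_ops_0, of 0] by simp_all
    then show ?case using subspace_0[OF subspace_paired] by (simp add: zero_prod_def)
  next
    case (add S T S' T')
    then show ?case
      using subspace_add[OF subspace_paired, of "(S, T)" "(S', T')"]
        subspace_add[OF subspace_paired, of "(adj S, adj T)" "(adj S', adj T')"]
        paired_bounded[of S T] paired_bounded[of S' T'] by (simp add: adj_add)
  next
    case (scaleR r S T)
    then show ?case
      using subspace_scale[OF subspace_paired, of "(S, T)" r]
        subspace_scale[OF subspace_paired, of "(adj S, adj T)" r]
        paired_bounded[of S T] by (simp add: adj_scaleR)
  next
    case (generator c s)
    then show ?case
      using paired_generator[OF generator] paired_generator[OF left_inverse_hull.inverse[OF generator], of "cnj c"]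
      by (simp add: adj_op_scale adj_pshift pshift_bounded_ops hull_partial_bij partial_bij_lift lift_converse)
  qed
  then show ?thesis ..
qed

text \<open>The point \<open>y\<close> of the orbit of \<open>q\<close> is reached from \<open>q\<close> by the group element \<open>\<iota> y - \<iota> q\<close>, which
  becomes the first coordinate in the fibre over \<open>\<omega>\<close>.\<close>

abbreviation orbit_map :: "'p \<Rightarrow> 'p Omega \<Rightarrow> 'p ell2 \<Rightarrow>\<^sub>L ('g \<times> 'p Omega) ell2" where
  "orbit_map q \<omega> \<equiv> pshift (range (\<lambda>y. (y, (\<iota> y - \<iota> q, \<omega>))))"

lemma inj_orbit: "inj (\<lambda>y. (\<iota> y - \<iota> q, \<omega>))"
  by (rule injI) (simp add: diff_conv_add_uminus iota_eq del: add_uminus_conv_diff)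

lemma norm_orbit_map: "norm (blinfun_apply (orbit_map q \<omega>) x) = norm x"
  by (rule norm_pshift_total[OF inj_orbit])

lemma orbit_map_ket:
  "blinfun_apply (orbit_map q \<omega>) (cscale d (ket y)) = cscale d (ket (\<iota> y - \<iota> q, \<omega>))"
  by (rule pshift_ket)
    (auto intro!: partial_bijI simp: diff_conv_add_uminus iota_eq simp del: add_uminus_conv_diff)

text \<open>The orbit map intertwines the two representations, but only on finitely many basis vectors at
  a time, and only if the point \<open>q\<close> looks like the character \<open>\<omega>\<close> on finitely many ideals.\<close>

lemma orbit_map_intertwines:
  assumes "(S, T) \<in> paired" and t: "t \<in> left_inverse_hull" and ct: "character \<omega> (Domain t)"
  shows "\<exists>\<X>. finite \<X> \<and> \<X> \<subseteq> constructible_ideals \<and>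
    (\<forall>q y d. (\<forall>X\<in>\<X>. q \<in> X \<longleftrightarrow> character \<omega> X) \<longrightarrow> (q, y) \<in> t \<longrightarrow>
      blinfun_apply T (blinfun_apply (orbit_map q \<omega>) (cscale d (ket y))) =
      blinfun_apply (orbit_map q \<omega>) (blinfun_apply S (cscale d (ket y))))"
    (is "\<exists>\<X>. ?P S T \<X>")
  using assms(1)
proof (induction rule: paired_induct)
  case zero
  show ?case by (rule exI[of _ "{}"]) simp
next
  case (add S T S' T')
  then obtain \<X> \<X>' where "?P S T \<X>" "?P S' T' \<X>'" by blast
  then show ?case
    by (intro exI[of _ "\<X> \<union> \<X>'"]) (auto simp: blinfun.add_left blinfun.add_right)
next
  case (scaleR r S T)
  then obtain \<X> where "?P S T \<X>" by blast
  then show ?case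
    by (intro exI[of _ \<X>]) (simp add: blinfun.scaleR_left blinfun.scaleR_right)
next
  case (generator c s)
  note ts = left_inverse_hull.product[OF t generator]
  show ?case
  proof (intro exI[of _ "{Domain (t O s)}"] conjI allI impI)
    show "{Domain (t O s)} \<subseteq> constructible_ideals" using Domain_constructible[OF ts] by simp
    fix q y d
    assume q: "\<forall>X\<in>{Domain (t O s)}. q \<in> X \<longleftrightarrow> character \<omega> X" and qy: "(q, y) \<in> t"
    have k: "\<iota> y - \<iota> q = group_value \<iota> t" using group_value[OF t qy] by simp
    note ps = hull_partial_bij[OF generator]
    have yz: "y \<in> Domain s \<longleftrightarrow> q \<in> Domain (t O s)"
      using qy partial_bijD(1)[OF hull_partial_bij[OF t] qy] by auto
    show "blinfun_apply (op_scale c (pshift (lift s))) (blinfun_apply (orbit_map q \<omega>) (cscale d (ket y))) =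
      blinfun_apply (orbit_map q \<omega>) (blinfun_apply (op_scale c (pshift s)) (cscale d (ket y)))"
    proof (cases "y \<in> Domain s")
      case True
      then obtain z where z: "(y, z) \<in> s" by auto
      have "((group_value \<iota> t, \<omega>), (group_value \<iota> s + group_value \<iota> t, \<omega>)) \<in> lift s"
        using True yz q lift_iff[OF generator t ct] by simp
      moreover have "group_value \<iota> s + group_value \<iota> t = \<iota> z - \<iota> q"
        unfolding group_value[OF generator z] k[symmetric]
        by (simp add: diff_conv_add_uminus add.assoc del: add_uminus_conv_diff)
      ultimately show ?thesis
        by (simp add: orbit_map_ket op_scale_apply k pshift_ket[OF ps z] pshift_ket[OF partial_bij_lift])
    next
      case False
      then have "(group_value \<iota> t, \<omega>) \<notin> Domain (lift s)"
        using yz q lift_iff[OF generator t ct] by auto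
      with False show ?thesis
        by (simp add: orbit_map_ket op_scale_apply k pshift_ket_0[OF ps] pshift_ket_0[OF partial_bij_lift])
    qed
  qed simp
qed

text \<open>A finitely supported vector in the fibre over \<open>\<omega>\<close> is the image under an orbit map of a vector of
  the same norm in the semigroup representation; for a point \<open>q\<close> close enough to \<open>\<omega>\<close> the
  operators correspond on these two vectors. Basis vectors outside the domain of the partial action
  are annihilated.\<close>

lemma paired_norm_le:
  assumes ST: "(S, T) \<in> paired"
  shows "norm T \<le> norm S"
proof -
  let ?D = "{(k, \<omega>). \<exists>t\<in>left_inverse_hull. group_value \<iota> t = k \<and> character \<omega> (Domain t)}"
  have Tb: "T \<in> bounded_ops" using paired_bounded[OF ST] by simp
  have block: "coord (blinfun_apply T (ket i)) j \<noteq> 0 \<Longrightarrow> snd j = snd i" for i j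
    using ST
  proof (induction rule: paired_induct)
    case (add S T S' T')
    then show ?case by (cases "coord (blinfun_apply T (ket i)) j = 0") (auto simp: blinfun.add_left)
  next
    case (generator c s)
    show ?case
    proof (cases "i \<in> Domain (lift s)")
      case True
      then obtain j' where j': "(i, j') \<in> lift s" by auto
      then have "snd j' = snd i" by (auto simp: lift_def)
      with generator(2) show ?thesis
        using pshift_ket[OF partial_bij_lift j', of 1] by (auto simp: op_scale_apply split: if_splits)
    next
      case False
      with generator(2) show ?thesis
        using pshift_ket_0[OF partial_bij_lift False, of 1] by (simp add: op_scale_apply)
    qed
  qed (auto simp: blinfun.add_left blinfun.scaleR_left)
  have ker: "blinfun_apply T (ket i) = 0" if i: "i \<notin> ?D" for i
    using ST
  proof (induction rule: paired_induct)
    case (generator c s)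
    have "i \<notin> Domain (lift s)"
    proof
      assume "i \<in> Domain (lift s)"
      then obtain t \<omega> where t: "t \<in> left_inverse_hull" "character \<omega> (Domain (t O s))" "i = (group_value \<iota> t, \<omega>)"
        by (auto simp: lift_def)
      then have "character \<omega> (Domain t)"
        by (intro character_mono[OF t(2) _ Domain_constructible[OF t(1)]]) auto
      with t i show False by blast
    qed
    from pshift_ket_0[OF partial_bij_lift this, of 1] show ?case by (simp add: op_scale_apply)
  qed (auto simp: blinfun.add_left blinfun.scaleR_left)
  show ?thesis
  proof (rule norm_le_of_block_bounds[OF Tb norm_ge_zero block ker])
    fix F c
    assume F: "finite F" "F \<subseteq> ?D" and eq: "\<And>i j. i \<in> F \<Longrightarrow> j \<in> F \<Longrightarrow> snd i = snd j"
    show "norm (blinfun_apply T (\<Sum>i\<in>F. cscale (c i) (ket i))) \<le> norm S * norm (\<Sum>i\<in>F. cscale (c i) (ket i))"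
    proof (cases "F = {}")
      case False
      then obtain \<omega> where \<omega>: "\<And>i. i \<in> F \<Longrightarrow> snd i = \<omega>" using eq by blast
      have "\<forall>i\<in>F. \<exists>t. t \<in> left_inverse_hull \<and> group_value \<iota> t = fst i \<and> character \<omega> (Domain t)"
        using F(2) \<omega> by fastforce
      then obtain t where t: "\<And>i. i \<in> F \<Longrightarrow> t i \<in> left_inverse_hull"
        "\<And>i. i \<in> F \<Longrightarrow> group_value \<iota> (t i) = fst i" "\<And>i. i \<in> F \<Longrightarrow> character \<omega> (Domain (t i))"
        by metis
      have "\<forall>i\<in>F. \<exists>\<X>. finite \<X> \<and> \<X> \<subseteq> constructible_ideals \<and>
        (\<forall>q y d. (\<forall>X\<in>\<X>. q \<in> X \<longleftrightarrow> character \<omega> X) \<longrightarrow> (q, y) \<in> t i \<longrightarrow>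
          blinfun_apply T (blinfun_apply (orbit_map q \<omega>) (cscale d (ket y))) =
          blinfun_apply (orbit_map q \<omega>) (blinfun_apply S (cscale d (ket y))))"
        by (intro ballI orbit_map_intertwines[OF ST] t)
      from bchoice[OF this] obtain \<X> where X: "\<forall>i\<in>F. finite (\<X> i) \<and> \<X> i \<subseteq> constructible_ideals \<and>
        (\<forall>q y d. (\<forall>X\<in>\<X> i. q \<in> X \<longleftrightarrow> character \<omega> X) \<longrightarrow> (q, y) \<in> t i \<longrightarrow>
          blinfun_apply T (blinfun_apply (orbit_map q \<omega>) (cscale d (ket y))) =
          blinfun_apply (orbit_map q \<omega>) (blinfun_apply S (cscale d (ket y))))" ..
      then have \<X>: "\<And>i. i \<in> F \<Longrightarrow> finite (\<X> i) \<and> \<X> i \<subseteq> constructible_ideals"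
        and inter: "\<And>i q y d. i \<in> F \<Longrightarrow> (\<forall>X\<in>\<X> i. q \<in> X \<longleftrightarrow> character \<omega> X) \<Longrightarrow> (q, y) \<in> t i \<Longrightarrow>
          blinfun_apply T (blinfun_apply (orbit_map q \<omega>) (cscale d (ket y))) =
          blinfun_apply (orbit_map q \<omega>) (blinfun_apply S (cscale d (ket y)))"
        by simp_all
      let ?Y = "\<Union>i\<in>F. insert (Domain (t i)) (\<X> i)"
      have fY: "finite ?Y" using F(1) \<X> by blast
      have "?Y \<subseteq> constructible_ideals" using \<X> Domain_constructible[OF t(1)] by blast
      from point_matching_character[OF fY this, of \<omega>]
      obtain q where q: "\<forall>X\<in>?Y. q \<in> X \<longleftrightarrow> character \<omega> X" ..
      have "q \<in> Domain (t i)" if "i \<in> F" for i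
        using bspec[OF q, of "Domain (t i)"] that t(3)[OF that] by blast
      then have "\<forall>i\<in>F. \<exists>y. (q, y) \<in> t i" by (simp add: Domain_iff)
      then obtain y where y: "\<And>i. i \<in> F \<Longrightarrow> (q, y i) \<in> t i" by metis
      define \<eta> where "\<eta> = (\<Sum>i\<in>F. cscale (c i) (ket (y i)))"
      have L: "blinfun_apply (orbit_map q \<omega>) (cscale d (ket (y i))) = cscale d (ket i)" if "i \<in> F" for i d
      proof -
        have "(\<iota> (y i) - \<iota> q, \<omega>) = i"
          using group_value[OF t(1) y, OF that that] t(2)[OF that] \<omega>[OF that] by (simp add: prod_eq_iff)
        then show ?thesis by (simp add: orbit_map_ket)
      qed
      have \<xi>: "(\<Sum>i\<in>F. cscale (c i) (ket i)) = blinfun_apply (orbit_map q \<omega>) \<eta>"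
        unfolding \<eta>_def blinfun.sum_right by (intro sum.cong) (simp_all add: L)
      have "blinfun_apply T (blinfun_apply (orbit_map q \<omega>) \<eta>) = blinfun_apply (orbit_map q \<omega>) (blinfun_apply S \<eta>)"
        unfolding \<eta>_def blinfun.sum_right
      proof (rule sum.cong)
        fix i assume i: "i \<in> F"
        show "blinfun_apply T (blinfun_apply (orbit_map q \<omega>) (cscale (c i) (ket (y i)))) =
          blinfun_apply (orbit_map q \<omega>) (blinfun_apply S (cscale (c i) (ket (y i))))"
          by (rule inter[OF i _ y[OF i]]) (intro ballI bspec[OF q], use i in blast)
      qed simp
      then show ?thesis
        unfolding \<xi> by (simp add: norm_orbit_map norm_blinfun)
    qed simp
  qed
qed

text \<open>Here the orbit maps are taken at point characters, where the matching condition holds for every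
  ideal. They intertwine on all of the orbit of \<open>q\<close>, and every block is such an orbit.\<close>

lemma paired_norm_ge:
  assumes ST: "(S, T) \<in> paired"
  shows "norm S \<le> norm T"
proof -
  define b where "b q = {y. \<exists>s\<in>left_inverse_hull. (q, y) \<in> s}" for q :: 'p
  have Sb: "S \<in> bounded_ops" using paired_bounded[OF ST] by simp
  have b: "b j = b i" if s: "s \<in> left_inverse_hull" "(i, j) \<in> s" for s i j
  proof -
    have "b j \<subseteq> b i" if "s \<in> left_inverse_hull" "(i, j) \<in> s" for s i j
      using left_inverse_hull.product[OF that(1)] that(2) unfolding b_def by blast
    from this[OF s] this[of "s\<inverse>" j i] s show ?thesis
      by (auto intro: left_inverse_hull.inverse)
  qed
  have block: "coord (blinfun_apply S (ket i)) j \<noteq> 0 \<Longrightarrow> b j = b i" for i j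
    using ST
  proof (induction rule: paired_induct)
    case (add S T S' T')
    then show ?case by (cases "coord (blinfun_apply S (ket i)) j = 0") (auto simp: blinfun.add_left)
  next
    case (generator c s)
    note ps = hull_partial_bij[OF generator(1)]
    show ?case
    proof (cases "i \<in> Domain s")
      case True
      then obtain j' where j': "(i, j') \<in> s" by auto
      with generator show ?thesis
        using pshift_ket[OF ps j', of 1] b[OF generator(1) j'] by (auto simp: op_scale_apply split: if_splits)
    next
      case False
      with generator(2) show ?thesis
        using pshift_ket_0[OF ps False, of 1] by (simp add: op_scale_apply)
    qed
  qed (auto simp: blinfun.add_left blinfun.scaleR_left)
  show ?thesis
  proof (rule norm_le_of_block_bounds[OF Sb norm_ge_zero block, where D = UNIV])
    fix F c
    assume F: "finite F" and eq: "\<And>i j. i \<in> F \<Longrightarrow> j \<in> F \<Longrightarrow> b i = b j"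
    show "norm (blinfun_apply S (\<Sum>i\<in>F. cscale (c i) (ket i))) \<le> norm T * norm (\<Sum>i\<in>F. cscale (c i) (ket i))"
    proof (cases "F = {}")
      case False
      then obtain q where q: "q \<in> F" by auto
      let ?L = "orbit_map q (point_character q)"
      define \<eta> where "\<eta> = (\<Sum>i\<in>F. cscale (c i) (ket i) :: 'p ell2)"
      have "blinfun_apply T (blinfun_apply ?L \<eta>) = blinfun_apply ?L (blinfun_apply S \<eta>)"
        unfolding \<eta>_def blinfun.sum_right
      proof (rule sum.cong)
        fix y assume y: "y \<in> F"
        have "y \<in> b y" using hull_Id by (auto simp: b_def)
        then obtain t where t: "t \<in> left_inverse_hull" "(q, y) \<in> t"
          unfolding eq[OF y q] by (auto simp: b_def)
        have "character (point_character q) (Domain t)"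
          using t by (auto simp: character_point Domain_constructible)
        from orbit_map_intertwines[OF ST t(1) this]
        show "blinfun_apply T (blinfun_apply ?L (cscale (c y) (ket y))) =
          blinfun_apply ?L (blinfun_apply S (cscale (c y) (ket y)))"
          using t(2) by (force simp: character_point)
      qed simp
      then have "norm (blinfun_apply S \<eta>) = norm (blinfun_apply T (blinfun_apply ?L \<eta>))"
        by (simp add: norm_orbit_map)
      also have "\<dots> \<le> norm T * norm \<eta>"
        using norm_blinfun[of T "blinfun_apply ?L \<eta>"] by (simp add: norm_orbit_map)
      finally show ?thesis by (simp add: \<eta>_def)
    qed simp
  qed auto
qed


section \<open>The reduced semigroup algebra\<close>

lemma semigroup_isometry_eq: "semigroup_isometry (p :: 'p) = pshift (range (\<lambda>x. (x, p + x)))"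
proof -
  have r: "partial_bij (range (\<lambda>x. (x, p + x)))"
    by (intro hull_partial_bij left_inverse_hull.translation)
  show ?thesis
    unfolding semigroup_isometry_def
    by (rule op_on_basis_eqI[OF pshift_bounded_ops[OF r]]) (use pshift_ket[OF r, of _ _ 1] in auto)
qed

lemma cstar_subalgebra_paired_fst: "cstar_subalgebra (closure (fst ` paired))"
proof (rule cstar_subalgebra_closure)
  show "fst ` paired \<subseteq> bounded_ops" using paired_bounded by auto
  have "(0, 0) \<in> paired" using subspace_0[OF subspace_paired] by (simp add: zero_prod_def)
  then show "0 \<in> fst ` paired" by force
  fix S S' assume "S \<in> fst ` paired" "S' \<in> fst ` paired"
  then obtain T T' where T: "(S, T) \<in> paired" "(S', T') \<in> paired" by auto
  show "S + S' \<in> fst ` paired" using subspace_add[OF subspace_paired T] by force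
  show "S o\<^sub>L S' \<in> fst ` paired" using paired_compose[OF T] by force
  show "op_scale c S \<in> fst ` paired" for c using paired_op_scale[OF T(1)] by force
  show "adj S \<in> fst ` paired" using paired_adj[OF T(1)] by force
qed

lemma reduced_semigroup_algebra_eq: "reduced_semigroup_algebra = closure (fst ` paired)"
proof
  have "pshift s \<in> fst ` paired" if "s \<in> left_inverse_hull" for s
    using paired_generator[OF that, of 1] by (force simp: op_scale_of_real[of 1, simplified])
  then have "range semigroup_isometry \<subseteq> closure (fst ` paired)"
    using closure_subset left_inverse_hull.translation by (force simp: semigroup_isometry_eq)
  then show "reduced_semigroup_algebra \<subseteq> closure (fst ` paired)"
    unfolding reduced_semigroup_algebra_def cstar_generated_def
    using cstar_subalgebra_paired_fst by blast
  show "closure (fst ` paired) \<subseteq> reduced_semigroup_algebra"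
    unfolding reduced_semigroup_algebra_def cstar_generated_def
  proof (intro Inter_greatest)
    fix B :: "'p operator set"
    assume "B \<in> {B. cstar_subalgebra B \<and> range semigroup_isometry \<subseteq> B}"
    then have B: "cstar_subalgebra B" and V: "range semigroup_isometry \<subseteq> B" by auto
    note BD = cstar_subalgebraD[OF B]
    have hull: "pshift s \<in> B" if "s \<in> left_inverse_hull" for s
      using that
    proof induction
      case (translation p)
      show ?case using V by (auto simp: semigroup_isometry_eq)
    next
      case (inverse s)
      then show ?case using BD(8)[of "pshift s"] by (simp add: adj_pshift hull_partial_bij)
    next
      case (product s t)
      then show ?case using BD(5)[of "pshift t" "pshift s"] by (simp add: pshift_compose hull_partial_bij)
    qed
    have "S \<in> B" if "(S, T) \<in> paired" for S T
      using that by (induction rule: paired_induct) (auto intro: BD hull)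
    then show "closure (fst ` paired) \<subseteq> B"
      by (intro closure_minimal BD(2)) auto
  qed
qed

lemma id_in_reduced_semigroup_algebra: "id_blinfun \<in> (reduced_semigroup_algebra :: 'p operator set)"
proof -
  have "id_blinfun \<in> fst ` paired"
    using paired_generator[OF hull_Id, of 1] by (force simp: op_scale_of_real[of 1, simplified] pshift_Id)
  then show ?thesis
    unfolding reduced_semigroup_algebra_eq by (rule closure_subset[THEN subsetD])
qed

end


section \<open>The spectrum as a compact Hausdorff space\<close>

lemma continuous_on_character: "continuous_on UNIV (character :: 'p::cancel_semigroup_add Omega \<Rightarrow> _)"
  unfolding continuous_on_open_vimage[OF open_UNIV] by (auto simp: open_Omega_def)

lemma
  shows open_character: "open {\<omega> :: 'p::cancel_semigroup_add Omega. character \<omega> X}"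
    and closed_character: "closed {\<omega> :: 'p::cancel_semigroup_add Omega. character \<omega> X}"
proof -
  have c: "continuous_on UNIV (\<lambda>\<omega> :: 'p Omega. character \<omega> X)"
    by (rule continuous_on_compose2[OF continuous_on_product_coordinates continuous_on_character subset_UNIV])
  have "open ((\<lambda>\<omega> :: 'p Omega. character \<omega> X) -` {True})"
    by (rule open_vimage[OF open_discrete c])
  then show "open {\<omega> :: 'p Omega. character \<omega> X}" by (simp add: vimage_def)
  have "open ((\<lambda>\<omega> :: 'p Omega. character \<omega> X) -` {False})"
    by (rule open_vimage[OF open_discrete c])
  then show "closed {\<omega> :: 'p Omega. character \<omega> X}" by (simp add: closed_def vimage_def Collect_neg_eq)
qed

instance Omega :: (cancel_semigroup_add) t2_space
proof
  fix \<omega> \<psi> :: "'a Omega"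
  assume "\<omega> \<noteq> \<psi>"
  then obtain X where X: "character \<omega> X \<noteq> character \<psi> X" using Omega_eqI by blast
  let ?U = "{\<omega> :: 'a Omega. character \<omega> X}"
  have "open ?U" "open (- ?U)" using open_character closed_character by (auto simp: open_Compl)
  then show "\<exists>U V. open U \<and> open V \<and> \<omega> \<in> U \<and> \<psi> \<in> V \<and> U \<inter> V = {}"
    using X by (cases "character \<omega> X") (blast, metis (no_types, lifting) ComplI Compl_disjoint inf_commute mem_Collect_eq)
qed

text \<open>Each condition defining the spectrum involves only finitely many values of the map. To make
  this visible, the existence of an ideal of value one is replaced by the condition on the largest
  ideal.\<close>

lemma closed_range_character: "closed (range (character :: 'p::cancel_semigroup_add Omega \<Rightarrow> _))"
proof -
  have op: "open {f :: 'p set \<Rightarrow> bool. f X}" and cl: "closed {f :: 'p set \<Rightarrow> bool. f X}" for X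
  proof -
    have "open ((\<lambda>f :: 'p set \<Rightarrow> bool. f X) -` {True})" "open ((\<lambda>f :: 'p set \<Rightarrow> bool. f X) -` {False})"
      by (intro open_vimage[OF open_discrete] continuous_on_product_coordinates)+
    then show "open {f :: 'p set \<Rightarrow> bool. f X}" "closed {f :: 'p set \<Rightarrow> bool. f X}"
      by (simp_all add: closed_def vimage_def Collect_neg_eq)
  qed
  let ?J = "constructible_ideals :: 'p set set"
  have "range (character :: 'p Omega \<Rightarrow> _) = {f.
      (\<forall>X. X \<notin> ?J \<longrightarrow> (f X \<longrightarrow> False)) \<and> f UNIV \<and>
      (\<forall>X Y. X \<in> ?J \<longrightarrow> Y \<in> ?J \<longrightarrow> (f (X \<inter> Y) \<longrightarrow> f X \<and> f Y) \<and> (f X \<and> f Y \<longrightarrow> f (X \<inter> Y))) \<and>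
      (f {} \<longrightarrow> False) \<and>
      (\<forall>\<F>. finite \<F> \<longrightarrow> \<F> \<subseteq> ?J \<longrightarrow> \<Union>\<F> \<in> ?J \<longrightarrow> (f (\<Union>\<F>) \<longrightarrow> (\<exists>Y\<in>\<F>. f Y)))}"
    (is "_ = ?R")
  proof
    show "range character \<subseteq> ?R"
    proof (rule image_subsetI)
      fix \<omega> :: "'p Omega"
      show "character \<omega> \<in> ?R"
      proof (intro CollectI conjI allI impI)
        show "character \<omega> X \<Longrightarrow> X \<notin> ?J \<Longrightarrow> False" for X
          using character_constructible[of \<omega> X] by simp
        fix X Y assume XY: "X \<in> ?J" "Y \<in> ?J"
        show "character \<omega> X" "character \<omega> Y" if "character \<omega> (X \<inter> Y)"
          using that character_Int[OF XY, of \<omega>] by simp_all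
        show "character \<omega> (X \<inter> Y)" if "character \<omega> X \<and> character \<omega> Y"
          using that character_Int[OF XY, of \<omega>] by simp
      next
        show "\<exists>Y\<in>\<F>. character \<omega> Y" if "finite \<F>" "\<F> \<subseteq> ?J" "character \<omega> (\<Union>\<F>)" for \<F>
          using that by (rule character_cover)
      qed (simp_all add: character_UNIV character_empty)
    qed
    show "?R \<subseteq> range character"
    proof
      fix f assume f: "f \<in> ?R"
      then have 1: "\<forall>X. X \<notin> ?J \<longrightarrow> (f X \<longrightarrow> False)" and 2: "f UNIV"
        and 3: "\<forall>X Y. X \<in> ?J \<longrightarrow> Y \<in> ?J \<longrightarrow> (f (X \<inter> Y) \<longrightarrow> f X \<and> f Y) \<and> (f X \<and> f Y \<longrightarrow> f (X \<inter> Y))"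
        and 4: "f {} \<longrightarrow> False"
        and 5: "\<forall>\<F>. finite \<F> \<longrightarrow> \<F> \<subseteq> ?J \<longrightarrow> \<Union>\<F> \<in> ?J \<longrightarrow> (f (\<Union>\<F>) \<longrightarrow> (\<exists>Y\<in>\<F>. f Y))"
        unfolding mem_Collect_eq by - (elim conjE, assumption)+
      have "f \<in> semilattice_characters"
        unfolding semilattice_characters_def
      proof (intro CollectI conjI)
        show "\<forall>X. X \<notin> ?J \<longrightarrow> \<not> f X" using 1 by simp
        show "\<exists>X\<in>?J. f X" using 2 UNIV_constructible by (rule rev_bexI[rotated])
        show "\<forall>X\<in>?J. \<forall>Y\<in>?J. f (X \<inter> Y) \<longleftrightarrow> f X \<and> f Y"
        proof (intro ballI)
          fix X Y assume "X \<in> ?J" "Y \<in> ?J"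
          then show "f (X \<inter> Y) \<longleftrightarrow> f X \<and> f Y" using 3[THEN spec, THEN spec, of X Y] by (metis (full_types))
        qed
        show "{} \<in> ?J \<longrightarrow> \<not> f {}" using 4 by simp
      qed
      then have "character (Abs_Omega f) = f"
        by (intro Abs_Omega_inverse CollectI conjI) (use 5 in auto)
      then show "f \<in> range character" by (metis rangeI)
    qed
  qed
  also have "closed \<dots>"
  proof -
    have hyp: "closed {f. P \<longrightarrow> Q f}" if "P \<Longrightarrow> closed {f. Q f}" for P and Q :: "('p set \<Rightarrow> bool) \<Rightarrow> bool"
      using that by (cases P) simp_all
    have neg: "closed {f :: 'p set \<Rightarrow> bool. f X \<longrightarrow> False}" for X
      by (intro closed_Collect_imp op) simp
    have meet: "closed {f :: 'p set \<Rightarrow> bool. (f (X \<inter> Y) \<longrightarrow> f X \<and> f Y) \<and> (f X \<and> f Y \<longrightarrow> f (X \<inter> Y))}" for X Y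
      by (intro closed_Collect_conj closed_Collect_imp open_Collect_conj op cl)
    have cover: "closed {f. f (\<Union>\<F>) \<longrightarrow> (\<exists>Y\<in>\<F>. f Y)}" if "finite \<F>" for \<F> :: "'p set set"
    proof (rule closed_Collect_imp[OF op])
      have "{f. \<exists>Y\<in>\<F>. f Y} = (\<Union>Y\<in>\<F>. {f :: 'p set \<Rightarrow> bool. f Y})" by auto
      also have "closed \<dots>" by (intro closed_UN that ballI cl)
      finally show "closed {f. \<exists>Y\<in>\<F>. f Y}" .
    qed
    show ?thesis
      by (intro closed_Collect_conj closed_Collect_all hyp neg meet cover cl)
  qed
  finally show ?thesis .
qed

lemma compact_Omega: "compact (UNIV :: 'p::cancel_semigroup_add Omega set)"
proof -
  have "compact_space (product_topology (\<lambda>_ :: 'p set. euclidean :: bool topology) UNIV)"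
    unfolding compact_space_product_topology
    by (auto simp: compact_space_def finite_imp_compact)
  then have "compact (UNIV :: ('p set \<Rightarrow> bool) set)"
    by (simp add: euclidean_product_topology compact_space_def)
  then have K: "compact (range (character :: 'p Omega \<Rightarrow> _))"
    using compact_Int_closed[OF _ closed_range_character] by fastforce
  have "continuous_on (range (character :: 'p Omega \<Rightarrow> _)) Abs_Omega"
    unfolding continuous_on_open_invariant
  proof (intro allI impI)
    fix W :: "'p Omega set" assume "open W"
    then obtain V where "open V" "W = character -` V" by (auto simp: open_Omega_def)
    then show "\<exists>A. open A \<and> A \<inter> range character = Abs_Omega -` W \<inter> range character"
      by (intro exI[of _ V]) (auto simp: character_inverse)
  qed
  from compact_continuous_image[OF this K] show ?thesis
    by (simp add: image_image character_inverse)
qed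

lemma C0_bounded:
  assumes "f \<in> C0 W"
  shows "\<exists>C. \<forall>x. cmod (f x) \<le> C"
proof -
  let ?K = "{x \<in> W. 1 \<le> cmod (f x)}"
  have "compact ?K" "continuous_on ?K f"
    using assms by (auto simp: C0_def intro: continuous_on_subset)
  then have "bounded (f ` ?K)" by (intro compact_imp_bounded compact_continuous_image)
  then obtain C where C: "\<forall>x\<in>?K. cmod (f x) \<le> C" by (auto simp: bounded_iff)
  have "cmod (f x) \<le> max C 1" for x
  proof (cases "x \<in> ?K")
    case False
    then have "cmod (f x) \<le> 1" using assms by (cases "x \<in> W") (auto simp: C0_def)
    then show ?thesis by simp
  qed (use C in \<open>auto simp: max.coboundedI1\<close>)
  then show ?thesis by blast
qed

lemma continuous_Omega_bounded:
  assumes "continuous_on UNIV (f :: 'p::cancel_semigroup_add Omega \<Rightarrow> complex)"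
  shows "\<exists>C. \<forall>x. cmod (f x) \<le> C"
  using compact_imp_bounded[OF compact_continuous_image[OF assms compact_Omega]] by (auto simp: bounded_iff)

lemma C0_of_clopen_support:
  fixes f :: "'p::cancel_semigroup_add Omega \<Rightarrow> complex"
  assumes f: "continuous_on UNIV f" and N: "N \<subseteq> W" "\<And>x. x \<notin> N \<Longrightarrow> f x = 0"
  shows "f \<in> C0 W"
  unfolding C0_def
proof (intro CollectI conjI allI impI)
  show "continuous_on W f" using f by (rule continuous_on_subset) simp
  show "f x = 0" if "x \<notin> W" for x using that N by auto
  fix e :: real assume "0 < e"
  then have "{x \<in> W. e \<le> cmod (f x)} = UNIV \<inter> {x. e \<le> cmod (f x)}" using N by fastforce
  also have "compact \<dots>"
    by (intro compact_Int_closed compact_Omega closed_Collect_le continuous_intros f)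
  finally show "compact {x \<in> W. e \<le> cmod (f x)}" .
qed

lemma continuous_on_indicator_clopen:
  fixes f :: "'a::topological_space \<Rightarrow> complex"
  assumes "open N" "closed N" "continuous_on N f"
  shows "continuous_on UNIV (\<lambda>x. if x \<in> N then f x else 0)"
proof -
  have "continuous_on (N \<union> - N) (\<lambda>x. if x \<in> N then f x else 0)"
    by (rule continuous_on_cases) (use assms in \<open>auto simp: closed_Compl\<close>)
  then show ?thesis by simp
qed

definition ideal_indicator :: "'p::cancel_semigroup_add set \<Rightarrow> 'p Omega \<Rightarrow> complex" where
  "ideal_indicator X \<omega> = of_bool (character \<omega> X)"

lemma continuous_ideal_indicator: "continuous_on UNIV (ideal_indicator X)"
proof -
  have "ideal_indicator X = (\<lambda>\<omega>. if \<omega> \<in> {\<omega>. character \<omega> X} then 1 else 0)"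
    by (auto simp: ideal_indicator_def)
  then show ?thesis
    using continuous_on_indicator_clopen[OF open_character closed_character, of X "\<lambda>_. 1"] by simp
qed


section \<open>The partial action on the spectrum\<close>

context semigroup_embedding
begin

lemma Omega_dom_uminus:
  "\<omega> \<in> Omega_dom \<iota> (- k) \<longleftrightarrow>
    (\<exists>t\<in>left_inverse_hull. group_value \<iota> t = k \<and> character \<omega> (Domain t))"
  unfolding Omega_dom_def mem_Collect_eq minus_minus using character_nonempty by blast

lemma Omega_dom_Range:
  "\<omega> \<in> Omega_dom \<iota> h \<longleftrightarrow>
    (\<exists>s\<in>left_inverse_hull. s \<noteq> {} \<and> group_value \<iota> s = h \<and> character \<omega> (Range s))"
proof
  assume "\<omega> \<in> Omega_dom \<iota> h"
  then obtain s where s: "s \<in> left_inverse_hull" "s \<noteq> {}" "group_value \<iota> s = - h" "character \<omega> (Domain s)"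
    by (auto simp: Omega_dom_def)
  then show "\<exists>s\<in>left_inverse_hull. s \<noteq> {} \<and> group_value \<iota> s = h \<and> character \<omega> (Range s)"
    by (intro bexI[of _ "s\<inverse>"]) (auto simp: group_value_converse left_inverse_hull.inverse)
next
  assume "\<exists>s\<in>left_inverse_hull. s \<noteq> {} \<and> group_value \<iota> s = h \<and> character \<omega> (Range s)"
  then obtain s where s: "s \<in> left_inverse_hull" "s \<noteq> {}" "group_value \<iota> s = h" "character \<omega> (Range s)"
    by auto
  then show "\<omega> \<in> Omega_dom \<iota> h"
    unfolding Omega_dom_def
    by (intro CollectI bexI[of _ "s\<inverse>"]) (auto simp: group_value_converse left_inverse_hull.inverse)
qed

lemma converse_Image_eq: "s\<inverse> `` X = Domain (s O Id_on X)"
  by auto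

text \<open>Partial bijections with the same group element agree where both are defined, so the pullback
  along any one of them meets the defining description for all of them.\<close>

lemma character_Omega_act:
  assumes t: "t \<in> left_inverse_hull" and ct: "character \<omega> (Domain t)"
    and X: "X \<in> constructible_ideals"
  shows "character (Omega_act \<iota> (group_value \<iota> t) \<omega>) X \<longleftrightarrow> character \<omega> (Domain (t O Id_on X))"
proof -
  let ?f = "\<lambda>X. X \<in> constructible_ideals \<and> character \<omega> (t\<inverse> `` X)"
  have tJ: "t\<inverse> `` X \<in> constructible_ideals" if "X \<in> constructible_ideals" for X
    unfolding converse_Image_eq by (intro Domain_constructible left_inverse_hull.product t hull_Id_on that)
  have tInt: "t\<inverse> `` (X \<inter> Y) = t\<inverse> `` X \<inter> t\<inverse> `` Y" for X Y
    using partial_bijD(1)[OF hull_partial_bij[OF t]] by (auto simp: Image_iff)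
  have "?f \<in> semilattice_characters"
    unfolding semilattice_characters_def
  proof (intro CollectI conjI allI impI ballI)
    have "t\<inverse> `` UNIV = Domain t" by auto
    then show "\<exists>X\<in>constructible_ideals. ?f X"
      using ct UNIV_constructible by (intro bexI[of _ UNIV]) auto
    show "?f (X \<inter> Y) \<longleftrightarrow> ?f X \<and> ?f Y" if "X \<in> constructible_ideals" "Y \<in> constructible_ideals" for X Y
      using that by (simp add: tInt character_Int tJ constructible_ideals_Int)
  qed (auto simp: character_empty)
  moreover have "\<exists>Y\<in>\<F>. ?f Y" if h: "finite \<F>" "\<F> \<subseteq> constructible_ideals" "X = \<Union>\<F>" "?f X" for X \<F>
  proof -
    have "t\<inverse> `` X = \<Union>((\<lambda>Y. t\<inverse> `` Y) ` \<F>)" using h(3) by auto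
    moreover have "(\<lambda>Y. t\<inverse> `` Y) ` \<F> \<subseteq> constructible_ideals" using h(2) tJ by blast
    ultimately obtain Y where "Y \<in> \<F>" "character \<omega> (t\<inverse> `` Y)"
      using character_cover[of "(\<lambda>Y. t\<inverse> `` Y) ` \<F>" \<omega>] h(1,4) by auto
    then show ?thesis using h(2) by blast
  qed
  ultimately have inv: "character (Abs_Omega ?f) = ?f"
    by (intro Abs_Omega_inverse) blast
  have "Omega_act \<iota> (group_value \<iota> t) \<omega> = Abs_Omega ?f"
    unfolding Omega_act_def
  proof (rule the_equality)
    show "\<forall>s\<in>left_inverse_hull. s \<noteq> {} \<and> group_value \<iota> s = group_value \<iota> t \<and> character \<omega> (Domain s) \<longrightarrow>
      (\<forall>X\<in>constructible_ideals. character (Abs_Omega ?f) X \<longleftrightarrow> character \<omega> (s\<inverse> `` (X \<inter> Range s)))"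
    proof (intro ballI impI)
      fix s and X :: "'p set" assume s: "s \<in> left_inverse_hull" and X: "X \<in> constructible_ideals"
        and *: "s \<noteq> {} \<and> group_value \<iota> s = group_value \<iota> t \<and> character \<omega> (Domain s)"
      have Xs: "s\<inverse> `` (X \<inter> Range s) = Domain (s O Id_on X)" by auto
      have v: "group_value \<iota> s = group_value \<iota> t" and cs: "character \<omega> (Domain s)" using * by auto
      have "character \<omega> (Domain (s O Id_on X)) \<longleftrightarrow> character \<omega> (Domain (t O Id_on X))"
        by (rule iffI[OF character_relcomp_cong[OF t s hull_Id_on[OF X] v[symmetric] ct]
              character_relcomp_cong[OF s t hull_Id_on[OF X] v cs]])
      then show "character (Abs_Omega ?f) X \<longleftrightarrow> character \<omega> (s\<inverse> `` (X \<inter> Range s))"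
        unfolding inv Xs using X by (simp add: converse_Image_eq[of t])
    qed
    fix \<psi>
    assume \<psi>: "\<forall>s\<in>left_inverse_hull. s \<noteq> {} \<and> group_value \<iota> s = group_value \<iota> t \<and> character \<omega> (Domain s) \<longrightarrow>
      (\<forall>X\<in>constructible_ideals. character \<psi> X \<longleftrightarrow> character \<omega> (s\<inverse> `` (X \<inter> Range s)))"
    have "t\<inverse> `` (X \<inter> Range t) = t\<inverse> `` X" for X by auto
    with \<psi> t ct character_nonempty[OF ct] show "\<psi> = Abs_Omega ?f"
      by (intro Omega_eqI) (simp add: inv)
  qed
  then have "character (Omega_act \<iota> (group_value \<iota> t) \<omega>) X \<longleftrightarrow> ?f X"
    by (simp only: inv)
  then show ?thesis using X by (simp add: converse_Image_eq)
qed

lemma character_Omega_act_Domain: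
  assumes t: "t \<in> left_inverse_hull" and ct: "character \<omega> (Domain t)"
    and s: "s \<in> left_inverse_hull"
  shows "character (Omega_act \<iota> (group_value \<iota> t) \<omega>) (Domain s) \<longleftrightarrow> character \<omega> (Domain (t O s))"
proof -
  have "Domain (t O Id_on (Domain s)) = Domain (t O s)" by auto
  then show ?thesis using character_Omega_act[OF t ct Domain_constructible[OF s]] by simp
qed


section \<open>Multiplication and translation operators\<close>

abbreviation "mu \<equiv> cp_mu (Omega_dom \<iota>) (Omega_act \<iota>)"
abbreviation "tr \<equiv> cp_V (Omega_dom \<iota>) (Omega_act \<iota>)"

definition mu_dom :: "('g \<times> 'p Omega) set" where
  "mu_dom = {(k, \<omega>). \<omega> \<in> Omega_dom \<iota> (- k)}"

definition tr_dom :: "'g \<Rightarrow> ('g \<times> 'p Omega) set" where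
  "tr_dom h = {(k, \<omega>). \<omega> \<in> Omega_dom \<iota> (- k) \<and> Omega_act \<iota> k \<omega> \<in> Omega_dom \<iota> (- h)}"

context
  fixes f :: "'p Omega \<Rightarrow> complex" and C :: real
  assumes f: "\<And>x. cmod (f x) \<le> C"
begin

lemma bounded_weight_mu: "bounded_weight (\<lambda>(k, \<omega>). f (Omega_act \<iota> k \<omega>)) (Id_on mu_dom)"
  unfolding bounded_weight_def by (intro exI[of _ C]) (auto intro: f)

lemma mu_eq_shift: "mu f = shift (\<lambda>(k, \<omega>). f (Omega_act \<iota> k \<omega>)) (Id_on mu_dom)"
proof -
  let ?c = "\<lambda>(k, \<omega>). f (Omega_act \<iota> k \<omega>)"
  note c = bounded_weight_mu
  show ?thesis
    unfolding cp_mu_def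
  proof (rule op_on_basis_eqI)
    show "shift ?c (Id_on mu_dom) \<in> bounded_ops" by (rule shift_bounded_ops[OF partial_bij_Id_on c])
    fix i :: "'g \<times> 'p Omega"
    obtain k \<omega> where i: "i = (k, \<omega>)" by force
    show "blinfun_apply (shift ?c (Id_on mu_dom)) (ket i) =
      (case i of (g, x) \<Rightarrow> if x \<in> Omega_dom \<iota> (- g) then cscale (f (Omega_act \<iota> g x)) (ket (g, x)) else 0)"
      using shift_ket[OF partial_bij_Id_on c, of i i 1] shift_ket_0[OF partial_bij_Id_on c, of i 1]
      by (auto simp: i mu_dom_def Id_on_def)
  qed
qed

lemma coord_mu:
  "coord (blinfun_apply (mu f) x) i =
    (if i \<in> mu_dom then f (Omega_act \<iota> (fst i) (snd i)) * coord x i else 0)"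
proof -
  let ?c = "\<lambda>(k, \<omega>). f (Omega_act \<iota> k \<omega>)"
  note c = bounded_weight_mu
  show ?thesis
    unfolding mu_eq_shift
    using coord_shift[OF partial_bij_Id_on c, of i i x] coord_shift_0[OF partial_bij_Id_on c, of i x]
    by (auto simp: case_prod_beta)
qed

lemma norm_mu: "norm (mu f) \<le> C"
proof -
  have "0 \<le> C" using f[of undefined] norm_ge_zero order_trans by blast
  then show ?thesis
    unfolding mu_eq_shift by (intro norm_shift_le[OF partial_bij_Id_on]) (use f in auto)
qed

lemma mu_bounded_ops: "mu f \<in> bounded_ops"
  unfolding mu_eq_shift by (rule shift_bounded_ops[OF partial_bij_Id_on bounded_weight_mu])

end

lemma mu_eqI:
  assumes "\<exists>C. \<forall>x. cmod (f x) \<le> C"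
    and "\<And>x i. coord (blinfun_apply A x) i =
      (if i \<in> mu_dom then f (Omega_act \<iota> (fst i) (snd i)) * coord x i else 0)"
  shows "mu f = A"
proof -
  from assms(1) obtain C where C: "\<And>x. cmod (f x) \<le> C" by blast
  show ?thesis by (intro blinfun_eqI ell2_eqI) (simp only: coord_mu[OF C] assms(2))
qed

lemma mu_add:
  assumes f: "\<exists>C. \<forall>x. cmod (f x) \<le> C" and g: "\<exists>C. \<forall>x. cmod (g x) \<le> C"
  shows "mu (\<lambda>x. f x + g x) = mu f + mu g"
proof -
  from f g obtain C D where C: "\<And>x. cmod (f x) \<le> C" and D: "\<And>x. cmod (g x) \<le> D" by blast
  show ?thesis
  proof (rule mu_eqI)
    show "\<exists>C. \<forall>x. cmod (f x + g x) \<le> C"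
      by (intro exI[of _ "C + D"] allI norm_triangle_le add_mono C D)
  qed (simp add: blinfun.add_left coord_mu[OF C] coord_mu[OF D] algebra_simps)
qed

lemma mu_mult:
  assumes f: "\<exists>C. \<forall>x. cmod (f x) \<le> C" and g: "\<exists>C. \<forall>x. cmod (g x) \<le> C"
  shows "mu (\<lambda>x. f x * g x) = mu f o\<^sub>L mu g"
proof -
  from f g obtain C D where C: "\<And>x. cmod (f x) \<le> C" and D: "\<And>x. cmod (g x) \<le> D" by blast
  have "0 \<le> C" using C[of undefined] norm_ge_zero order_trans by blast
  show ?thesis
  proof (rule mu_eqI)
    show "\<exists>C. \<forall>x. cmod (f x * g x) \<le> C"
      unfolding norm_mult
      by (intro exI[of _ "C * D"] allI mult_mono C D norm_ge_zero \<open>0 \<le> C\<close>)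
  qed (simp add: coord_mu[OF C] coord_mu[OF D])
qed

lemma mu_scale:
  assumes "\<exists>C. \<forall>x. cmod (f x) \<le> C"
  shows "mu (\<lambda>x. c * f x) = op_scale c (mu f)"
proof -
  from assms obtain C where C: "\<And>x. cmod (f x) \<le> C" by blast
  show ?thesis
  proof (rule mu_eqI)
    show "\<exists>C. \<forall>x. cmod (c * f x) \<le> C"
      unfolding norm_mult by (intro exI[of _ "cmod c * C"] allI mult_left_mono C norm_ge_zero)
  qed (simp add: op_scale_apply coord_mu[OF C])
qed

lemma mu_diff_norm:
  assumes f: "\<exists>C. \<forall>x. cmod (f x) \<le> C" and g: "\<exists>C. \<forall>x. cmod (g x) \<le> C"
    and e: "\<And>x. cmod (f x - g x) \<le> e"
  shows "norm (mu f - mu g) \<le> e"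
proof -
  from f g obtain C D where C: "\<And>x. cmod (f x) \<le> C" and D: "\<And>x. cmod (g x) \<le> D" by blast
  have "mu (\<lambda>x. f x - g x) = mu f - mu g"
    by (rule mu_eqI) (use e in \<open>auto simp: blinfun.diff_left coord_mu[OF C] coord_mu[OF D] algebra_simps\<close>)
  then show ?thesis using norm_mu[of "\<lambda>x. f x - g x" e] e by simp
qed

lemma bounded_ideal_indicator: "\<exists>C. \<forall>x. cmod (ideal_indicator X x) \<le> C"
  by (intro exI[of _ 1]) (simp add: ideal_indicator_def)

lemma ideal_indicator_C0:
  assumes "s \<in> left_inverse_hull" "s \<noteq> {}"
  shows "ideal_indicator (Range s) \<in> C0 (Omega_dom \<iota> (group_value \<iota> s))"
proof (rule C0_of_clopen_support[OF continuous_ideal_indicator])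
  show "{\<omega>. character \<omega> (Range s)} \<subseteq> Omega_dom \<iota> (group_value \<iota> s)"
    using assms by (auto simp: Omega_dom_Range)
qed (simp add: ideal_indicator_def)

lemma cp_lambda_eq:
  "(cp_lambda h :: ('g \<times> 'p Omega) operator) = pshift (range (\<lambda>(k, \<omega>). ((k, \<omega>), (h + k, \<omega>))))"
proof -
  have r: "partial_bij (range (\<lambda>(k, \<omega>). ((k :: 'g, \<omega> :: 'p Omega), (h + k, \<omega>))))"
    by (rule partial_bijI) auto
  show ?thesis
    unfolding cp_lambda_def
    by (rule op_on_basis_eqI[OF pshift_bounded_ops[OF r]]) (use pshift_ket[OF r, of _ _ 1] in force)
qed

text \<open>The projection in the definition of the translation operators is the coordinate projection
  onto \<open>tr_dom h\<close>: at each basis vector of \<open>tr_dom h\<close> some indicator function in \<open>C0\<close> is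
  nonzero, so the ranges reach that basis vector.\<close>

lemma cp_E_eq: "cp_E (Omega_dom \<iota>) (Omega_act \<iota>) h = pshift (Id_on (tr_dom h))"
proof -
  let ?E = "pshift (Id_on (tr_dom h))"
  define M where "M = {x :: ('g \<times> 'p Omega) ell2. \<forall>i. i \<notin> tr_dom h \<longrightarrow> coord x i = 0}"
  have coE: "coord (blinfun_apply ?E x) i = (if i \<in> tr_dom h then coord x i else 0)" for x i
    using coord_pshift[OF partial_bij_Id_on, of i i "tr_dom h" x] coord_pshift_0[OF partial_bij_Id_on, of i "tr_dom h" x]
    by auto
  have M_eq: "M = {x. blinfun_apply ?E x - x = 0}"
    by (auto simp: M_def intro!: ell2_eqI) (use coE in metis)+
  have M: "subspace M"
    by (auto simp: M_def subspace_def)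
  have Mcl: "closed M"
    unfolding M_eq by (intro closed_Collect_eq continuous_intros)
  let ?S = "\<Union>f\<in>C0 (Omega_dom \<iota> (- h)). range (blinfun_apply (mu f))"
  have "?S \<subseteq> M"
  proof
    fix x assume "x \<in> ?S"
    then obtain f y where f: "f \<in> C0 (Omega_dom \<iota> (- h))" and x: "x = blinfun_apply (mu f) y" by auto
    obtain C where C: "\<And>x. cmod (f x) \<le> C" using C0_bounded[OF f] by blast
    have f0: "f \<omega> = 0" if "\<omega> \<notin> Omega_dom \<iota> (- h)" for \<omega>
      using f that by (simp add: C0_def)
    show "x \<in> M"
      unfolding M_def x coord_mu[OF C] mem_Collect_eq
    proof (intro allI impI)
      fix i assume "i \<notin> tr_dom h"
      then show "(if i \<in> mu_dom then f (Omega_act \<iota> (fst i) (snd i)) * coord y i else 0) = 0"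
        by (cases i) (auto simp: tr_dom_def mu_dom_def intro: f0)
    qed
  qed
  then have "closure (span ?S) \<subseteq> M"
    by (intro closure_minimal Mcl span_minimal M)
  moreover have "M \<subseteq> closure (span ?S)"
  proof
    fix x assume x: "x \<in> M"
    show "x \<in> closure (span ?S)"
    proof (rule closed_subspace_contains_expansion)
      show "subspace (closure (span ?S))"
      proof (rule subspaceI)
        show "0 \<in> closure (span ?S)" by (intro closure_subset[THEN subsetD] span_0)
        show "u + v \<in> closure (span ?S)" if uv: "u \<in> closure (span ?S)" "v \<in> closure (span ?S)" for u v
        proof -
          from uv obtain a b where ab: "\<And>n. a n \<in> span ?S" "\<And>n. b n \<in> span ?S" and l: "a \<longlonglongrightarrow> u" "b \<longlonglongrightarrow> v"
            unfolding closure_sequential by blast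
          show ?thesis by (rule closureI_seq[OF tendsto_add[OF l]]) (rule span_add[OF ab])
        qed
        show "r *\<^sub>R u \<in> closure (span ?S)" if u: "u \<in> closure (span ?S)" for r u
        proof -
          from u obtain a where a: "\<And>n. a n \<in> span ?S" and l: "a \<longlonglongrightarrow> u"
            unfolding closure_sequential by blast
          show ?thesis by (rule closureI_seq[OF tendsto_scaleR[OF tendsto_const l]]) (rule span_scale[OF a])
        qed
      qed
      fix i assume "coord x i \<noteq> 0"
      with x have i: "i \<in> tr_dom h" unfolding M_def by blast
      obtain k \<omega> where k: "i = (k, \<omega>)" by force
      with i obtain s where s: "s \<in> left_inverse_hull" "s \<noteq> {}" "group_value \<iota> s = - h"
        "character (Omega_act \<iota> k \<omega>) (Range s)"
        by (auto simp: tr_dom_def Omega_dom_Range)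
      let ?f = "ideal_indicator (Range s)"
      have f: "?f \<in> C0 (Omega_dom \<iota> (- h))" using ideal_indicator_C0[OF s(1,2)] s(3) by simp
      have "blinfun_apply (mu ?f) (cscale (coord x i) (ket i)) = cscale (coord x i) (ket i)"
        using i k s(4)
        by (intro ell2_eqI) (auto simp: coord_mu[of ?f 1] ideal_indicator_def tr_dom_def mu_dom_def)
      then have "cscale (coord x i) (ket i) \<in> ?S" using f by (metis UN_I rangeI)
      then show "cscale (coord x i) (ket i) \<in> closure (span ?S)"
        by (intro closure_subset[THEN subsetD] span_base)
    qed simp
  qed
  ultimately have MS: "closure (span ?S) = M" by blast
  have orth: "cinner y z = 0" if "y \<in> M" "\<And>i. i \<in> tr_dom h \<Longrightarrow> coord z i = 0" for y z
  proof -
    have "cnj (coord y i) * coord z i = 0" for i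
    proof (cases "i \<in> tr_dom h")
      case False
      then have "coord y i = 0" using that(1) unfolding M_def by blast
      then show ?thesis by simp
    qed (simp add: that(2))
    then show ?thesis unfolding cinner_def by (simp only: infsum_0)
  qed
  show ?thesis
    unfolding cp_E_def MS proj_onto_def
  proof (rule the_equality)
    show "?E \<in> bounded_ops \<and> (\<forall>x. blinfun_apply ?E x \<in> M \<and> (\<forall>y\<in>M. cinner y (x - blinfun_apply ?E x) = 0))"
      by (auto intro!: pshift_bounded_ops partial_bij_Id_on orth simp: coE) (simp add: M_def coE)
    fix F assume F: "F \<in> bounded_ops \<and> (\<forall>x. blinfun_apply F x \<in> M \<and> (\<forall>y\<in>M. cinner y (x - blinfun_apply F x) = 0))"
    show "F = ?E"
    proof (rule blinfun_eqI)
      fix x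
      let ?d = "blinfun_apply F x - blinfun_apply ?E x"
      have d: "?d \<in> M" using F by (intro subspace_diff[OF M]) (auto simp: M_def coE)
      have "inner ?d (x - blinfun_apply F x) = 0" using F d by (simp add: inner_ell2_def)
      moreover have "inner ?d (x - blinfun_apply ?E x) = 0"
        using orth[OF d, of "x - blinfun_apply ?E x"] by (simp add: inner_ell2_def coE)
      ultimately have "inner ?d ?d = 0" by (simp add: inner_diff_right)
      then show "blinfun_apply F x = blinfun_apply ?E x" by simp
    qed
  qed
qed

definition tr_rel :: "'g \<Rightarrow> (('g \<times> 'p Omega) \<times> ('g \<times> 'p Omega)) set" where
  "tr_rel h = {((k, \<omega>), (h + k, \<omega>)) | k \<omega>. (k, \<omega>) \<in> tr_dom h}"

lemma partial_bij_tr_rel: "partial_bij (tr_rel h)"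
  by (rule partial_bijI) (auto simp: tr_rel_def)

lemma tr_eq: "tr h = pshift (tr_rel h)"
proof -
  have r: "partial_bij (range (\<lambda>(k, \<omega>). ((k :: 'g, \<omega> :: 'p Omega), (h + k, \<omega>))))"
    by (rule partial_bijI) auto
  have "Id_on (tr_dom h) O range (\<lambda>(k, \<omega>). ((k :: 'g, \<omega> :: 'p Omega), (h + k, \<omega>))) = tr_rel h"
    by (auto simp: tr_rel_def intro!: relcompI[OF Id_onI])
  then show ?thesis
    unfolding cp_V_def cp_lambda_eq cp_E_eq by (simp add: pshift_compose partial_bij_Id_on r)
qed

lemma norm_tr: "norm (tr h) \<le> 1"
  unfolding tr_eq by (rule norm_shift_le[OF partial_bij_tr_rel]) auto

text \<open>Multiplication looks at the translated point, so it asks for the range of \<open>s\<close>, whereas the lift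
  asks the original point for the domain. Both conditions come out as the same condition on
  \<open>\<omega>\<close>.\<close>

lemma mu_tr_eq_lift:
  assumes s: "s \<in> left_inverse_hull" and ne: "s \<noteq> {}"
  shows "mu (ideal_indicator (Range s)) o\<^sub>L tr (group_value \<iota> s) = pshift (lift s)"
proof (rule op_eqI)
  let ?h = "group_value \<iota> s" and ?f = "ideal_indicator (Range s)"
  have fb: "cmod (?f x) \<le> 1" for x by (simp add: ideal_indicator_def)
  show "mu ?f o\<^sub>L tr ?h \<in> bounded_ops"
    unfolding tr_eq by (intro bounded_ops_compose mu_bounded_ops[of ?f 1] pshift_bounded_ops partial_bij_tr_rel fb)
  show "pshift (lift s) \<in> bounded_ops" by (intro pshift_bounded_ops partial_bij_lift)
  have mu_ket: "blinfun_apply (mu ?f) (ket (k, \<omega>)) = ket (k, \<omega>)"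
    if "(k, \<omega>) \<in> mu_dom" "character (Omega_act \<iota> k \<omega>) (Range s)" for k \<omega>
    using that by (intro ell2_eqI) (auto simp: coord_mu[OF fb] ideal_indicator_def)
  have mu_ket_0: "blinfun_apply (mu ?f) (ket (k, \<omega>)) = 0"
    if "\<not> character (Omega_act \<iota> k \<omega>) (Range s)" for k \<omega>
    using that by (intro ell2_eqI) (auto simp: coord_mu[OF fb] ideal_indicator_def)
  fix i :: "'g \<times> 'p Omega"
  obtain k \<omega> where i: "i = (k, \<omega>)" by force
  show "blinfun_apply (mu ?f o\<^sub>L tr ?h) (ket i) = blinfun_apply (pshift (lift s)) (ket i)"
  proof (cases "i \<in> tr_dom ?h")
    case True
    then obtain t where t: "t \<in> left_inverse_hull" "group_value \<iota> t = k" "character \<omega> (Domain t)"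
      and act: "Omega_act \<iota> k \<omega> \<in> Omega_dom \<iota> (- ?h)"
      by (auto simp: i tr_dom_def Omega_dom_uminus)
    from act obtain s' where s': "s' \<in> left_inverse_hull" "group_value \<iota> s' = ?h"
      and cs': "character (Omega_act \<iota> k \<omega>) (Domain s')"
      by (auto simp: Omega_dom_uminus)
    have c: "character \<omega> (Domain (t O s'))"
      using cs' character_Omega_act_Domain[OF t(1,3) s'(1)] t(2) by simp
    note ts' = left_inverse_hull.product[OF t(1) s'(1)] and ts = left_inverse_hull.product[OF t(1) s]
    note s_inv = left_inverse_hull.inverse[OF s]
    have v: "group_value \<iota> (t O s') = ?h + k"
      using group_value_relcomp[OF t(1) s'(1) character_nonempty[OF c]] s'(2) t(2) by simp
    have dom: "(?h + k, \<omega>) \<in> mu_dom" using v c ts' by (auto simp: mu_dom_def Omega_dom_uminus)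
    \<comment> \<open>membership in the range of s after moving by the product of the group elements amounts to
       membership in the domain of s after moving by the first\<close>
    have "character (Omega_act \<iota> (?h + k) \<omega>) (Range s) \<longleftrightarrow> character \<omega> (Domain ((t O s') O s\<inverse>))"
      using character_Omega_act_Domain[OF ts' c s_inv] v by simp
    also have "\<dots> \<longleftrightarrow> character \<omega> (Domain (t O s))"
    proof
      assume h: "character \<omega> (Domain ((t O s') O s\<inverse>))"
      show "character \<omega> (Domain (t O s))"
      proof (rule character_mono[OF h _ Domain_constructible[OF ts]])
        show "Domain ((t O s') O s\<inverse>) \<subseteq> Domain (t O s)"
        proof clarify
          fix x y z w assume xy: "(x, y) \<in> t" and yz: "(y, z) \<in> s'" and wz: "(w, z) \<in> s"
          have "?h + \<iota> y = ?h + \<iota> w"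
            using group_value_apply[OF s'(1) yz] group_value_apply[OF s wz] s'(2) by simp
          then have "y = w" by (simp add: iota_eq)
          with xy wz show "x \<in> Domain (t O s)" by auto
        qed
      qed
    next
      assume h: "character \<omega> (Domain (t O s))"
      have "Domain ((t O s) O s\<inverse>) = Domain (t O s)" by auto
      moreover have "group_value \<iota> (t O s') = group_value \<iota> (t O s)"
        using v group_value_relcomp[OF t(1) s character_nonempty[OF h]] t(2) by simp
      ultimately show "character \<omega> (Domain ((t O s') O s\<inverse>))"
        using character_relcomp_cong[OF ts' ts s_inv _ c] h by simp
    qed
    finally have iff: "character (Omega_act \<iota> (?h + k) \<omega>) (Range s) \<longleftrightarrow> character \<omega> (Domain (t O s))" .
    have tr: "blinfun_apply (tr ?h) (ket i) = ket (?h + k, \<omega>)"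
      using pshift_ket[OF partial_bij_tr_rel, of i "(?h + k, \<omega>)" ?h 1] True
      by (auto simp: tr_eq tr_rel_def i)
    show ?thesis
    proof (cases "character \<omega> (Domain (t O s))")
      case True
      then have "(i, (?h + k, \<omega>)) \<in> lift s" using lift_iff[OF s t(1,3)] by (simp add: i t(2))
      from pshift_ket[OF partial_bij_lift this, of 1] show ?thesis
        using True iff dom by (simp add: tr mu_ket)
    next
      case False
      then have "i \<notin> Domain (lift s)" using lift_iff[OF s t(1,3)] by (auto simp: i t(2))
      from pshift_ket_0[OF partial_bij_lift this, of 1] show ?thesis
        using False iff by (simp add: tr mu_ket_0)
    qed
  next
    case False
    then have "i \<notin> Domain (tr_rel ?h)" by (auto simp: tr_rel_def)
    from pshift_ket_0[OF partial_bij_tr_rel this, of 1] have tr: "blinfun_apply (tr ?h) (ket i) = 0"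
      by (simp add: tr_eq)
    have "i \<notin> Domain (lift s)"
    proof
      assume "i \<in> Domain (lift s)"
      then obtain t where t: "t \<in> left_inverse_hull" "group_value \<iota> t = k" "character \<omega> (Domain (t O s))"
        by (auto simp: lift_def i)
      have ct: "character \<omega> (Domain t)"
        by (rule character_mono[OF t(3) _ Domain_constructible[OF t(1)]]) auto
      have "character (Omega_act \<iota> k \<omega>) (Domain s)"
        using character_Omega_act_Domain[OF t(1) ct s] t by simp
      with t(1,2) ct s False show False by (auto simp: i tr_dom_def Omega_dom_uminus)
    qed
    from pshift_ket_0[OF partial_bij_lift this, of 1] show ?thesis by (simp add: tr)
  qed
qed

lemma mu_ideal_indicator:
  assumes X: "X \<in> constructible_ideals"
  shows "mu (ideal_indicator X) = pshift (lift (Id_on X))"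
proof (rule op_eqI)
  let ?f = "ideal_indicator X"
  have fb: "cmod (?f x) \<le> 1" for x by (simp add: ideal_indicator_def)
  show "mu ?f \<in> bounded_ops" by (rule mu_bounded_ops[OF fb])
  show "pshift (lift (Id_on X)) \<in> bounded_ops" by (intro pshift_bounded_ops partial_bij_lift)
  fix i :: "'g \<times> 'p Omega"
  obtain k \<omega> where i: "i = (k, \<omega>)" by force
  show "blinfun_apply (mu ?f) (ket i) = blinfun_apply (pshift (lift (Id_on X))) (ket i)"
  proof (cases "\<exists>t\<in>left_inverse_hull. group_value \<iota> t = k \<and> character \<omega> (Domain (t O Id_on X))")
    case True
    then obtain t where t: "t \<in> left_inverse_hull" "group_value \<iota> t = k" "character \<omega> (Domain (t O Id_on X))"
      by blast
    have ct: "character \<omega> (Domain t)"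
      by (rule character_mono[OF t(3) _ Domain_constructible[OF t(1)]]) auto
    have dom: "i \<in> mu_dom" using t ct by (auto simp: i mu_dom_def Omega_dom_uminus)
    have "character (Omega_act \<iota> k \<omega>) X" using character_Omega_act[OF t(1) ct X] t by simp
    with dom have 1: "blinfun_apply (mu ?f) (ket i) = ket i"
      by (intro ell2_eqI) (auto simp: coord_mu[OF fb] ideal_indicator_def i)
    obtain x where "x \<in> X" using t(3) character_nonempty by blast
    then have "group_value \<iota> (Id_on X) = 0" using group_value[OF hull_Id_on[OF X], of x x] by auto
    then have "(i, i) \<in> lift (Id_on X)" using True by (auto simp: lift_def i)
    from pshift_ket[OF partial_bij_lift this, of 1] show ?thesis by (simp add: 1)
  next
    case False
    then have "i \<notin> Domain (lift (Id_on X))" by (auto simp: lift_def i)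
    from pshift_ket_0[OF partial_bij_lift this, of 1]
    have 1: "blinfun_apply (pshift (lift (Id_on X))) (ket i) = 0" by simp
    have "i \<notin> mu_dom \<or> \<not> character (Omega_act \<iota> k \<omega>) X"
      using False character_Omega_act[OF _ _ X] by (auto simp: i mu_dom_def Omega_dom_uminus)
    then show ?thesis
      unfolding 1 by (intro ell2_eqI) (auto simp: coord_mu[OF fb] ideal_indicator_def i)
  qed
qed


section \<open>The reduced crossed product as a closed span\<close>

lemma cstar_subalgebra_paired_snd: "cstar_subalgebra (closure (snd ` paired))"
proof (rule cstar_subalgebra_closure)
  show "snd ` paired \<subseteq> bounded_ops" using paired_bounded by auto
  have "(0, 0) \<in> paired" using subspace_0[OF subspace_paired] by (simp add: zero_prod_def)
  then show "0 \<in> snd ` paired" by force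
  fix T T' assume "T \<in> snd ` paired" "T' \<in> snd ` paired"
  then obtain S S' where S: "(S, T) \<in> paired" "(S', T') \<in> paired" by auto
  show "T + T' \<in> snd ` paired" using subspace_add[OF subspace_paired S] by force
  show "T o\<^sub>L T' \<in> snd ` paired" using paired_compose[OF S] by force
  show "op_scale c T \<in> snd ` paired" for c using paired_op_scale[OF S(1)] by force
  show "adj T \<in> snd ` paired" using paired_adj[OF S(1)] by force
qed

lemma pshift_lift_in: "s \<in> left_inverse_hull \<Longrightarrow> pshift (lift s) \<in> snd ` paired"
  using paired_generator[of s 1] by (force simp: op_scale_of_real[of 1, simplified])

lemma bounded_of_continuous_real:
  "continuous_on UNIV (r :: 'p Omega \<Rightarrow> real) \<Longrightarrow> \<exists>C. \<forall>x. cmod (complex_of_real (r x)) \<le> C"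
  by (intro continuous_Omega_bounded continuous_intros)

text \<open>By the Stone--Weierstrass theorem the multiplication operators of all continuous functions
  lie in the closed algebra of the lifted partial bijections, since those of the indicator functions of
  the constructible ideals do and these functions separate the characters.\<close>

lemma mu_continuous_real:
  fixes f :: "'p Omega \<Rightarrow> real"
  assumes f: "continuous_on UNIV f"
  shows "mu (\<lambda>x. complex_of_real (f x)) \<in> closure (snd ` paired)"
proof -
  let ?C = "closure (snd ` paired)"
  note C = cstar_subalgebraD[OF cstar_subalgebra_paired_snd]
  define R where "R = {r :: 'p Omega \<Rightarrow> real. continuous_on UNIV r \<and> mu (\<lambda>x. complex_of_real (r x)) \<in> ?C}"
  have ind: "mu (ideal_indicator X) \<in> ?C" if "X \<in> constructible_ideals" for X
    unfolding mu_ideal_indicator[OF that]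
    by (intro closure_subset[THEN subsetD] pshift_lift_in hull_Id_on that)
  interpret function_ring_on R UNIV
  proof
    show "compact (UNIV :: 'p Omega set)" by (rule compact_Omega)
    show "continuous_on UNIV r" if "r \<in> R" for r using that by (simp add: R_def)
    show "(\<lambda>x. r x + q x) \<in> R" "(\<lambda>x. r x * q x) \<in> R" if "r \<in> R" "q \<in> R" for r q
    proof -
      have r: "continuous_on UNIV r" "continuous_on UNIV q" and
        m: "mu (\<lambda>x. complex_of_real (r x)) \<in> ?C" "mu (\<lambda>x. complex_of_real (q x)) \<in> ?C"
        using that by (auto simp: R_def)
      note b = bounded_of_continuous_real[OF r(1)] bounded_of_continuous_real[OF r(2)]
      show "(\<lambda>x. r x + q x) \<in> R"
        using C(4)[OF m] r by (simp add: R_def mu_add[OF b] continuous_on_add)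
      show "(\<lambda>x. r x * q x) \<in> R"
        using C(5)[OF m] r by (simp add: R_def mu_mult[OF b] continuous_on_mult)
    qed
    show "(\<lambda>_. c) \<in> R" for c
    proof -
      have "mu (\<lambda>x. complex_of_real c * ideal_indicator UNIV x) \<in> ?C"
        unfolding mu_scale[OF bounded_ideal_indicator] by (intro C(6) ind UNIV_constructible)
      then show ?thesis by (simp add: R_def ideal_indicator_def character_UNIV)
    qed
    show "\<exists>r\<in>R. r \<omega> \<noteq> r \<psi>" if "\<omega> \<noteq> \<psi>" for \<omega> \<psi>
    proof -
      obtain X where X: "X \<in> constructible_ideals" "character \<omega> X \<noteq> character \<psi> X"
        using \<open>\<omega> \<noteq> \<psi>\<close> Omega_eqI by blast
      let ?r = "\<lambda>x. Re (ideal_indicator X x)"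
      have "(\<lambda>x. complex_of_real (?r x)) = ideal_indicator X" by (auto simp: ideal_indicator_def)
      then have "?r \<in> R"
        using ind[OF X(1)] continuous_on_Re[OF continuous_ideal_indicator] by (simp add: R_def)
      then show ?thesis by (rule rev_bexI) (use X(2) in \<open>auto simp: ideal_indicator_def\<close>)
    qed
  qed
  show ?thesis
  proof (rule in_closed_if_approx[OF C(2)])
    fix e :: real assume "0 < e"
    then obtain r where r: "r \<in> R" "\<forall>x. \<bar>f x - r x\<bar> < e"
      using Stone_Weierstrass_basic[OF f] by auto
    then have "continuous_on UNIV r" by (simp add: R_def)
    then have "norm (mu (\<lambda>x. complex_of_real (f x)) - mu (\<lambda>x. complex_of_real (r x))) \<le> e"
    proof (intro mu_diff_norm bounded_of_continuous_real f)
      fix x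
      have "cmod (complex_of_real (f x) - complex_of_real (r x)) = \<bar>f x - r x\<bar>"
        by (metis norm_of_real of_real_diff)
      then show "cmod (complex_of_real (f x) - complex_of_real (r x)) \<le> e"
        using r(2) by (simp add: less_imp_le)
    qed
    with r(1) show "\<exists>y\<in>?C. norm (mu (\<lambda>x. complex_of_real (f x)) - y) \<le> e" by (auto simp: R_def)
  qed
qed

lemma mu_continuous:
  assumes f: "continuous_on UNIV f"
  shows "mu f \<in> closure (snd ` paired)"
proof -
  note C = cstar_subalgebraD[OF cstar_subalgebra_paired_snd]
  have re: "continuous_on UNIV (\<lambda>x. Re (f x))" and im: "continuous_on UNIV (\<lambda>x. Im (f x))"
    by (intro continuous_intros f)+
  note b = bounded_of_continuous_real[OF re] bounded_of_continuous_real[OF im]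
  have bi: "\<exists>C. \<forall>x. cmod (\<i> * complex_of_real (Im (f x))) \<le> C"
    using b(2) by (simp add: norm_mult)
  have "f = (\<lambda>x. complex_of_real (Re (f x)) + \<i> * complex_of_real (Im (f x)))"
    by (simp add: complex_eq[symmetric])
  then have "mu f = mu (\<lambda>x. complex_of_real (Re (f x)) + \<i> * complex_of_real (Im (f x)))" by simp
  also have "\<dots> = mu (\<lambda>x. complex_of_real (Re (f x))) + op_scale \<i> (mu (\<lambda>x. complex_of_real (Im (f x))))"
    by (simp only: mu_add[OF b(1) bi] mu_scale[OF b(2)])
  also have "\<dots> \<in> closure (snd ` paired)"
    by (intro C(4,6) mu_continuous_real re im)
  finally show ?thesis .
qed

lemma mu_zero: "mu (\<lambda>_. 0) = 0"
  by (rule mu_eqI) (auto intro: exI[of _ 0])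

text \<open>The function is split off the clopen sets given by the ranges one at a time; on each of these,
  translation by \<open>h\<close> is the operator of a single lifted partial bijection.\<close>

lemma mu_tr_clopen_support:
  assumes "finite A" "A \<subseteq> {s \<in> left_inverse_hull. s \<noteq> {} \<and> group_value \<iota> s = h}"
    and "continuous_on UNIV f" "\<And>x. (\<And>s. s \<in> A \<Longrightarrow> \<not> character x (Range s)) \<Longrightarrow> f x = 0"
  shows "mu f o\<^sub>L tr h \<in> closure (snd ` paired)"
  using assms
proof (induction A arbitrary: f)
  case empty
  then have "f = (\<lambda>_. 0)" by auto
  then show ?case
    using cstar_subalgebraD(3)[OF cstar_subalgebra_paired_snd]
    by (simp add: mu_zero bounded_bilinear.zero_left[OF bounded_bilinear_blinfun_compose])
next
  case (insert s A)
  let ?C = "closure (snd ` paired)" and ?i = "ideal_indicator (Range s)"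
  note C = cstar_subalgebraD[OF cstar_subalgebra_paired_snd]
  have s: "s \<in> left_inverse_hull" "s \<noteq> {}" "group_value \<iota> s = h" using insert.prems(1) by auto
  let ?f1 = "\<lambda>x. f x * ?i x" and ?f2 = "\<lambda>x. f x * (1 - ?i x)"
  have cont: "continuous_on UNIV ?f1" "continuous_on UNIV ?f2"
    by (intro continuous_intros insert.prems continuous_ideal_indicator)+
  have "f = (\<lambda>x. ?f1 x + ?f2 x)" by (simp add: algebra_simps)
  then have "mu f = mu (\<lambda>x. ?f1 x + ?f2 x)" by simp
  also have "\<dots> = mu ?f1 + mu ?f2"
    by (intro mu_add continuous_Omega_bounded cont)
  finally have "mu f o\<^sub>L tr h = (mu ?f1 o\<^sub>L tr h) + (mu ?f2 o\<^sub>L tr h)"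
    by (simp add: bounded_bilinear.add_left[OF bounded_bilinear_blinfun_compose])
  moreover have "mu ?f1 o\<^sub>L tr h \<in> ?C"
  proof -
    have "mu ?f1 o\<^sub>L tr h = mu f o\<^sub>L (mu ?i o\<^sub>L tr h)"
      unfolding mu_mult[OF continuous_Omega_bounded[OF insert.prems(2)] bounded_ideal_indicator]
      by (rule blinfun_eqI) simp
    also have "\<dots> = mu f o\<^sub>L pshift (lift s)" using mu_tr_eq_lift[OF s(1,2)] s(3) by simp
    also have "\<dots> \<in> ?C"
      by (intro C(5) mu_continuous insert.prems(2) closure_subset[THEN subsetD] pshift_lift_in s)
    finally show ?thesis .
  qed
  moreover have "mu ?f2 o\<^sub>L tr h \<in> ?C"
  proof (rule insert.IH)
    show "?f2 x = 0" if "\<And>u. u \<in> A \<Longrightarrow> \<not> character x (Range u)" for x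
      using insert.prems(3)[of x] that by (cases "character x (Range s)") (auto simp: ideal_indicator_def)
  qed (use insert.prems cont in auto)
  ultimately show ?case using C(4) by simp
qed

text \<open>The set where \<open>f\<close> is not small is compact, so finitely many of the clopen sets that make up
  \<open>Omega_dom \<iota> h\<close> cover it. Cutting \<open>f\<close> off outside these changes it little.\<close>

lemma mu_tr_C0:
  assumes f: "f \<in> C0 (Omega_dom \<iota> h)"
  shows "mu f o\<^sub>L tr h \<in> closure (snd ` paired)"
proof (rule in_closed_if_approx[OF cstar_subalgebraD(2)[OF cstar_subalgebra_paired_snd]])
  fix e :: real assume e: "0 < e"
  let ?K = "{x \<in> Omega_dom \<iota> h. e \<le> cmod (f x)}"
  let ?A = "{s \<in> left_inverse_hull. s \<noteq> {} \<and> group_value \<iota> s = h}"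
  have "compact ?K" using f e by (simp add: C0_def)
  then obtain A where A: "A \<subseteq> ?A" "finite A" "?K \<subseteq> (\<Union>s\<in>A. {x. character x (Range s)})"
  proof (rule compactE_image[where C = ?A])
    show "open {x :: 'p Omega. character x (Range s)}" for s :: "('p \<times> 'p) set" by (rule open_character)
    show "?K \<subseteq> (\<Union>s\<in>?A. {x. character x (Range s)})" by (auto simp: Omega_dom_Range)
  qed
  define N where "N = (\<Union>s\<in>A. {x :: 'p Omega. character x (Range s)})"
  define g where "g = (\<lambda>x. if x \<in> N then f x else 0)"
  have NU: "N \<subseteq> Omega_dom \<iota> h"
  proof
    fix x assume "x \<in> N"
    then obtain s where "s \<in> A" "character x (Range s)" by (auto simp: N_def)
    with A(1) show "x \<in> Omega_dom \<iota> h" unfolding Omega_dom_Range by blast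
  qed
  have "open N" unfolding N_def by (intro open_UN ballI open_character)
  moreover have "closed N" unfolding N_def by (intro closed_UN A(2) ballI closed_character)
  moreover have "continuous_on N f" using f NU by (auto simp: C0_def intro: continuous_on_subset)
  ultimately have g: "continuous_on UNIV g" unfolding g_def by (rule continuous_on_indicator_clopen)
  have "mu g o\<^sub>L tr h \<in> closure (snd ` paired)"
    by (rule mu_tr_clopen_support[OF A(2,1) g]) (auto simp: g_def N_def)
  moreover have "norm ((mu f o\<^sub>L tr h) - (mu g o\<^sub>L tr h)) \<le> e"
  proof -
    have "norm ((mu f - mu g) o\<^sub>L tr h) \<le> norm (mu f - mu g) * norm (tr h)" by (rule norm_blinfun_compose)
    also have "\<dots> \<le> e * 1"
    proof (intro mult_mono mu_diff_norm C0_bounded[OF f] continuous_Omega_bounded[OF g] norm_tr)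
      fix x show "cmod (f x - g x) \<le> e"
      proof (cases "x \<in> N")
        case False
        then have "x \<notin> ?K" using A(3) by (auto simp: N_def)
        then show ?thesis using False f e by (cases "x \<in> Omega_dom \<iota> h") (auto simp: g_def C0_def)
      qed (use e in \<open>simp add: g_def\<close>)
    qed (use e in auto)
    finally show ?thesis by (simp add: bounded_bilinear.diff_left[OF bounded_bilinear_blinfun_compose])
  qed
  ultimately show "\<exists>y\<in>closure (snd ` paired). norm ((mu f o\<^sub>L tr h) - y) \<le> e" by blast
qed

abbreviation "rep \<equiv> cp_rep (Omega_dom \<iota>) (Omega_act \<iota>)"

text \<open>Finite sums with coefficients that are continuous on the whole spectrum already reach the
  span of the lifted partial bijections. Unlike the general coefficients, they are visibly closed
  under addition and need no estimate for summability.\<close>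

definition finite_family :: "('g \<Rightarrow> 'p Omega \<Rightarrow> complex) \<Rightarrow> bool" where
  "finite_family a \<longleftrightarrow> finite {g. a g \<noteq> (\<lambda>_. 0)} \<and>
    (\<forall>g. continuous_on UNIV (a g) \<and> (\<exists>N\<subseteq>Omega_dom \<iota> g. \<forall>x. x \<notin> N \<longrightarrow> a g x = 0))"

lemma rep_finite:
  assumes "finite G" "{g. a g \<noteq> (\<lambda>_. 0)} \<subseteq> G"
  shows "rep a = (\<Sum>g\<in>G. mu (a g) o\<^sub>L tr g)"
proof -
  have "rep a = (\<Sum>\<^sub>\<infinity>g\<in>G. mu (a g) o\<^sub>L tr g)"
    unfolding cp_rep_def
  proof (rule infsum_cong_neutral)
    fix g assume "g \<in> UNIV - G"
    with assms(2) have "a g = (\<lambda>_. 0)" by auto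
    then show "mu (a g) o\<^sub>L tr g = 0"
      by (simp add: mu_zero bounded_bilinear.zero_left[OF bounded_bilinear_blinfun_compose])
  qed auto
  then show ?thesis using assms(1) by simp
qed

lemma finite_family_ell1:
  assumes a: "finite_family a"
  shows "a \<in> cp_ell1 (Omega_dom \<iota>)"
  unfolding cp_ell1_def
proof (intro CollectI conjI allI)
  show "a g \<in> C0 (Omega_dom \<iota> g)" for g
    using a C0_of_clopen_support[of "a g"] unfolding finite_family_def by blast
  have "(\<lambda>g. SUP x. cmod (a g x)) summable_on {g. a g \<noteq> (\<lambda>_. 0)}"
    using a by (simp add: finite_family_def)
  then show "(\<lambda>g. SUP x. cmod (a g x)) summable_on UNIV"
    by (rule summable_on_cong_neutral[THEN iffD1, rotated -1]) auto
qed

lemma rep_delta: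
  "rep (cp_delta f h) = mu f o\<^sub>L tr h"
  by (subst rep_finite[of "{h}"]) (auto simp: cp_delta_def)

lemma paired_snd_finite:
  assumes "(S, T) \<in> paired"
  shows "\<exists>a. finite_family a \<and> rep a = T"
  using assms
proof (induction rule: paired_induct)
  case zero
  have "rep (\<lambda>_ _. 0) = 0" by (subst rep_finite[of "{}"]) auto
  moreover have "finite_family (\<lambda>_ _. 0)" by (auto simp: finite_family_def)
  ultimately show ?case by blast
next
  case (add S T S' T')
  then obtain a b where a: "finite_family a" "rep a = T" and b: "finite_family b" "rep b = T'" by blast
  let ?G = "{g. a g \<noteq> (\<lambda>_. 0)} \<union> {g. b g \<noteq> (\<lambda>_. 0)}" and ?c = "\<lambda>g x. a g x + b g x"
  have sub: "{g. ?c g \<noteq> (\<lambda>_. 0)} \<subseteq> ?G" by auto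
  have fin: "finite ?G" using a b by (simp add: finite_family_def)
  have bd: "\<exists>C. \<forall>x. cmod (a g x) \<le> C" "\<exists>C. \<forall>x. cmod (b g x) \<le> C" for g
    using a b by (auto simp: finite_family_def intro: continuous_Omega_bounded)
  have "rep ?c = (\<Sum>g\<in>?G. (mu (a g) o\<^sub>L tr g) + (mu (b g) o\<^sub>L tr g))"
    unfolding rep_finite[OF fin sub]
    by (simp add: mu_add[OF bd] bounded_bilinear.add_left[OF bounded_bilinear_blinfun_compose])
  also have "\<dots> = T + T'"
    using rep_finite[of ?G a] rep_finite[of ?G b] fin a b by (simp add: sum.distrib)
  finally have "rep ?c = T + T'" .
  moreover have "finite_family ?c"
    unfolding finite_family_def
  proof (intro conjI allI)
    show "finite {g. ?c g \<noteq> (\<lambda>_. 0)}" by (rule finite_subset[OF sub fin])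
    fix g
    show "continuous_on UNIV (?c g)"
      using a b by (intro continuous_intros) (auto simp: finite_family_def)
    obtain N N' where "N \<subseteq> Omega_dom \<iota> g" "N' \<subseteq> Omega_dom \<iota> g"
      "\<forall>x. x \<notin> N \<longrightarrow> a g x = 0" "\<forall>x. x \<notin> N' \<longrightarrow> b g x = 0"
      using a b unfolding finite_family_def by metis
    then show "\<exists>N\<subseteq>Omega_dom \<iota> g. \<forall>x. x \<notin> N \<longrightarrow> ?c g x = 0"
      by (intro exI[of _ "N \<union> N'"]) auto
  qed
  ultimately show ?case by blast
next
  case (scaleR r S T)
  then obtain a where a: "finite_family a" "rep a = T" by blast
  let ?G = "{g. a g \<noteq> (\<lambda>_. 0)}" and ?c = "\<lambda>g x. complex_of_real r * a g x"
  have sub: "{g. ?c g \<noteq> (\<lambda>_. 0)} \<subseteq> ?G" by auto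
  have fin: "finite ?G" using a by (simp add: finite_family_def)
  have bd: "\<exists>C. \<forall>x. cmod (a g x) \<le> C" for g
    using a by (auto simp: finite_family_def intro: continuous_Omega_bounded)
  have "rep ?c = (\<Sum>g\<in>?G. r *\<^sub>R (mu (a g) o\<^sub>L tr g))"
    unfolding rep_finite[OF fin sub]
    by (simp add: mu_scale[OF bd] op_scale_of_real bounded_bilinear.scaleR_left[OF bounded_bilinear_blinfun_compose])
  also have "\<dots> = r *\<^sub>R T"
    using rep_finite[of ?G a] fin a by (simp add: scaleR_sum_right)
  finally have "rep ?c = r *\<^sub>R T" .
  moreover have "finite_family ?c"
    unfolding finite_family_def
  proof (intro conjI allI)
    show "finite {g. ?c g \<noteq> (\<lambda>_. 0)}" by (rule finite_subset[OF sub fin])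
    fix g
    show "continuous_on UNIV (?c g)"
      using a by (intro continuous_intros) (auto simp: finite_family_def)
    obtain N where "N \<subseteq> Omega_dom \<iota> g" "\<forall>x. x \<notin> N \<longrightarrow> a g x = 0"
      using a unfolding finite_family_def by metis
    then show "\<exists>N\<subseteq>Omega_dom \<iota> g. \<forall>x. x \<notin> N \<longrightarrow> ?c g x = 0"
      by (intro exI[of _ N]) auto
  qed
  ultimately show ?case by blast
next
  case (generator c s)
  show ?case
  proof (cases "s = {}")
    case True
    have "lift {} = {}" by (auto simp: lift_def character_empty)
    then have "op_scale c (pshift (lift s)) = 0"
      using True linear_0[OF bounded_linear.linear[OF bounded_linear_op_scale]] by (simp add: pshift_empty)
    moreover have "rep (\<lambda>_ _. 0) = 0" by (subst rep_finite[of "{}"]) auto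
    moreover have "finite_family (\<lambda>_ _. 0)" by (auto simp: finite_family_def)
    ultimately show ?thesis by metis
  next
    case False
    let ?a = "cp_delta (\<lambda>x. c * ideal_indicator (Range s) x) (group_value \<iota> s)"
    have "rep ?a = op_scale c (mu (ideal_indicator (Range s)) o\<^sub>L tr (group_value \<iota> s))"
      unfolding rep_delta mu_scale[OF bounded_ideal_indicator]
      by (rule blinfun_eqI) (simp add: op_scale_apply)
    also have "\<dots> = op_scale c (pshift (lift s))" by (simp add: mu_tr_eq_lift[OF generator False])
    finally have "rep ?a = op_scale c (pshift (lift s))" .
    moreover have "finite_family ?a"
      unfolding finite_family_def
    proof (intro conjI allI)
      show "finite {g. ?a g \<noteq> (\<lambda>_. 0)}"
        by (rule finite_subset[of _ "{group_value \<iota> s}"]) (auto simp: cp_delta_def)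
      fix g
      show "continuous_on UNIV (?a g)"
        by (auto simp: cp_delta_def intro!: continuous_intros continuous_ideal_indicator)
      show "\<exists>N\<subseteq>Omega_dom \<iota> g. \<forall>x. x \<notin> N \<longrightarrow> ?a g x = 0"
      proof (cases "g = group_value \<iota> s")
        case True
        show ?thesis
          by (intro exI[of _ "{\<omega>. character \<omega> (Range s)}"] conjI)
            (use generator False True in \<open>auto simp: Omega_dom_Range cp_delta_def ideal_indicator_def\<close>)
      qed (auto simp: cp_delta_def)
    qed
    ultimately show ?thesis by blast
  qed
qed

lemma reduced_crossed_product_eq:
  "reduced_crossed_product (Omega_dom \<iota>) (Omega_act \<iota>) = closure (snd ` paired)"
  unfolding reduced_crossed_product_def
proof
  note C = cstar_subalgebra_paired_snd
  have "rep a \<in> closure (snd ` paired)" if "a \<in> cp_ell1 (Omega_dom \<iota>)" for a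
    unfolding cp_rep_def
    by (intro infsum_in_closed_subspace cstar_subalgebra_subspace[OF C] cstar_subalgebraD(2)[OF C] mu_tr_C0)
      (use that in \<open>simp add: cp_ell1_def\<close>)
  then show "closure (rep ` cp_ell1 (Omega_dom \<iota>)) \<subseteq> closure (snd ` paired)"
    by (intro closure_minimal) auto
  have "snd ` paired \<subseteq> rep ` cp_ell1 (Omega_dom \<iota>)"
  proof
    fix T assume "T \<in> snd ` paired"
    then obtain S where "(S, T) \<in> paired" by auto
    from paired_snd_finite[OF this] obtain a where "finite_family a" "rep a = T" by blast
    then show "T \<in> rep ` cp_ell1 (Omega_dom \<iota>)" using finite_family_ell1 by blast
  qed
  then show "closure (snd ` paired) \<subseteq> closure (rep ` cp_ell1 (Omega_dom \<iota>))"
    by (rule closure_mono)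
qed

lemma canonical_isometry_eq: "canonical_isometry \<iota> p = pshift (lift (range (\<lambda>x. (x, p + x))))"
proof -
  let ?s = "range (\<lambda>x. (x, p + x))"
  have s: "?s \<in> left_inverse_hull" by (rule left_inverse_hull.translation)
  have "group_value \<iota> ?s = \<iota> p" using group_value[OF s, of p "p + p"] by (auto simp: hom)
  moreover have "Range ?s = range (\<lambda>x. p + x)" by auto
  moreover have "?s \<noteq> {}" by auto
  ultimately show ?thesis
    using mu_tr_eq_lift[OF s] unfolding canonical_isometry_def rep_delta
    by (simp add: ideal_indicator_def[abs_def])
qed

lemma paired_isometries: "(semigroup_isometry p, canonical_isometry \<iota> p) \<in> paired"
  using paired_generator[OF left_inverse_hull.translation, of 1 p]
  by (simp add: semigroup_isometry_eq canonical_isometry_eq op_scale_of_real[of 1, simplified])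

end


section \<open>The isomorphism\<close>

theorem theorem6p41:
  fixes \<iota> :: "'p::{cancel_semigroup_add, countable} \<Rightarrow> 'g::{group_add, countable}"
  assumes hom: "\<And>p q. \<iota> (p + q) = \<iota> p + \<iota> q"
    and inj: "inj \<iota>"
  shows "\<exists>\<Phi>. star_isomorphism \<Phi> (reduced_semigroup_algebra :: 'p operator set)
                (reduced_crossed_product (Omega_dom \<iota>) (Omega_act \<iota>)) \<and>
              (\<forall>p. \<Phi> (semigroup_isometry p) = canonical_isometry \<iota> p) \<and>
              (\<forall>\<Psi>. star_isomorphism \<Psi> (reduced_semigroup_algebra :: 'p operator set)
                      (reduced_crossed_product (Omega_dom \<iota>) (Omega_act \<iota>)) \<and>
                    (\<forall>p. \<Psi> (semigroup_isometry p) = canonical_isometry \<iota> p) \<longrightarrow>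
                    (\<forall>S\<in>reduced_semigroup_algebra. \<Psi> S = \<Phi> S))"
proof -
  interpret semigroup_embedding \<iota> by unfold_locales (rule hom, rule inj)
  let ?A = "reduced_semigroup_algebra :: 'p operator set"
  let ?B = "reduced_crossed_product (Omega_dom \<iota>) (Omega_act \<iota>)"
  have "\<exists>\<Phi>. star_isomorphism \<Phi> (closure (fst ` paired)) (closure (snd ` paired)) \<and>
      (\<forall>(S, T)\<in>paired. \<Phi> S = T)"
  proof (rule star_isomorphism_of_isometric_relation)
    show "paired \<subseteq> bounded_ops \<times> bounded_ops" using paired_bounded by auto
    show "norm S = norm T" if "(S, T) \<in> paired" for S T
      using paired_norm_le[OF that] paired_norm_ge[OF that] by simp
  qed (intro subspace_paired paired_compose paired_op_scale paired_adj; assumption)+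
  then obtain \<Phi> where iso: "star_isomorphism \<Phi> ?A ?B" and \<Phi>: "\<forall>(S, T)\<in>paired. \<Phi> S = T"
    unfolding reduced_semigroup_algebra_eq reduced_crossed_product_eq by blast
  have V: "\<Phi> (semigroup_isometry p) = canonical_isometry \<iota> p" for p
    using bspec[OF \<Phi> paired_isometries, of p] by simp
  have "\<Psi> S = \<Phi> S" if \<Psi>: "star_isomorphism \<Psi> ?A ?B" "\<forall>p. \<Psi> (semigroup_isometry p) = canonical_isometry \<iota> p"
    and S: "S \<in> ?A" for \<Psi> S
  proof (rule star_isomorphism_agree[of \<Phi> "range semigroup_isometry" ?B])
    show "star_isomorphism \<Phi> (cstar_generated (range semigroup_isometry)) ?B"
      "star_isomorphism \<Psi> (cstar_generated (range semigroup_isometry)) ?B"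
      "S \<in> cstar_generated (range semigroup_isometry)"
      using iso \<Psi>(1) S by (simp_all add: reduced_semigroup_algebra_def)
    show "cstar_subalgebra (cstar_generated (range semigroup_isometry) :: 'p operator set)"
      using cstar_subalgebra_paired_fst
      by (simp add: reduced_semigroup_algebra_eq[symmetric]) (simp add: reduced_semigroup_algebra_def)
    show "id_blinfun \<in> (cstar_generated (range semigroup_isometry) :: 'p operator set)"
      using id_in_reduced_semigroup_algebra by (simp add: reduced_semigroup_algebra_def)
    show "?B \<subseteq> bounded_ops"
      using cstar_subalgebraD(1)[OF cstar_subalgebra_paired_snd] by (simp add: reduced_crossed_product_eq)
    show "\<Phi> V' = \<Psi> V'" if "V' \<in> range semigroup_isometry" for V'
      using that V \<Psi>(2) by auto
  qed
  with iso V show ?thesis by blast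
qed

end
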